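(* In the subspace setting with noisy measurements $\boldsymbol y_l=\mathrm{diag}(\boldsymbol B\boldsymbol b)\boldsymbol A_l\boldsymbol Z\boldsymbol z+\boldsymbol\nu_l$ and $\sigma=\frac1{\sqrt{mp}}\|(\boldsymbol\nu_1,\dots,\boldsymbol\nu_p)\|_F$, given $\delta\in(0,1)$ and $t\ge1$, assume $n\gtrsim t\log(mp)$, $mp\gtrsim t\delta^{-2}(k+\mu_{\max}^2h)\log^2(m(p+n))\log\frac1\delta$, $\rho<\frac{1-4\delta}{31}$ and $\sigma\le c_1\|\boldsymbol z\|$ for a fixed constant $c_1>0$; set $\eta=1-4\delta-31\rho$. There is a universal constant $c>0$ such that with $\mu_0=c\frac{\eta}{m}\min\big(1,\frac{\|\boldsymbol z\|^2}{\sigma^2}\big)$, for any $0<\mu<\mu_0$ and with probability exceeding $1-C(mp)^{-t}$ for some $C>0$, the iterates $$\boldsymbol\zeta_0=\tfrac1{mp}\textstyle\sum_l(\boldsymbol A_l\boldsymbol Z)^\top\boldsymbol y_l,\ \boldsymbol\beta_0=(\sqrt m,\boldsymbol 0_{h-1}^\top)^\top,\quad \boldsymbol\zeta_{j+1}=\boldsymbol\zeta_j-\mu\nabla_{\boldsymbol\zeta}\tilde f^{\rm s}(\boldsymbol\zeta_j,\boldsymbol\beta_j),\quad \boldsymbol\beta_{j+1}=\mathcal P_{\mathcal B_\rho}\Big(\boldsymbol\beta_j-\mu\tfrac m{\|\boldsymbol z\|^2}\nabla^\perp_{\boldsymbol\beta}\tilde f^{\rm s}(\boldsymbol\zeta_j,\boldsymbol\beta_j)\Big)$$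 satisfy, for all $j\ge0$, $\Delta(\boldsymbol\zeta_j,\boldsymbol\beta_j)\le C'\big[(1-\eta\mu)^j\|\boldsymbol z\|^2+\frac1\eta\sigma\|\boldsymbol z\|\big]$ for a constant $C'>0$ depending only on $c_1$. Hence $\limsup_{j\to\infty}\Delta(\boldsymbol\zeta_j,\boldsymbol\beta_j)\le C'\frac1\eta\sigma\|\boldsymbol z\|$.
   Context: Random model: $X$ centred with $\mathbb EX^2=1$ and sub-Gaussian norm $\alpha<\infty$; $\boldsymbol a\in\mathbb R^n$ with i.i.d. entries $\sim X$; $\boldsymbol a_{i,l}$ ($i\in[m],l\in[p]$) i.i.d. copies; $\boldsymbol A_l$ has rows $\boldsymbol a_{i,l}^\top$. Bernoulli restriction: if $\mathbb EX^4=1$ then $n>1$ and $\|\boldsymbol x/\|\boldsymbol x\|\|_4^4\le1-c_0/n$. $\gtrsim$ hides large constants depending only on $\alpha$ (and $c_0$). Noise vectors $\boldsymbol\nu_l\in\mathbb R^m$ arbitrary. Subspace setting: $\boldsymbol Z\in\mathbb R^{n\times k}$, $\boldsymbol Z^\top\boldsymbol Z=\boldsymbol I_k$; $\boldsymbol B=(\boldsymbol 1_m/\sqrt m,\boldsymbol B^\perp)\in\mathbb R^{m\times h}$ with orthonormal columns, columns of $\boldsymbol B^\perp$ in $\boldsymbol 1_m^\perp$; $\boldsymbol x=\boldsymbol Z\boldsymbol z\ne\boldsymbol 0$; $\boldsymbol g=\boldsymbol B\boldsymbol b$, $\boldsymbol b=(\sqrt m,(\boldsymbol b^\perp)^\top)^\top$,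 $\boldsymbol g\in\mathcal G_\rho=\{\boldsymbol 1_m+\boldsymbol e:\boldsymbol 1_m^\top\boldsymbol e=0,\|\boldsymbol e\|_\infty\le\rho\}$. $\mu_{\max}=\sqrt{m/h}\max_i\|\boldsymbol B^\top\boldsymbol c_i\|$. Noisy objective $\tilde f^{\rm s}(\boldsymbol\zeta,\boldsymbol\beta)=\frac1{2mp}\sum_l\|\mathrm{diag}(\boldsymbol B\boldsymbol\beta)\boldsymbol A_l\boldsymbol Z\boldsymbol\zeta-\boldsymbol y_l\|^2$ with partial gradients $\nabla_{\boldsymbol\zeta}\tilde f^{\rm s},\nabla_{\boldsymbol\beta}\tilde f^{\rm s}$ and $\nabla^\perp_{\boldsymbol\beta}\tilde f^{\rm s}=\mathrm{diag}(0,1,\dots,1)\nabla_{\boldsymbol\beta}\tilde f^{\rm s}$. $\mathcal B_\rho=\{\boldsymbol v\in\mathbb R^h:\boldsymbol B\boldsymbol v\in\mathcal G_\rho\}$, $\mathcal P_{\mathcal B_\rho}$ Euclidean projection onto it. $\Delta(\boldsymbol\zeta,\boldsymbol\beta)=\|\boldsymbol\zeta-\boldsymbol z\|^2+\frac{\|\boldsymbol z\|^2}m\|\boldsymbol\beta-\boldsymbol b\|^2$. *)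

theory Defs
  imports "HOL-Probability.Probability"
begin

text \<open>Vectors/matrices of varying dimension are represented as functions on nat
  (resp. nat => nat), only the indices below the stated dimension being meaningful.\<close>

definition subg_set :: "real measure \<Rightarrow> real set" where
  "subg_set M = {s. s > 0 \<and> (\<integral>\<^sup>+ x. ennreal (exp (x\<^sup>2 / s\<^sup>2)) \<partial>M) \<le> 2}"

definition subgaussian_norm :: "real measure \<Rightarrow> real" where
  "subgaussian_norm M = Inf (subg_set M)"

definition matvec :: "nat \<Rightarrow> (nat \<Rightarrow> nat \<Rightarrow> real) \<Rightarrow> (nat \<Rightarrow> real) \<Rightarrow> nat \<Rightarrow> real" where
  "matvec d M v = (\<lambda>i. \<Sum>a<d. M i a * v a)"

definition fs :: "nat \<Rightarrow> nat \<Rightarrow> nat \<Rightarrow> nat \<Rightarrow> nat \<Rightarrow> (nat \<Rightarrow> nat \<Rightarrow> nat \<Rightarrow> real)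
   \<Rightarrow> (nat \<Rightarrow> nat \<Rightarrow> real) \<Rightarrow> (nat \<Rightarrow> nat \<Rightarrow> real) \<Rightarrow> (nat \<Rightarrow> nat \<Rightarrow> real)
   \<Rightarrow> (nat \<Rightarrow> real) \<Rightarrow> (nat \<Rightarrow> real) \<Rightarrow> real" where
  "fs m p n k h A Z B y \<zeta> \<beta> =
     (1 / (2 * real m * real p)) *
     (\<Sum>l<p. \<Sum>i<m. (matvec h B \<beta> i * matvec n (A l) (matvec k Z \<zeta>) i - y l i)\<^sup>2)"

definition pdiff :: "((nat \<Rightarrow> real) \<Rightarrow> real) \<Rightarrow> (nat \<Rightarrow> real) \<Rightarrow> nat \<Rightarrow> real" where
  "pdiff g v a = deriv (\<lambda>s. g (v(a := v a + s))) 0"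

definition grad :: "nat \<Rightarrow> ((nat \<Rightarrow> real) \<Rightarrow> real) \<Rightarrow> (nat \<Rightarrow> real) \<Rightarrow> nat \<Rightarrow> real" where
  "grad d g v = (\<lambda>a. if a < d then pdiff g v a else 0)"

definition perp0 :: "(nat \<Rightarrow> real) \<Rightarrow> nat \<Rightarrow> real" where
  "perp0 v = (\<lambda>a. if a = 0 then 0 else v a)"

definition G_rho :: "nat \<Rightarrow> real \<Rightarrow> (nat \<Rightarrow> real) set" where
  "G_rho m \<rho> = {g. (\<Sum>i<m. g i - 1) = 0 \<and> (\<forall>i<m. \<bar>g i - 1\<bar> \<le> \<rho>)}"

definition B_rho :: "nat \<Rightarrow> nat \<Rightarrow> (nat \<Rightarrow> nat \<Rightarrow> real) \<Rightarrow> real \<Rightarrow> (nat \<Rightarrow> real) set" where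
  "B_rho m h B \<rho> = {v. (\<forall>a\<ge>h. v a = 0) \<and> matvec h B v \<in> G_rho m \<rho>}"

definition proj :: "nat \<Rightarrow> (nat \<Rightarrow> real) set \<Rightarrow> (nat \<Rightarrow> real) \<Rightarrow> nat \<Rightarrow> real" where
  "proj h S w = (SOME v. v \<in> S \<and> (\<forall>u\<in>S. (\<Sum>a<h. (v a - w a)\<^sup>2) \<le> (\<Sum>a<h. (u a - w a)\<^sup>2)))"

primrec gd_iter :: "((nat \<Rightarrow> real) \<Rightarrow> (nat \<Rightarrow> real) \<Rightarrow> real) \<Rightarrow> nat \<Rightarrow> nat \<Rightarrow> real \<Rightarrow> real
   \<Rightarrow> (nat \<Rightarrow> real) set \<Rightarrow> (nat \<Rightarrow> real) \<Rightarrow> (nat \<Rightarrow> real) \<Rightarrow> nat \<Rightarrow> (nat \<Rightarrow> real) \<times> (nat \<Rightarrow> real)" where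
  "gd_iter f k h \<mu> s S \<zeta>0 \<beta>0 0 = (\<zeta>0, \<beta>0)"
| "gd_iter f k h \<mu> s S \<zeta>0 \<beta>0 (Suc j) =
     (let (\<zeta>, \<beta>) = gd_iter f k h \<mu> s S \<zeta>0 \<beta>0 j in
       (\<lambda>a. \<zeta> a - \<mu> * grad k (\<lambda>\<zeta>'. f \<zeta>' \<beta>) \<zeta> a,
        proj h S (\<lambda>a. \<beta> a - \<mu> * s * perp0 (grad h (\<lambda>\<beta>'. f \<zeta> \<beta>') \<beta>) a)))"

definition Delta :: "nat \<Rightarrow> nat \<Rightarrow> nat \<Rightarrow> (nat \<Rightarrow> real) \<Rightarrow> (nat \<Rightarrow> real) \<Rightarrow> (nat \<Rightarrow> real) \<Rightarrow> (nat \<Rightarrow> real) \<Rightarrow> real" where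
  "Delta m k h z b \<zeta> \<beta> =
     (\<Sum>a<k. (\<zeta> a - z a)\<^sup>2) + (\<Sum>a<k. (z a)\<^sup>2) / real m * (\<Sum>a<h. (\<beta> a - b a)\<^sup>2)"

definition mu_max :: "nat \<Rightarrow> nat \<Rightarrow> (nat \<Rightarrow> nat \<Rightarrow> real) \<Rightarrow> real" where
  "mu_max m h B = sqrt (real m / real h) * Max ((\<lambda>i. sqrt (\<Sum>a<h. (B i a)\<^sup>2)) ` {..<m})"

end

theory Submission
  imports Defs
begin

text \<open>
  With high probability the measurements satisfy two inequalities, and given these the iteration
  contracts deterministically. For \<open>u = \<zeta> - z\<close> and \<open>v = \<beta> - b\<close> the noiseless residual is
  \<open>diag(B \<beta>) A Z u + diag(B v) A Z z\<close>. Since \<open>\<bar>B \<beta> - 1\<bar> \<le> \<rho> \<le> 1/31\<close> on the constraint set, it is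
  close to the linear map \<open>(u, v) \<mapsto> A Z u + diag(B v) A Z z\<close>, so a lower bound for the smallest
  singular value of this map and an upper bound for the largest singular value of \<open>A Z\<close> give a
  regularity condition with an absolute constant; the slack in that constant absorbs \<open>\<rho>\<close>.

  The upper bound follows from a net argument. The rows of the linear map are anisotropic, their
  squared lengths being of order \<open>k + \<mu>\<^sub>m\<^sub>a\<^sub>x\<^sup>2 h\<close>, and a net would be too expensive. Because only a
  lower bound is needed, the rows may be truncated at this length, and the moments
  \<open>E tr X\<^sup>2\<^sup>r\<close> of the centred sum \<open>X\<close> of their rank-one matrices are bounded recursively: replacing one
  row by an independent copy turns \<open>E tr(Y\<^sub>j X\<^sup>2\<^sup>r\<^sup>-\<^sup>1)\<close> into a difference of powers, which telescopes.
  Taking \<open>r\<close> of order \<open>t ln (m p)\<close> costs only one logarithm.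
\<close>

section \<open>Traces of powers of symmetric matrices\<close>

text \<open>For unrestricted \<open>v\<close> the linear map has a kernel: the scaling
  \<open>u = z\<close> is undone by a constant change of the gains. All feasible
  \<open>\<beta>\<close> share their coordinate 0, so only \<open>v 0 = 0\<close> occurs; the other
  columns of \<open>B\<close> sum to zero, and then the two blocks are uncorrelated after averaging
  over the rows. The expected form, divided by the number of rows, is thus exactly |u|^2 + |z|^2
  |v|^2 / m, the quantity behind \<open>Delta\<close>. Its constant 1 drops to 9/10: truncation
  costs 1/20 and the fluctuation another 1/20. What is left gives contraction by
  \<open>1 - \<mu>\<close>, and the rate \<open>1 - \<eta> * \<mu>\<close> follows from \<eta> \<le>
  1. The step size is of order 1/m because an entry of \<open>B v\<close> is bounded by the length
  of \<open>v\<close> alone; the noise level enters it because the gradient in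
  \<open>\<beta>\<close> grows with \<open>\<zeta>\<close>, and the noise limits how far
  \<open>\<zeta>\<close> may be from \<open>z\<close>.\<close>

definition mmul :: "nat \<Rightarrow> (nat \<Rightarrow> nat \<Rightarrow> real) \<Rightarrow> (nat \<Rightarrow> nat \<Rightarrow> real) \<Rightarrow> nat \<Rightarrow> nat \<Rightarrow> real" where
  "mmul d A B = (\<lambda>i j. \<Sum>k<d. A i k * B k j)"

definition frob :: "nat \<Rightarrow> (nat \<Rightarrow> nat \<Rightarrow> real) \<Rightarrow> (nat \<Rightarrow> nat \<Rightarrow> real) \<Rightarrow> real" where
  "frob d A B = (\<Sum>i<d. \<Sum>j<d. A i j * B i j)"

text \<open>Zero outside the leading block, hence a unit only for matrices supported there.\<close>

definition idm :: "nat \<Rightarrow> nat \<Rightarrow> nat \<Rightarrow> real" where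
  "idm d = (\<lambda>i j. if i = j \<and> i < d then 1 else 0)"

definition mpow :: "nat \<Rightarrow> (nat \<Rightarrow> nat \<Rightarrow> real) \<Rightarrow> nat \<Rightarrow> nat \<Rightarrow> nat \<Rightarrow> real" where
  "mpow d X q = (mmul d X ^^ q) (idm d)"

lemma mmul_assoc: "mmul d (mmul d A B) C = mmul d A (mmul d B C)"
proof (intro ext)
  fix i j
  have "(\<Sum>k<d. (\<Sum>l<d. A i l * B l k) * C k j) = (\<Sum>k<d. \<Sum>l<d. A i l * B l k * C k j)"
    by (simp add: sum_distrib_right)
  also have "\<dots> = (\<Sum>l<d. \<Sum>k<d. A i l * B l k * C k j)"
    by (rule sum.swap)
  also have "\<dots> = (\<Sum>l<d. A i l * (\<Sum>k<d. B l k * C k j))"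
    by (simp add: sum_distrib_left mult.assoc)
  finally show "mmul d (mmul d A B) C i j = mmul d A (mmul d B C) i j"
    by (simp add: mmul_def)
qed

lemma frob_commute: "frob d A B = frob d B A"
  by (simp add: frob_def mult.commute)

lemma frob_nonneg: "0 \<le> frob d A A"
  by (simp add: frob_def sum_nonneg)

lemma frob_diff_left: "frob d (\<lambda>i j. A i j - B i j) C = frob d A C - frob d B C"
  by (simp add: frob_def left_diff_distrib sum_subtractf)

lemma frob_Cauchy_Schwarz: "(frob d A B)\<^sup>2 \<le> frob d A A * frob d B B"
proof -
  have *: "frob d A B = (\<Sum>x\<in>{..<d}\<times>{..<d}. (case_prod A x) * (case_prod B x))" for A B
    by (simp add: frob_def sum.cartesian_product case_prod_unfold)
  show ?thesis
    unfolding * using Cauchy_Schwarz_ineq_sum[of "case_prod A" "case_prod B" "{..<d}\<times>{..<d}"]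
    by (simp add: power2_eq_square)
qed

lemma frob_AM_GM: "2 * \<bar>frob d A B\<bar> \<le> frob d A A + frob d B B"
proof -
  have "(frob d A B)\<^sup>2 \<le> ((frob d A A + frob d B B) / 2)\<^sup>2"
    using frob_Cauchy_Schwarz[of d A B] sum_squares_bound[of "frob d A A" "frob d B B"]
    by (auto simp: power2_eq_square field_simps)
  then have "\<bar>frob d A B\<bar> \<le> (frob d A A + frob d B B) / 2"
    using abs_le_square_iff[of "frob d A B" "(frob d A A + frob d B B) / 2"] frob_nonneg[of d A] frob_nonneg[of d B]
    by simp
  then show ?thesis by simp
qed

lemma frob_mmul_left:
  assumes "\<And>i j. W i j = W j i"
  shows "frob d (mmul d W A) B = frob d A (mmul d W B)"
proof -
  have "frob d (mmul d W A) B = (\<Sum>i<d. \<Sum>j<d. \<Sum>k<d. W i k * A k j * B i j)"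
    by (simp add: frob_def mmul_def sum_distrib_right)
  also have "\<dots> = (\<Sum>j<d. \<Sum>i<d. \<Sum>k<d. W i k * A k j * B i j)"
    by (rule sum.swap)
  also have "\<dots> = (\<Sum>j<d. \<Sum>k<d. \<Sum>i<d. W i k * A k j * B i j)"
    by (intro sum.cong refl sum.swap)
  also have "\<dots> = (\<Sum>k<d. \<Sum>j<d. \<Sum>i<d. W i k * A k j * B i j)"
    by (rule sum.swap)
  also have "\<dots> = frob d A (mmul d W B)"
    unfolding frob_def mmul_def sum_distrib_left
    by (intro sum.cong refl) (metis assms mult.assoc mult.left_commute)
  finally show ?thesis .
qed

lemma frob_mmul_right:
  assumes "\<And>i j. Y i j = Y j i"
  shows "frob d (mmul d A Y) B = frob d A (mmul d B Y)"
proof -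
  have "frob d (mmul d A Y) B = (\<Sum>i<d. \<Sum>j<d. \<Sum>k<d. A i k * Y k j * B i j)"
    by (simp add: frob_def mmul_def sum_distrib_right)
  also have "\<dots> = (\<Sum>i<d. \<Sum>k<d. \<Sum>j<d. A i k * Y k j * B i j)"
    by (intro sum.cong refl sum.swap)
  also have "\<dots> = frob d A (mmul d B Y)"
    unfolding frob_def mmul_def sum_distrib_left
    by (intro sum.cong refl) (metis assms mult.assoc mult.commute)
  finally show ?thesis .
qed

text \<open>Discrete maximum principle: at the leftmost interior maximiser the left neighbour is
  strictly smaller, which contradicts midpoint convexity.\<close>

lemma convex_seq_le_endpoints:
  fixes c :: "nat \<Rightarrow> real"
  assumes conv: "\<And>i. 0 < i \<Longrightarrow> i < n \<Longrightarrow> 2 * c i \<le> c (i - 1) + c (i + 1)" and "i \<le> n"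
  shows "c i \<le> max (c 0) (c n)"
proof (rule ccontr)
  assume neg: "\<not> ?thesis"
  define M where "M = Max (c ` {..n})"
  have M: "c j \<le> M" if "j \<le> n" for j
    using that by (auto simp: M_def)
  have "M \<in> c ` {..n}" unfolding M_def by (rule Max_in) auto
  then have ex: "\<exists>j. j \<le> n \<and> c j = M" by auto
  define j where "j = (LEAST j. j \<le> n \<and> c j = M)"
  have j: "j \<le> n" "c j = M" using LeastI_ex[OF ex] by (auto simp: j_def)
  have "M \<ge> c i" using M \<open>i \<le> n\<close> by auto
  then have "c j > c 0" "c j > c n" using neg j by auto
  then have "j \<noteq> 0" "j \<noteq> n" by (metis less_irrefl)+
  then have j': "0 < j" "j < n" using j by auto
  have "j - 1 < j" "j - 1 \<le> n" using j' by auto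
  then have "c (j - 1) \<noteq> M" using not_less_Least[of "j - 1" "\<lambda>j. j \<le> n \<and> c j = M"] 
    unfolding j_def[symmetric] by blast
  moreover have "c (j - 1) \<le> M" by (rule M) fact
  ultimately have "c (j - 1) < M" by linarith
  moreover have "c (j + 1) \<le> M" using M[of "j+1"] j' by auto
  ultimately show False using conv[OF j'] j by auto
qed

text \<open>The product W^a D Y^b. It iterates the multiplication instead of using
  \<open>mpow\<close>, whose start \<open>idm\<close> is a unit only on supported matrices; the
  shift rules then hold for every \<open>D\<close>.\<close>

definition lrmul :: "nat \<Rightarrow> (nat \<Rightarrow> nat \<Rightarrow> real) \<Rightarrow> (nat \<Rightarrow> nat \<Rightarrow> real) \<Rightarrow> nat \<Rightarrow> nat
    \<Rightarrow> (nat \<Rightarrow> nat \<Rightarrow> real) \<Rightarrow> nat \<Rightarrow> nat \<Rightarrow> real" where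
  "lrmul d W Y a b D = (mmul d W ^^ a) (((\<lambda>M. mmul d M Y) ^^ b) D)"

lemma lrmul_Suc_left: "mmul d W (lrmul d W Y a b D) = lrmul d W Y (Suc a) b D"
  by (simp add: lrmul_def)

lemma lrmul_Suc_right: "mmul d (lrmul d W Y a b D) Y = lrmul d W Y a (Suc b) D"
proof -
  have "mmul d ((mmul d W ^^ a) M) Y = (mmul d W ^^ a) (mmul d M Y)" for M
    by (induction a) (simp_all add: mmul_assoc)
  then show ?thesis by (simp add: lrmul_def)
qed

text \<open>Left and right multiplication by symmetric matrices are self-adjoint for
  \<open>frob\<close>, so factors cross over one at a time. For \<open>E = D\<close> one mixed
  product becomes an inner product in several ways, which is the source of the convexity
  below.\<close>

lemma frob_lrmul:
  assumes W: "\<And>i j. W i j = W j i" and Y: "\<And>i j. Y i j = Y j i"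
  shows "frob d (lrmul d W Y (a + a') (b + b') D) E = frob d (lrmul d W Y a b D) (lrmul d W Y a' b' E)"
proof (induction a' arbitrary: a)
  case 0
  show ?case
  proof (induction b' arbitrary: b)
    case 0 show ?case by (simp add: lrmul_def)
  next
    case (Suc b')
    have "frob d (lrmul d W Y (a + 0) (b + Suc b') D) E = frob d (lrmul d W Y a (Suc b) D) (lrmul d W Y 0 b' E)"
      using Suc[of "Suc b"] by simp
    then show ?case
      by (simp add: lrmul_Suc_right[symmetric] frob_mmul_right[OF Y])
  qed
next
  case (Suc a')
  have "frob d (lrmul d W Y (a + Suc a') (b + b') D) E = frob d (lrmul d W Y (Suc a) b D) (lrmul d W Y a' b' E)"
    using Suc[of "Suc a"] by simp
  then show ?case
    by (simp add: lrmul_Suc_left[symmetric] frob_mmul_left[OF W])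
qed

text \<open>Cauchy-Schwarz makes \<open>q \<mapsto> \<langle>W\<^sup>q D Y\<^sup>2\<^sup>n\<^sup>-\<^sup>q, D\<rangle>\<close> convex along the even \<open>q\<close>, hence maximal at an end
  point; this avoids diagonalising \<open>W\<close> and \<open>Y\<close>.\<close>

lemma frob_lrmul_le:
  assumes W: "\<And>i j. W i j = W j i" and Y: "\<And>i j. Y i j = Y j i" and q: "q \<le> 2 * n"
  shows "\<bar>frob d (lrmul d W Y q (2 * n - q) D) D\<bar>
    \<le> frob d (lrmul d W Y n 0 D) (lrmul d W Y n 0 D) + frob d (lrmul d W Y 0 n D) (lrmul d W Y 0 n D)"
proof -
  define e where "e i = lrmul d W Y i (n - i) D" for i
  define c where "c i = frob d (e i) (e i)" for i
  have c0: "0 \<le> c i" for i by (simp add: c_def frob_nonneg)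
  have "2 * c i \<le> c (i - 1) + c (i + 1)" if "0 < i" "i < n" for i
  proof -
    have "c i = frob d (lrmul d W Y (i + i) ((n - i) + (n - i)) D) D"
      unfolding c_def e_def by (rule frob_lrmul[OF W Y, symmetric])
    also have "\<dots> = frob d (lrmul d W Y ((i - 1) + (i + 1)) ((n - (i - 1)) + (n - (i + 1))) D) D"
      using that by (intro arg_cong2[where f = "\<lambda>a b. frob d (lrmul d W Y a b D) D"]) auto
    also have "\<dots> = frob d (e (i - 1)) (e (i + 1))"
      unfolding e_def by (rule frob_lrmul[OF W Y])
    finally show ?thesis using frob_AM_GM[of d "e (i - 1)" "e (i + 1)"] by (simp add: c_def)
  qed
  then have "c i \<le> max (c 0) (c n)" if "i \<le> n" for i
    using convex_seq_le_endpoints[of n c i] that by blast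
  then have cb: "c i \<le> c 0 + c n" if "i \<le> n" for i
    using that c0[of 0] c0[of n] by (fastforce simp: max_def split: if_splits)
  have "\<bar>frob d (lrmul d W Y q (2 * n - q) D) D\<bar> \<le> c 0 + c n"
  proof (cases "even q")
    case True
    then obtain i where i: "q = i + i" by (metis evenE mult_2)
    with q have "frob d (lrmul d W Y q (2 * n - q) D) D = frob d (lrmul d W Y (i + i) ((n - i) + (n - i)) D) D"
      by (intro arg_cong2[where f = "\<lambda>a b. frob d (lrmul d W Y a b D) D"]) auto
    also have "\<dots> = c i" unfolding c_def e_def by (rule frob_lrmul[OF W Y])
    finally show ?thesis using cb[of i] c0[of i] i q by auto
  next
    \<comment> \<open>An odd \<open>q\<close> splits into the neighbours \<open>i\<close> and
      \<open>i + 1\<close>, so the term is not itself one of the \<open>c i\<close>; AM-GM bounds it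
      by their mean.\<close>
    case False
    then obtain i where i: "q = i + (i + 1)" by (metis oddE mult_2 add.assoc)
    with q have "frob d (lrmul d W Y q (2 * n - q) D) D
        = frob d (lrmul d W Y (i + (i + 1)) ((n - i) + (n - (i + 1))) D) D"
      by (intro arg_cong2[where f = "\<lambda>a b. frob d (lrmul d W Y a b D) D"]) auto
    also have "\<dots> = frob d (e i) (e (i + 1))" unfolding e_def by (rule frob_lrmul[OF W Y])
    finally show ?thesis using frob_AM_GM[of d "e i" "e (i + 1)"] cb[of i] cb[of "i + 1"] i q
      by (auto simp: c_def)
  qed
  then show ?thesis by (simp add: c_def e_def add.commute)
qed

lemma mmul_idm_left: "(\<And>i j. i \<ge> d \<Longrightarrow> A i j = 0) \<Longrightarrow> mmul d (idm d) A = A"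
proof (intro ext)
  fix i j assume "\<And>i j. i \<ge> d \<Longrightarrow> A i j = 0"
  moreover have "mmul d (idm d) A i j = (\<Sum>k<d. if i = k then A k j else 0)"
    unfolding mmul_def idm_def by (intro sum.cong) auto
  ultimately show "mmul d (idm d) A i j = A i j" by (simp add: not_less)
qed

lemma mmul_idm_right: "(\<And>i j. j \<ge> d \<Longrightarrow> A i j = 0) \<Longrightarrow> mmul d A (idm d) = A"
proof (intro ext)
  fix i j assume "\<And>i j. j \<ge> d \<Longrightarrow> A i j = 0"
  moreover have "mmul d A (idm d) i j = (\<Sum>k<d. if j = k then A i k else 0)"
    unfolding mmul_def idm_def by (intro sum.cong) auto
  ultimately show "mmul d A (idm d) i j = A i j" by (simp add: not_less)
qed

lemma mpow_Suc: "mpow d X (Suc q) = mmul d X (mpow d X q)"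
  by (simp add: mpow_def)

lemma rpow_transpose:
  assumes Y: "\<And>i j. Y i j = Y j i" and D: "\<And>i j. D i j = D j i"
  shows "((\<lambda>M. mmul d M Y) ^^ n) D i j = (mmul d Y ^^ n) D j i"
proof (induction n arbitrary: i j)
  case 0 show ?case by (simp add: D)
next
  case (Suc n)
  have "((\<lambda>M. mmul d M Y) ^^ Suc n) D i j = (\<Sum>k<d. ((\<lambda>M. mmul d M Y) ^^ n) D i k * Y k j)"
    by (simp add: mmul_def)
  also have "\<dots> = (\<Sum>k<d. Y j k * (mmul d Y ^^ n) D k i)"
    by (intro sum.cong refl) (metis Suc Y mult.commute)
  also have "\<dots> = (mmul d Y ^^ Suc n) D j i" by (simp add: mmul_def)
  finally show ?case .
qed

lemma rpow_idm:
  assumes "\<And>i j. i \<ge> d \<Longrightarrow> Y i j = 0" "\<And>i j. j \<ge> d \<Longrightarrow> Y i j = 0"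
  shows "((\<lambda>M. mmul d M Y) ^^ n) (idm d) = mpow d Y n"
proof (induction n)
  case 0 show ?case by (simp add: mpow_def)
next
  case (Suc n)
  have "mmul d (mpow d Y n) Y = mpow d Y (Suc n)"
  proof (induction n)
    case 0 show ?case using assms by (simp add: mpow_def mmul_idm_left mmul_idm_right)
  next
    case (Suc n) then show ?case by (simp add: mpow_Suc mmul_assoc)
  qed
  with Suc show ?case by simp
qed

lemma mpow_sym:
  assumes "\<And>i j. i \<ge> d \<Longrightarrow> Y i j = 0" "\<And>i j. Y i j = Y j i"
  shows "mpow d Y n i j = mpow d Y n j i"
proof -
  have s: "\<And>i j. j \<ge> d \<Longrightarrow> Y i j = 0" using assms by metis
  have "mpow d Y n i j = ((\<lambda>M. mmul d M Y) ^^ n) (idm d) i j" by (simp add: rpow_idm[OF assms(1) s])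
  also have "\<dots> = (mmul d Y ^^ n) (idm d) j i"
    by (rule rpow_transpose[OF assms(2)]) (auto simp: idm_def)
  finally show ?thesis by (simp add: mpow_def)
qed

text \<open>Noncommutative factorisation of a difference of powers: it is the sum of W^q D Y^(2n-q)
  over 2n+1 values of q, and paired with \<open>D\<close> each term is at most the sum of the two
  extreme ones. The exponent 2n+1 leaves an even number of outer factors, so the extremes are
  squared norms.\<close>

lemma mpow_diff_frob_le:
  assumes W: "\<And>i j. W i j = W j i" and Y: "\<And>i j. Y i j = Y j i"
    and Ws: "\<And>i j. i \<ge> d \<Longrightarrow> W i j = 0" and Ys: "\<And>i j. i \<ge> d \<Longrightarrow> Y i j = 0"
    and D: "D = (\<lambda>i j. W i j - Y i j)"
  shows "frob d D (\<lambda>i j. mpow d W (2 * n + 1) i j - mpow d Y (2 * n + 1) i j)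
    \<le> real (2 * n + 1) * (frob d ((mmul d W ^^ n) D) ((mmul d W ^^ n) D)
                     + frob d ((mmul d Y ^^ n) D) ((mmul d Y ^^ n) D))"
proof -
  have Ws': "\<And>i j. j \<ge> d \<Longrightarrow> W i j = 0" and Ys': "\<And>i j. j \<ge> d \<Longrightarrow> Y i j = 0" using Ws W Ys Y by metis+
  \<comment> \<open>\<open>T\<close> interpolates between the two powers; each increment turns one
    factor \<open>Y\<close> into \<open>W\<close> and leaves \<open>D\<close> in its place.\<close>
  define T where "T q = frob d D (lrmul d W Y q (2 * n + 1 - q) (idm d))" for q
  have diff: "T (Suc q) - T q = frob d (lrmul d W Y q (2 * n - q) D) D" if "q < 2 * n + 1" for q
  proof -
    have "lrmul d W Y (Suc q) (2 * n - q) (idm d) = lrmul d W Y q (2 * n - q) W"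
    proof -
      have "mmul d W (((\<lambda>M. mmul d M Y) ^^ b) (idm d)) = ((\<lambda>M. mmul d M Y) ^^ b) W" for b
        using Ws' by (induction b) (simp_all add: mmul_idm_right mmul_assoc[symmetric])
      then show ?thesis by (simp add: lrmul_def funpow_swap1)
    qed
    moreover have "lrmul d W Y q (Suc (2 * n - q)) (idm d) = lrmul d W Y q (2 * n - q) Y"
      using Ys by (simp only: lrmul_def funpow_Suc_right o_apply mmul_idm_left)
    moreover have "lrmul d W Y a b D = (\<lambda>i j. lrmul d W Y a b W i j - lrmul d W Y a b Y i j)" for a b
    proof -
      have "((\<lambda>M. mmul d M Y) ^^ b) D = (\<lambda>i j. ((\<lambda>M. mmul d M Y) ^^ b) W i j - ((\<lambda>M. mmul d M Y) ^^ b) Y i j)" for b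
        by (induction b) (simp_all add: D mmul_def left_diff_distrib sum_subtractf)
      moreover have "(mmul d W ^^ a) (\<lambda>i j. P i j - Q i j) = (\<lambda>i j. (mmul d W ^^ a) P i j - (mmul d W ^^ a) Q i j)" for a P Q
        by (induction a) (simp_all add: mmul_def right_diff_distrib sum_subtractf)
      ultimately show ?thesis by (simp add: lrmul_def)
    qed
    ultimately have "frob d (lrmul d W Y q (2 * n - q) D) D
      = frob d (lrmul d W Y (Suc q) (2 * n - q) (idm d)) D - frob d (lrmul d W Y q (Suc (2 * n - q)) (idm d)) D"
      by (simp add: frob_diff_left)
    moreover have "Suc (2 * n - q) = 2 * n + 1 - q" using that by simp
    ultimately show ?thesis by (simp add: T_def frob_commute)
  qed
  have "frob d D (\<lambda>i j. mpow d W (2 * n + 1) i j - mpow d Y (2 * n + 1) i j) = T (2 * n + 1) - T 0"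
  proof -
    have "T 0 = frob d D (mpow d Y (2 * n + 1))"
      by (simp only: T_def lrmul_def funpow_0 diff_zero rpow_idm[OF Ys Ys'])
    then show ?thesis
      by (simp add: T_def lrmul_def mpow_def[of d W] frob_commute[of d D] frob_diff_left)
  qed
  also have "\<dots> = (\<Sum>q<2*n+1. T (Suc q) - T q)"
    by (rule sum_lessThan_telescope[symmetric])
  also have "\<dots> \<le> (\<Sum>q<2*n+1. frob d (lrmul d W Y n 0 D) (lrmul d W Y n 0 D) + frob d (lrmul d W Y 0 n D) (lrmul d W Y 0 n D))"
  proof (rule sum_mono)
    fix q assume "q \<in> {..<2*n+1}"
    then have "q < 2 * n + 1" "q \<le> 2 * n" by auto
    then show "T (Suc q) - T q \<le> frob d (lrmul d W Y n 0 D) (lrmul d W Y n 0 D) + frob d (lrmul d W Y 0 n D) (lrmul d W Y 0 n D)"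
      using frob_lrmul_le[where W = W and Y = Y and q = q and n = n and d = d and D = D, OF W Y \<open>q \<le> 2 * n\<close>]
        diff[OF \<open>q < 2 * n + 1\<close>] by linarith
  qed
  \<comment> \<open>\<open>D\<close> is symmetric, so D Y^n is the transpose of Y^n D and has the
    same norm.\<close>
  also have "frob d (lrmul d W Y 0 n D) (lrmul d W Y 0 n D) = frob d ((mmul d Y ^^ n) D) ((mmul d Y ^^ n) D)"
  proof -
    have Ds: "D i j = D j i" for i j unfolding D using W[of i j] Y[of i j] by simp
    have "lrmul d W Y 0 n D = (\<lambda>i j. (mmul d Y ^^ n) D j i)"
    proof (intro ext)
      fix i j show "lrmul d W Y 0 n D i j = (mmul d Y ^^ n) D j i"
        unfolding lrmul_def funpow_0 by (rule rpow_transpose) (rule Y Ds)+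
    qed
    then show ?thesis unfolding frob_def by simp (rule sum.swap)
  qed
  finally show ?thesis by (simp add: lrmul_def add.commute)
qed

section \<open>Differences of two rank-one matrices\<close>

definition sqn :: "nat \<Rightarrow> (nat \<Rightarrow> real) \<Rightarrow> real" where
  "sqn d v = (\<Sum>i<d. (v i)\<^sup>2)"

lemma sqn_nonneg: "0 \<le> sqn d v"
  by (simp add: sqn_def sum_nonneg)

lemma lpow_outer: "(mmul d W ^^ n) (\<lambda>i j. u i * v j) = (\<lambda>i j. (matvec d W ^^ n) u i * v j)"
  by (induction n) (simp_all add: mmul_def matvec_def sum_distrib_right mult.assoc)

lemma matvec_mmul: "matvec d (mmul d A B) v = matvec d A (matvec d B v)"
proof (rule ext)
  fix i
  have "matvec d (mmul d A B) v i = (\<Sum>a<d. \<Sum>k<d. A i k * B k a * v a)"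
    by (simp add: matvec_def mmul_def sum_distrib_right)
  also have "\<dots> = (\<Sum>k<d. \<Sum>a<d. A i k * B k a * v a)" by (rule sum.swap)
  finally show "matvec d (mmul d A B) v i = matvec d A (matvec d B v) i"
    by (simp add: matvec_def sum_distrib_left mult.assoc)
qed

lemma matvec_funpow:
  assumes "\<And>i. i \<ge> d \<Longrightarrow> v i = 0"
  shows "(matvec d W ^^ n) v = matvec d (mpow d W n) v"
proof (induction n)
  case 0
  have "matvec d (idm d) v i = v i" for i
  proof -
    have "matvec d (idm d) v i = (\<Sum>k<d. if i = k then v k else 0)"
      unfolding matvec_def idm_def by (intro sum.cong) auto
    then show ?thesis using assms by (simp add: not_less)
  qed
  then show ?case by (simp add: mpow_def fun_eq_iff)
next
  case (Suc n) then show ?case by (simp add: mpow_Suc matvec_mmul)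
qed

text \<open>The power hits only one side of each rank-one matrix; the other side contributes its
  squared length, at most \<open>T\<close>. The factor 2 is (a - b)^2 \<le> 2 a^2 + 2 b^2.\<close>

lemma lpow_outer_diff_le:
  assumes s: "\<And>i. i \<ge> d \<Longrightarrow> u i = 0" "\<And>i. i \<ge> d \<Longrightarrow> v i = 0"
    and T: "sqn d u \<le> T" "sqn d v \<le> T"
    and D: "D = (\<lambda>i j. u i * u j - v i * v j)"
  shows "frob d ((mmul d W ^^ n) D) ((mmul d W ^^ n) D)
    \<le> 2 * T * (sqn d (matvec d (mpow d W n) u) + sqn d (matvec d (mpow d W n) v))"
proof -
  let ?a = "matvec d (mpow d W n)"
  have lin: "(mmul d W ^^ a) (\<lambda>i j. P i j - Q i j) = (\<lambda>i j. (mmul d W ^^ a) P i j - (mmul d W ^^ a) Q i j)" for a P Q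
    by (induction a) (simp_all add: mmul_def right_diff_distrib sum_subtractf)
  have e: "(mmul d W ^^ n) D = (\<lambda>i j. ?a u i * u j - ?a v i * v j)"
    by (simp add: D lin lpow_outer matvec_funpow s)
  have "frob d ((mmul d W ^^ n) D) ((mmul d W ^^ n) D)
      \<le> (\<Sum>i<d. \<Sum>j<d. 2 * ((?a u i)\<^sup>2 * (u j)\<^sup>2) + 2 * ((?a v i)\<^sup>2 * (v j)\<^sup>2))"
    unfolding e frob_def
  proof (intro sum_mono)
    fix i j
    have "0 \<le> (?a u i * u j + ?a v i * v j)\<^sup>2" by simp
    then show "(?a u i * u j - ?a v i * v j) * (?a u i * u j - ?a v i * v j)
        \<le> 2 * ((?a u i)\<^sup>2 * (u j)\<^sup>2) + 2 * ((?a v i)\<^sup>2 * (v j)\<^sup>2)"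
      by (simp add: power2_eq_square algebra_simps)
  qed
  also have "\<dots> = 2 * (sqn d (?a u) * sqn d u) + 2 * (sqn d (?a v) * sqn d v)"
  proof -
    have "(\<Sum>i<d. \<Sum>j<d. 2 * ((?a w i)\<^sup>2 * (w j)\<^sup>2)) = 2 * (sqn d (?a w) * sqn d w)" for w
      unfolding sqn_def sum_product by (simp only: sum_distrib_left)
    then show ?thesis by (simp add: sum.distrib)
  qed
  also have "\<dots> \<le> 2 * (sqn d (?a u) * T) + 2 * (sqn d (?a v) * T)"
    using T by (intro add_mono mult_left_mono) (auto simp: sqn_nonneg)
  finally show ?thesis by (simp add: algebra_simps)
qed

section \<open>The moment method for sums of bounded rank-one matrices\<close>

text \<open>Bounded measurable functions. After truncation the integrands of the moment method are
  polynomials in such functions, so closure under sums and products settles their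
  integrability.\<close>

definition bdm :: "'a measure \<Rightarrow> ('a \<Rightarrow> real) \<Rightarrow> bool" where
  "bdm M f \<longleftrightarrow> f \<in> borel_measurable M \<and> (\<exists>C. \<forall>x\<in>space M. \<bar>f x\<bar> \<le> C)"

lemma bdm_const [simp]: "bdm M (\<lambda>_. c)"
  by (auto simp: bdm_def)

lemma bdm_mult: "bdm M f \<Longrightarrow> bdm M g \<Longrightarrow> bdm M (\<lambda>x. f x * g x)"
  unfolding bdm_def
proof safe
  fix C D assume "\<forall>x\<in>space M. \<bar>f x\<bar> \<le> C" "\<forall>x\<in>space M. \<bar>g x\<bar> \<le> D"
  then have "\<forall>x\<in>space M. \<bar>f x * g x\<bar> \<le> C * D"
    by (auto simp: abs_mult intro!: mult_mono order_trans[OF abs_ge_zero])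
  then show "\<exists>C. \<forall>x\<in>space M. \<bar>f x * g x\<bar> \<le> C" by blast
qed auto

lemma bdm_add: "bdm M f \<Longrightarrow> bdm M g \<Longrightarrow> bdm M (\<lambda>x. f x + g x)"
  unfolding bdm_def
proof safe
  fix C D assume "\<forall>x\<in>space M. \<bar>f x\<bar> \<le> C" "\<forall>x\<in>space M. \<bar>g x\<bar> \<le> D"
  then have "\<forall>x\<in>space M. \<bar>f x + g x\<bar> \<le> C + D"
    by (auto intro!: order_trans[OF abs_triangle_ineq] add_mono)
  then show "\<exists>C. \<forall>x\<in>space M. \<bar>f x + g x\<bar> \<le> C" by blast
qed auto

lemma bdm_diff: "bdm M f \<Longrightarrow> bdm M g \<Longrightarrow> bdm M (\<lambda>x. f x - g x)"
  using bdm_add[of M f "\<lambda>x. - 1 * g x"] bdm_mult[of M "\<lambda>_. -1" g] by simp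

lemma bdm_power2: "bdm M f \<Longrightarrow> bdm M (\<lambda>x. (f x)\<^sup>2)"
  using bdm_mult[of M f f] by (simp add: power2_eq_square)

lemma bdm_sum: "(\<And>i. i \<in> I \<Longrightarrow> bdm M (f i)) \<Longrightarrow> bdm M (\<lambda>x. \<Sum>i\<in>I. f i x)"
  by (induction I rule: infinite_finite_induct) (auto intro: bdm_add)

lemma bdm_compose: "bdm N f \<Longrightarrow> g \<in> measurable M N \<Longrightarrow> bdm M (\<lambda>x. f (g x))"
  unfolding bdm_def by (auto dest: measurable_space)

lemma (in prob_space) bdm_integrable: "bdm M f \<Longrightarrow> integrable M f"
proof -
  assume "bdm M f"
  then obtain C where "f \<in> borel_measurable M" "\<And>x. x \<in> space M \<Longrightarrow> \<bar>f x\<bar> \<le> C"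
    unfolding bdm_def by blast
  then show ?thesis by (intro integrable_const_bound[where B = C]) auto
qed

lemmas bdm_intros = bdm_const bdm_mult bdm_add bdm_diff bdm_power2 bdm_sum

text \<open>Via \<open>2 Cov(A, G) = E (A - A') (G - G')\<close> with independent copies.\<close>

lemma (in prob_space) covariance_le:
  assumes A: "\<And>i. i \<in> I \<Longrightarrow> bdm M (A i)" and A0: "\<And>i. i \<in> I \<Longrightarrow> (\<integral>x. A i x \<partial>M) = 0"
    and G: "\<And>i. i \<in> I \<Longrightarrow> bdm M (G i)"
    and h: "bdm M h" and f: "\<And>k. k \<in> K \<Longrightarrow> bdm M (f k)" and g: "\<And>k. k \<in> K \<Longrightarrow> bdm M (g k)"
    and le: "\<And>x y. x \<in> space M \<Longrightarrow> y \<in> space M \<Longrightarrow>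
      (\<Sum>i\<in>I. (A i x - A i y) * (G i x - G i y))
        \<le> c * (h x + h y + (\<Sum>k\<in>K. f k x * g k y) + (\<Sum>k\<in>K. f k y * g k x))"
  shows "(\<integral>x. (\<Sum>i\<in>I. A i x * G i x) \<partial>M)
    \<le> c * ((\<integral>x. h x \<partial>M) + (\<Sum>k\<in>K. (\<integral>x. f k x \<partial>M) * (\<integral>x. g k x \<partial>M)))"
proof -
  note int = bdm_integrable
  have iAG: "integrable M (\<lambda>x. A i x * G i x)" if "i \<in> I" for i
    by (rule int) (intro bdm_intros A G that)
  have iA: "integrable M (A i)" "integrable M (G i)" if "i \<in> I" for i
    using int A G that by auto
  have if': "integrable M (f k)" "integrable M (g k)" if "k \<in> K" for k
    using int f g that by auto
  have ih: "integrable M h" by (rule int) fact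
  have inner: "(\<integral>y. (\<Sum>i\<in>I. (A i x - A i y) * (G i x - G i y)) \<partial>M)
      = (\<Sum>i\<in>I. A i x * G i x - A i x * (\<integral>y. G i y \<partial>M) + (\<integral>y. A i y * G i y \<partial>M))" for x
  proof -
    have "(\<integral>y. (\<Sum>i\<in>I. (A i x - A i y) * (G i x - G i y)) \<partial>M)
      = (\<Sum>i\<in>I. (\<integral>y. (A i x * G i x - A i x * G i y) - G i x * A i y + A i y * G i y \<partial>M))"
      using iAG iA by (subst Bochner_Integration.integral_sum[symmetric])
         (auto simp: algebra_simps intro!: Bochner_Integration.integral_cong)
    also have "\<dots> = (\<Sum>i\<in>I. A i x * G i x - A i x * (\<integral>y. G i y \<partial>M) + (\<integral>y. A i y * G i y \<partial>M))"
      using iAG iA A0 by (intro sum.cong refl) (simp add: prob_space)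
    finally show ?thesis .
  qed
  have rinner: "(\<integral>y. c * (h x + h y + (\<Sum>k\<in>K. f k x * g k y) + (\<Sum>k\<in>K. f k y * g k x)) \<partial>M)
      = c * (h x + (\<integral>y. h y \<partial>M) + (\<Sum>k\<in>K. f k x * (\<integral>y. g k y \<partial>M)) + (\<Sum>k\<in>K. (\<integral>y. f k y \<partial>M) * g k x))" for x
    using ih if' by (simp add: prob_space)
  \<comment> \<open>Both cross terms vanish because \<open>A i\<close> has mean zero, leaving two
    copies of the left-hand side.\<close>
  have "2 * (\<integral>x. (\<Sum>i\<in>I. A i x * G i x) \<partial>M)
      = (\<integral>x. (\<integral>y. (\<Sum>i\<in>I. (A i x - A i y) * (G i x - G i y)) \<partial>M) \<partial>M)"
    unfolding inner using iAG iA A0 by (simp add: sum.distrib prob_space)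
  also have "\<dots> \<le> (\<integral>x. (\<integral>y. c * (h x + h y + (\<Sum>k\<in>K. f k x * g k y) + (\<Sum>k\<in>K. f k y * g k x)) \<partial>M) \<partial>M)"
  proof (rule integral_mono)
    show "integrable M (\<lambda>x. (\<integral>y. (\<Sum>i\<in>I. (A i x - A i y) * (G i x - G i y)) \<partial>M))"
      unfolding inner using iAG iA by auto
    show "integrable M (\<lambda>x. (\<integral>y. c * (h x + h y + (\<Sum>k\<in>K. f k x * g k y) + (\<Sum>k\<in>K. f k y * g k x)) \<partial>M))"
      unfolding rinner using ih if' by auto
    fix x assume x: "x \<in> space M"
    show "(\<integral>y. (\<Sum>i\<in>I. (A i x - A i y) * (G i x - G i y)) \<partial>M)
       \<le> (\<integral>y. c * (h x + h y + (\<Sum>k\<in>K. f k x * g k y) + (\<Sum>k\<in>K. f k y * g k x)) \<partial>M)"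
    proof (rule integral_mono)
      show "integrable M (\<lambda>y. \<Sum>i\<in>I. (A i x - A i y) * (G i x - G i y))"
        by (rule int) (intro bdm_intros A G)
      show "integrable M (\<lambda>y. c * (h x + h y + (\<Sum>k\<in>K. f k x * g k y) + (\<Sum>k\<in>K. f k y * g k x)))"
        by (rule int) (intro bdm_intros f g h)
    qed (use le x in auto)
  qed
  also have "\<dots> = 2 * (c * ((\<integral>x. h x \<partial>M) + (\<Sum>k\<in>K. (\<integral>x. f k x \<partial>M) * (\<integral>x. g k x \<partial>M))))"
    unfolding rinner using ih if' by (simp add: prob_space algebra_simps)
  finally show ?thesis by simp
qed

text \<open>The setting of a matrix Bernstein inequality for independent rank-one matrices whose
  laws may depend on \<open>j\<close>: \<open>T\<close> bounds the squared lengths, and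
  \<open>energy\<close> bounds the operator norm of the sum of second moment matrices by
  \<open>L\<close>, written through its quadratic form.\<close>

locale bounded_vectors = prob_space V for V :: "'v measure" +
  fixes J :: "'j set" and d :: nat and \<psi> :: "'j \<Rightarrow> 'v \<Rightarrow> nat \<Rightarrow> real" and T L :: real
  assumes finJ: "finite J"
    and meas: "\<And>j c. j \<in> J \<Longrightarrow> (\<lambda>x. \<psi> j x c) \<in> borel_measurable V"
    and supp: "\<And>j x c. c \<ge> d \<Longrightarrow> \<psi> j x c = 0"
    and bnd: "\<And>j x. j \<in> J \<Longrightarrow> sqn d (\<psi> j x) \<le> T"
    and energy: "\<And>w. (\<Sum>j\<in>J. \<integral>x. (\<Sum>c<d. w c * \<psi> j x c)\<^sup>2 \<partial>V) \<le> L * sqn d w"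
begin

abbreviation "PP \<equiv> PiM J (\<lambda>_. V)"

definition Cm :: "'j \<Rightarrow> nat \<Rightarrow> nat \<Rightarrow> real" where
  "Cm j = (\<lambda>a b. \<integral>x. \<psi> j x a * \<psi> j x b \<partial>V)"

definition Xm :: "('j \<Rightarrow> 'v) \<Rightarrow> nat \<Rightarrow> nat \<Rightarrow> real" where
  "Xm \<omega> = (\<lambda>a b. \<Sum>j\<in>J. \<psi> j (\<omega> j) a * \<psi> j (\<omega> j) b - Cm j a b)"

text \<open>The trace of the power \<open>2 r\<close>, as a squared Frobenius norm.\<close>

definition trm :: "nat \<Rightarrow> ('j \<Rightarrow> 'v) \<Rightarrow> real" where
  "trm r \<omega> = frob d (mpow d (Xm \<omega>) r) (mpow d (Xm \<omega>) r)"

lemma Xm_sym: "Xm \<omega> a b = Xm \<omega> b a"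
  by (simp add: Xm_def Cm_def mult.commute)

lemma Xm_supp: "a \<ge> d \<Longrightarrow> Xm \<omega> a b = 0"
  by (simp add: Xm_def Cm_def supp)

lemma mpow_Xm_sym: "mpow d (Xm \<omega>) r a b = mpow d (Xm \<omega>) r b a"
  by (rule mpow_sym) (auto simp: Xm_supp Xm_sym)

lemma psi_bdm: assumes "j \<in> J" shows "bdm V (\<lambda>x. \<psi> j x c)"
proof (cases "c < d")
  case True
  have "\<bar>\<psi> j x c\<bar> \<le> T + 1" for x
  proof -
    have "(\<psi> j x c)\<^sup>2 \<le> sqn d (\<psi> j x)" unfolding sqn_def
      by (rule member_le_sum) (use True in auto)
    then have "(\<psi> j x c)\<^sup>2 \<le> T" using bnd[OF assms, of x] by simp
    moreover have "\<bar>\<psi> j x c\<bar> \<le> (\<psi> j x c)\<^sup>2 + 1"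
      using zero_le_power2[of "\<bar>\<psi> j x c\<bar> - 1"] by (simp add: power2_diff)
    ultimately show ?thesis by simp
  qed
  then show ?thesis using meas[OF assms] by (auto simp: bdm_def)
qed (simp add: supp)

lemma PP_prob: "prob_space PP"
  by (rule prob_space_PiM) (rule prob_space_axioms)

lemma Xm_bdm_comp:
  assumes "\<And>j. j \<in> J \<Longrightarrow> (\<lambda>x. s x j) \<in> measurable N V"
  shows "bdm N (\<lambda>x. Xm (s x) a b)"
  unfolding Xm_def
  by (intro bdm_sum bdm_diff bdm_mult bdm_const bdm_compose[OF psi_bdm assms])

lemma mpow_bdm_comp:
  assumes "\<And>j. j \<in> J \<Longrightarrow> (\<lambda>x. s x j) \<in> measurable N V"
  shows "bdm N (\<lambda>x. mpow d (Xm (s x)) r a b)"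
proof (induction r arbitrary: a b)
  case 0 show ?case by (simp add: mpow_def)
next
  case (Suc r) then show ?case
    unfolding mpow_Suc mmul_def by (intro bdm_sum bdm_mult Xm_bdm_comp assms)
qed

lemma trm_bdm: "bdm PP (trm r)"
  unfolding trm_def frob_def by (intro bdm_sum bdm_mult mpow_bdm_comp) auto

lemma energy_eq:
  assumes j: "j \<in> J"
  shows "(\<integral>x. (\<Sum>c<d. w c * \<psi> j x c)\<^sup>2 \<partial>V) = (\<Sum>c<d. \<Sum>e<d. (w c * w e) * Cm j c e)"
proof -
  have "(\<integral>x. (\<Sum>c<d. w c * \<psi> j x c)\<^sup>2 \<partial>V) = (\<integral>x. (\<Sum>c<d. \<Sum>e<d. (w c * w e) * (\<psi> j x c * \<psi> j x e)) \<partial>V)"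
    by (intro Bochner_Integration.integral_cong refl) (simp add: power2_eq_square sum_product algebra_simps)
  also have "\<dots> = (\<Sum>c<d. \<Sum>e<d. (w c * w e) * Cm j c e)"
    using j by (simp add: Cm_def bdm_integrable bdm_mult psi_bdm)
  finally show ?thesis .
qed

text \<open>With all coordinates but \<open>j\<close> frozen, \<open>covariance_le\<close> applies
  to the entries of the centred matrix and of the odd power. Exchanging the vector of index
  \<open>j\<close> changes X by a difference of two rank-one matrices, so the bounds for such
  differences give the factor 2 T (2n+1). Four terms remain: where matrix and vector come from the
  same copy they yield the first summand; in the mixed ones the vector is independent of the matrix
  and is averaged, which yields the second.\<close>

lemma resample:
  assumes j: "j \<in> J"
  shows "(\<integral>\<omega>. frob d (\<lambda>a b. \<psi> j (\<omega> j) a * \<psi> j (\<omega> j) b - Cm j a b) (mpow d (Xm \<omega>) (2 * n + 1)) \<partial>PP)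
    \<le> 2 * T * real (2 * n + 1) * (\<integral>\<omega>. sqn d (matvec d (mpow d (Xm \<omega>) n) (\<psi> j (\<omega> j)))
        + (\<Sum>a<d. \<integral>x. (\<Sum>c<d. mpow d (Xm \<omega>) n a c * \<psi> j x c)\<^sup>2 \<partial>V) \<partial>PP)"
proof -
  define J' where "J' = J - {j}"
  have JJ: "J = insert j J'" "finite J'" "j \<notin> J'" using j finJ by (auto simp: J'_def)
  interpret PV: product_sigma_finite "\<lambda>_::'j. V" by standard
  interpret PP: prob_space PP by (rule PP_prob)
  interpret P': prob_space "PiM J' (\<lambda>_. V)" by (rule prob_space_PiM) (rule prob_space_axioms)
  \<comment> \<open>Fubini in coordinate \<open>j\<close>: the other coordinates outside, one point
    of \<open>V\<close> inside.\<close>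
  have split: "(\<integral>\<omega>. F \<omega> \<partial>PP) = (\<integral>\<omega>'. (\<integral>x. F (\<omega>'(j := x)) \<partial>V) \<partial>PiM J' (\<lambda>_. V))"
    and splitint: "integrable (PiM J' (\<lambda>_. V)) (\<lambda>\<omega>'. (\<integral>x. F (\<omega>'(j := x)) \<partial>V))"
    if Fbd: "bdm PP F" for F :: "('j \<Rightarrow> 'v) \<Rightarrow> real"
  proof -
    have i: "integrable (PiM (insert j J') (\<lambda>_. V)) F" using PP.bdm_integrable[OF Fbd] JJ(1) by simp
    show "(\<integral>\<omega>. F \<omega> \<partial>PP) = (\<integral>\<omega>'. (\<integral>x. F (\<omega>'(j := x)) \<partial>V) \<partial>PiM J' (\<lambda>_. V))"
      unfolding JJ(1) by (rule PV.product_integral_insert[OF JJ(2,3) i])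
    obtain C where C': "\<forall>\<omega>\<in>space PP. \<bar>F \<omega>\<bar> \<le> C" and Fm: "F \<in> borel_measurable PP"
      using Fbd unfolding bdm_def by blast
    then have C: "\<bar>F \<omega>\<bar> \<le> C" if "\<omega> \<in> space PP" for \<omega> using that by blast
    have upd: "\<omega>'(j := x) \<in> space PP" if "\<omega>' \<in> space (PiM J' (\<lambda>_. V))" "x \<in> space V" for \<omega>' x
      using that JJ by (auto simp: space_PiM PiE_def extensional_def)
    have Fm': "F \<in> borel_measurable (PiM (insert j J') (\<lambda>_. V))" using Fm JJ(1) by simp
    have mm: "(\<lambda>(\<omega>', x). F (\<omega>'(j := x))) \<in> borel_measurable (PiM J' (\<lambda>_. V) \<Otimes>\<^sub>M V)"
      using Fm' by measurable
    show "integrable (PiM J' (\<lambda>_. V)) (\<lambda>\<omega>'. (\<integral>x. F (\<omega>'(j := x)) \<partial>V))"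
    proof (rule P'.integrable_const_bound[where B = "\<bar>C\<bar>"])
      show "AE \<omega>' in PiM J' (\<lambda>_. V). norm (\<integral>x. F (\<omega>'(j := x)) \<partial>V) \<le> \<bar>C\<bar>"
      proof (rule AE_I2)
        fix \<omega>' assume w: "\<omega>' \<in> space (PiM J' (\<lambda>_. V))"
        have "(\<lambda>x. F (\<omega>'(j := x))) \<in> borel_measurable V"
          using measurable_compose[OF measurable_Pair1'[OF w] mm] by simp
        then have i: "integrable V (\<lambda>x. F (\<omega>'(j := x)))"
          using C upd[OF w] by (intro integrable_const_bound[where B = C]) auto
        have "norm (\<integral>x. F (\<omega>'(j := x)) \<partial>V) \<le> (\<integral>x. norm (F (\<omega>'(j := x))) \<partial>V)"
          by (rule integral_norm_bound)
        also have "\<dots> \<le> (\<integral>x. C \<partial>V)"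
          using i C upd[OF w] by (intro integral_mono) auto
        finally show "norm (\<integral>x. F (\<omega>'(j := x)) \<partial>V) \<le> \<bar>C\<bar>" by (simp add: prob_space)
      qed
      show "(\<lambda>\<omega>'. (\<integral>x. F (\<omega>'(j := x)) \<partial>V)) \<in> borel_measurable (PiM J' (\<lambda>_. V))"
        using borel_measurable_lebesgue_integral[OF mm] by simp
    qed
  qed
  define F where "F \<omega> = frob d (\<lambda>a b. \<psi> j (\<omega> j) a * \<psi> j (\<omega> j) b - Cm j a b) (mpow d (Xm \<omega>) (2 * n + 1))" for \<omega>
  define H where "H \<omega> = sqn d (matvec d (mpow d (Xm \<omega>) n) (\<psi> j (\<omega> j)))
        + (\<Sum>a<d. \<integral>x. (\<Sum>c<d. mpow d (Xm \<omega>) n a c * \<psi> j x c)\<^sup>2 \<partial>V)" for \<omega>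
  have comp: "(\<lambda>\<omega>. \<omega> i) \<in> measurable PP V" if "i \<in> J" for i using that by auto
  have Fb: "bdm PP F" unfolding F_def frob_def
    by (intro bdm_sum bdm_mult bdm_diff bdm_const mpow_bdm_comp comp bdm_compose[OF psi_bdm[OF j] comp[OF j]])
  note quad = energy_eq[OF j]
  have Hb: "bdm PP H" unfolding H_def sqn_def matvec_def quad
    by (intro bdm_sum bdm_mult bdm_add bdm_power2 bdm_const mpow_bdm_comp comp bdm_compose[OF psi_bdm[OF j] comp[OF j]])
  have main: "(\<integral>x. F (\<omega>'(j := x)) \<partial>V) \<le> (\<integral>x. 2 * T * real (2 * n + 1) * H (\<omega>'(j := x)) \<partial>V)"
    if w: "\<omega>' \<in> space (PiM J' (\<lambda>_. V))" for \<omega>'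
  proof -
    define W where "W x = Xm (\<omega>'(j := x))" for x
    have sm: "(\<lambda>x. (\<omega>'(j := x)) i) \<in> measurable V V" if "i \<in> J" for i
      using that w JJ by (cases "i = j") (auto simp: space_PiM intro!: measurable_const)
    have Wb: "bdm V (\<lambda>x. mpow d (W x) r a b)" for r a b
      unfolding W_def by (rule mpow_bdm_comp) (rule sm)
    have Wdiff: "W x a b - W y a b = \<psi> j x a * \<psi> j x b - \<psi> j y a * \<psi> j y b" for x y a b
    proof -
      have "W x a b = \<psi> j x a * \<psi> j x b - Cm j a b + (\<Sum>i\<in>J'. \<psi> i (\<omega>' i) a * \<psi> i (\<omega>' i) b - Cm i a b)" for x
      proof -
        have "(\<Sum>i\<in>J'. \<psi> i ((\<omega>'(j := x)) i) a * \<psi> i ((\<omega>'(j := x)) i) b - Cm i a b)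
          = (\<Sum>i\<in>J'. \<psi> i (\<omega>' i) a * \<psi> i (\<omega>' i) b - Cm i a b)"
          using JJ by (intro sum.cong) auto
        then show ?thesis unfolding W_def Xm_def sum.remove[OF finJ j] J'_def[symmetric] by simp
      qed
      then show ?thesis by simp
    qed
    have Ws: "W x a b = W x b a" "a \<ge> d \<Longrightarrow> W x a b = 0" for x a b
      by (simp_all add: W_def Xm_sym Xm_supp)
    define I where "I = {..<d} \<times> {..<d}"
    define Af where "Af = (\<lambda>(a, b) x. \<psi> j x a * \<psi> j x b - Cm j a b)"
    define Gf where "Gf = (\<lambda>(a, b) x. mpow d (W x) (2 * n + 1) a b)"
    \<comment> \<open>A triple (a, c, e) expands |X^n \<psi>|^2, with the matrix at \<open>x\<close>
      and the vector at \<open>y\<close>, into products of a function of \<open>x\<close> and a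
      function of \<open>y\<close>, the form that \<open>covariance_le\<close> can
      integrate.\<close>
    define K where "K = {..<d} \<times> {..<d} \<times> {..<d}"
    define ff where "ff = (\<lambda>(a, c, e) x. mpow d (W x) n a c * mpow d (W x) n a e)"
    define gf where "gf = (\<lambda>(a::nat, c, e) x. \<psi> j x c * \<psi> j x e)"
    define h where "h x = sqn d (matvec d (mpow d (W x) n) (\<psi> j x))" for x
    have hb: "bdm V h"
      unfolding h_def sqn_def matvec_def by (intro bdm_sum bdm_power2 bdm_mult Wb psi_bdm j)
    have ffb: "bdm V (ff k)" for k
      unfolding ff_def by (cases k) (auto intro!: bdm_mult Wb)
    have cross: "(\<Sum>k\<in>K. ff k x * gf k y) = sqn d (matvec d (mpow d (W x) n) (\<psi> j y))" for x y
    proof -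
      have "(\<Sum>k\<in>K. ff k x * gf k y) = (\<Sum>a<d. \<Sum>c<d. \<Sum>e<d.
          (mpow d (W x) n a c * mpow d (W x) n a e) * (\<psi> j y c * \<psi> j y e))"
        by (simp add: K_def ff_def gf_def sum.cartesian_product case_prod_unfold)
      also have "\<dots> = sqn d (matvec d (mpow d (W x) n) (\<psi> j y))"
        unfolding sqn_def matvec_def power2_eq_square sum_product
        by (intro sum.cong refl) (simp add: algebra_simps)
      finally show ?thesis .
    qed
    have Feq: "F (\<omega>'(j := x)) = (\<Sum>i\<in>I. Af i x * Gf i x)" for x
      by (simp add: F_def I_def Af_def Gf_def W_def frob_def sum.cartesian_product case_prod_unfold)
    have "(\<integral>x. (\<Sum>i\<in>I. Af i x * Gf i x) \<partial>V)
      \<le> 2 * T * real (2 * n + 1) * ((\<integral>x. h x \<partial>V) + (\<Sum>k\<in>K. (\<integral>x. ff k x \<partial>V) * (\<integral>x. gf k x \<partial>V)))"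
    proof (rule covariance_le)
      show "bdm V (Af i)" if "i \<in> I" for i
        unfolding Af_def by (cases i) (auto intro!: bdm_diff bdm_mult psi_bdm j)
      show "(\<integral>x. Af i x \<partial>V) = 0" if "i \<in> I" for i
        unfolding Af_def using j
        by (cases i) (auto simp: Cm_def prob_space bdm_integrable bdm_mult psi_bdm)
      show "bdm V (Gf i)" if "i \<in> I" for i
        unfolding Gf_def by (cases i) (auto intro!: Wb)
      show "bdm V h" by (rule hb)
      show "bdm V (ff k)" if "k \<in> K" for k by (rule ffb)
      show "bdm V (gf k)" if "k \<in> K" for k
        unfolding gf_def by (cases k) (auto intro!: bdm_mult psi_bdm j)
      fix x y assume "x \<in> space V" "y \<in> space V"
      define D where "D = (\<lambda>a b. W x a b - W y a b)"
      have D: "D = (\<lambda>a b. \<psi> j x a * \<psi> j x b - \<psi> j y a * \<psi> j y b)" by (simp add: D_def Wdiff)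
      have "(\<Sum>i\<in>I. (Af i x - Af i y) * (Gf i x - Gf i y))
        = frob d D (\<lambda>i j. mpow d (W x) (2 * n + 1) i j - mpow d (W y) (2 * n + 1) i j)"
        by (simp add: I_def Af_def Gf_def D frob_def sum.cartesian_product case_prod_unfold)
      also have "\<dots> \<le> real (2 * n + 1) * (frob d ((mmul d (W x) ^^ n) D) ((mmul d (W x) ^^ n) D)
                     + frob d ((mmul d (W y) ^^ n) D) ((mmul d (W y) ^^ n) D))"
        by (rule mpow_diff_frob_le) (auto simp: Ws D_def)
      also have "\<dots> \<le> real (2 * n + 1) * (2 * T * (sqn d (matvec d (mpow d (W x) n) (\<psi> j x)) + sqn d (matvec d (mpow d (W x) n) (\<psi> j y)))
         + 2 * T * (sqn d (matvec d (mpow d (W y) n) (\<psi> j x)) + sqn d (matvec d (mpow d (W y) n) (\<psi> j y))))"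
        by (intro mult_left_mono add_mono lpow_outer_diff_le) (auto simp: supp bnd j D)
      also have "\<dots> = 2 * T * real (2 * n + 1) * (h x + h y + (\<Sum>k\<in>K. ff k x * gf k y) + (\<Sum>k\<in>K. ff k y * gf k x))"
        unfolding cross h_def by (simp add: algebra_simps)
      finally show "(\<Sum>i\<in>I. (Af i x - Af i y) * (Gf i x - Gf i y))
        \<le> 2 * T * real (2 * n + 1) * (h x + h y + (\<Sum>k\<in>K. ff k x * gf k y) + (\<Sum>k\<in>K. ff k y * gf k x))" .
    qed
    also have "(\<integral>x. h x \<partial>V) + (\<Sum>k\<in>K. (\<integral>x. ff k x \<partial>V) * (\<integral>x. gf k x \<partial>V)) = (\<integral>x. H (\<omega>'(j := x)) \<partial>V)"
    proof -
      have Hx: "H (\<omega>'(j := x)) = h x + (\<Sum>k\<in>K. ff k x * (\<integral>y. gf k y \<partial>V))" for x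
      proof -
        have "(\<Sum>k\<in>K. ff k x * (\<integral>y. gf k y \<partial>V)) = (\<Sum>a<d. \<Sum>c<d. \<Sum>e<d.
          (mpow d (W x) n a c * mpow d (W x) n a e) * Cm j c e)"
          by (simp add: K_def ff_def gf_def Cm_def sum.cartesian_product case_prod_unfold)
        then show ?thesis by (simp add: H_def quad h_def W_def)
      qed
      have ib: "integrable V h" "\<And>k. integrable V (ff k)"
        using hb ffb by (auto intro: bdm_integrable)
      show ?thesis unfolding Hx using ib by simp
    qed
    finally show ?thesis unfolding Feq by simp
  qed
  have "(\<integral>\<omega>. F \<omega> \<partial>PP) = (\<integral>\<omega>'. (\<integral>x. F (\<omega>'(j := x)) \<partial>V) \<partial>PiM J' (\<lambda>_. V))" by (rule split[OF Fb])
  also have "\<dots> \<le> (\<integral>\<omega>'. (\<integral>x. 2 * T * real (2 * n + 1) * H (\<omega>'(j := x)) \<partial>V) \<partial>PiM J' (\<lambda>_. V))"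
    by (rule integral_mono[OF splitint[OF Fb] splitint main]) (intro bdm_mult bdm_const Hb)
  also have "\<dots> = (\<integral>\<omega>. 2 * T * real (2 * n + 1) * H \<omega> \<partial>PP)"
    by (rule split[symmetric]) (intro bdm_mult bdm_const Hb)
  also have "\<dots> = 2 * T * real (2 * n + 1) * (\<integral>\<omega>. H \<omega> \<partial>PP)" by simp
  finally show ?thesis unfolding F_def H_def by simp
qed

end

section \<open>Recursion for the trace moments and the resulting tail bound\<close>

context bounded_vectors
begin

definition quadX :: "('j \<Rightarrow> 'v) \<Rightarrow> (nat \<Rightarrow> real) \<Rightarrow> real" where
  "quadX \<omega> w = (\<Sum>c<d. w c * matvec d (Xm \<omega>) w c)"

lemma sum_sq_eq_quadX:
  "(\<Sum>j\<in>J. (\<Sum>c<d. w c * \<psi> j (\<omega> j) c)\<^sup>2)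
    = quadX \<omega> w + (\<Sum>j\<in>J. \<integral>x. (\<Sum>c<d. w c * \<psi> j x c)\<^sup>2 \<partial>V)"
proof -
  have "quadX \<omega> w = (\<Sum>c<d. \<Sum>e<d. \<Sum>j\<in>J. w c * w e * (\<psi> j (\<omega> j) c * \<psi> j (\<omega> j) e - Cm j c e))"
    by (simp add: quadX_def matvec_def Xm_def sum_distrib_left sum_distrib_right mult.assoc mult.left_commute mult.commute)
  also have "\<dots> = (\<Sum>c<d. \<Sum>j\<in>J. \<Sum>e<d. w c * w e * (\<psi> j (\<omega> j) c * \<psi> j (\<omega> j) e - Cm j c e))"
    by (intro sum.cong refl sum.swap)
  also have "\<dots> = (\<Sum>j\<in>J. \<Sum>c<d. \<Sum>e<d. w c * w e * (\<psi> j (\<omega> j) c * \<psi> j (\<omega> j) e - Cm j c e))"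
    by (rule sum.swap)
  also have "\<dots> = (\<Sum>j\<in>J. (\<Sum>c<d. w c * \<psi> j (\<omega> j) c)\<^sup>2 - (\<integral>x. (\<Sum>c<d. w c * \<psi> j x c)\<^sup>2 \<partial>V))"
  proof (rule sum.cong[OF refl])
    fix j assume "j \<in> J"
    have "(\<Sum>c<d. w c * \<psi> j (\<omega> j) c)\<^sup>2 = (\<Sum>c<d. \<Sum>e<d. (w c * w e) * (\<psi> j (\<omega> j) c * \<psi> j (\<omega> j) e))"
      by (simp add: power2_eq_square sum_product algebra_simps)
    then show "(\<Sum>c<d. \<Sum>e<d. w c * w e * (\<psi> j (\<omega> j) c * \<psi> j (\<omega> j) e - Cm j c e))
      = (\<Sum>c<d. w c * \<psi> j (\<omega> j) c)\<^sup>2 - (\<integral>x. (\<Sum>c<d. w c * \<psi> j x c)\<^sup>2 \<partial>V)"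
      by (simp add: energy_eq[OF \<open>j \<in> J\<close>] right_diff_distrib sum_subtractf)
  qed
  finally show ?thesis by (simp add: sum_subtractf)
qed

text \<open>One factor X of tr X^(2r+2) is split off and expanded into its centred summands, each of
  which \<open>resample\<close> pairs with the remaining odd power.\<close>

lemma trm_Suc: "trm (Suc r) \<omega> = (\<Sum>j\<in>J. frob d (\<lambda>a b. \<psi> j (\<omega> j) a * \<psi> j (\<omega> j) b - Cm j a b) (mpow d (Xm \<omega>) (2 * r + 1)))"
proof -
  have shift: "frob d (mpow d (Xm \<omega>) (Suc a)) (mpow d (Xm \<omega>) b) = frob d (mpow d (Xm \<omega>) 1) (mpow d (Xm \<omega>) (a + b))" for a b
  proof (induction a arbitrary: b)
    case (Suc a)
    have "frob d (mpow d (Xm \<omega>) (Suc (Suc a))) (mpow d (Xm \<omega>) b) = frob d (mpow d (Xm \<omega>) (Suc a)) (mpow d (Xm \<omega>) (Suc b))"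
      unfolding mpow_Suc[of _ _ "Suc a"] mpow_Suc[of _ _ b] by (rule frob_mmul_left) (rule Xm_sym)
    then show ?case using Suc[of "Suc b"] by simp
  qed simp
  have "mpow d (Xm \<omega>) 1 = Xm \<omega>"
  proof -
    have "Xm \<omega> a b = 0" if "b \<ge> d" for a b using Xm_supp[OF that] Xm_sym[of \<omega> a b] by simp
    then show ?thesis by (simp add: mpow_def mmul_idm_right)
  qed
  then have "trm (Suc r) \<omega> = frob d (Xm \<omega>) (mpow d (Xm \<omega>) (2 * r + 1))"
    unfolding trm_def using shift[of r "Suc r"] by (simp add: mult_2)
  also have "\<dots> = (\<Sum>a<d. \<Sum>b<d. \<Sum>j\<in>J. (\<psi> j (\<omega> j) a * \<psi> j (\<omega> j) b - Cm j a b) * mpow d (Xm \<omega>) (2 * r + 1) a b)"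
    by (simp add: frob_def Xm_def[of \<omega>, THEN fun_cong, THEN fun_cong] sum_distrib_right)
  also have "\<dots> = (\<Sum>a<d. \<Sum>j\<in>J. \<Sum>b<d. (\<psi> j (\<omega> j) a * \<psi> j (\<omega> j) b - Cm j a b) * mpow d (Xm \<omega>) (2 * r + 1) a b)"
    by (intro sum.cong refl sum.swap)
  also have "\<dots> = (\<Sum>j\<in>J. \<Sum>a<d. \<Sum>b<d. (\<psi> j (\<omega> j) a * \<psi> j (\<omega> j) b - Cm j a b) * mpow d (Xm \<omega>) (2 * r + 1) a b)"
    by (rule sum.swap)
  finally show ?thesis by (simp add: frob_def)
qed

text \<open>The rows of X^n act as test vectors: the sampled energy of a row w is its X-form plus
  its mean energy. The mean energy occurs twice, once here and once through the independent copy,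
  hence 2 L. AM-GM with weight \<gamma> splits the X-form into |w|^2 and |X w|^2, which sum over the
  rows to the traces of X^(2n) and X^(2n+2).\<close>

lemma pointwise_energy_le:
  assumes "\<gamma> > 0"
  shows "(\<Sum>j\<in>J. sqn d (matvec d (mpow d (Xm \<omega>) n) (\<psi> j (\<omega> j)))
        + (\<Sum>a<d. \<integral>x. (\<Sum>c<d. mpow d (Xm \<omega>) n a c * \<psi> j x c)\<^sup>2 \<partial>V))
    \<le> (trm n \<omega> / \<gamma> + \<gamma> * trm (Suc n) \<omega>) / 2 + 2 * L * trm n \<omega>"
proof -
  define row where "row a = mpow d (Xm \<omega>) n a" for a
  define E where "E w = (\<Sum>j\<in>J. \<integral>x. (\<Sum>c<d. w c * \<psi> j x c)\<^sup>2 \<partial>V)" for w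
  have t: "(\<Sum>a<d. sqn d (row a)) = trm n \<omega>"
    by (simp add: row_def trm_def frob_def sqn_def power2_eq_square)
  have "(\<Sum>a<d. sqn d (matvec d (Xm \<omega>) (row a))) = (\<Sum>a<d. \<Sum>c<d. (mpow d (Xm \<omega>) (Suc n) c a)\<^sup>2)"
    unfolding sqn_def mpow_Suc mmul_def matvec_def row_def
    by (intro sum.cong refl) (simp add: mpow_Xm_sym[of \<omega> n])
  also have "\<dots> = trm (Suc n) \<omega>"
    unfolding trm_def frob_def power2_eq_square by (rule sum.swap)
  finally have t': "(\<Sum>a<d. sqn d (matvec d (Xm \<omega>) (row a))) = trm (Suc n) \<omega>" .
  have q: "quadX \<omega> w \<le> (sqn d w / \<gamma> + \<gamma> * sqn d (matvec d (Xm \<omega>) w)) / 2" for w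
  proof -
    have "x * y \<le> x\<^sup>2 / (2 * \<gamma>) + \<gamma> * y\<^sup>2 / 2" for x y :: real
    proof -
      have "0 \<le> (x - \<gamma> * y)\<^sup>2 / (2 * \<gamma>)" using assms by simp
      also have "\<dots> = x\<^sup>2 / (2 * \<gamma>) + \<gamma> * y\<^sup>2 / 2 - x * y"
        using assms by (simp add: power2_eq_square field_simps)
      finally show ?thesis by simp
    qed
    then have "quadX \<omega> w \<le> (\<Sum>c<d. (w c)\<^sup>2 / (2 * \<gamma>) + \<gamma> * (matvec d (Xm \<omega>) w c)\<^sup>2 / 2)"
      unfolding quadX_def by (rule sum_mono)
    also have "\<dots> = (sqn d w / \<gamma> + \<gamma> * sqn d (matvec d (Xm \<omega>) w)) / 2"
      by (simp add: sqn_def sum.distrib sum_divide_distrib[symmetric] sum_distrib_left[symmetric] add_divide_distrib)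
    finally show ?thesis .
  qed
  have "(\<Sum>j\<in>J. sqn d (matvec d (mpow d (Xm \<omega>) n) (\<psi> j (\<omega> j)))
        + (\<Sum>a<d. \<integral>x. (\<Sum>c<d. mpow d (Xm \<omega>) n a c * \<psi> j x c)\<^sup>2 \<partial>V))
    = (\<Sum>a<d. \<Sum>j\<in>J. (\<Sum>c<d. row a c * \<psi> j (\<omega> j) c)\<^sup>2) + (\<Sum>a<d. E (row a))"
    by (simp add: sum.distrib sqn_def matvec_def row_def E_def sum.swap[of _ J])
  also have "\<dots> = (\<Sum>a<d. quadX \<omega> (row a) + 2 * E (row a))"
    unfolding sum_sq_eq_quadX E_def[symmetric] by (simp add: sum.distrib sum_distrib_left[symmetric])
  also have "\<dots> \<le> (\<Sum>a<d. (sqn d (row a) / \<gamma> + \<gamma> * sqn d (matvec d (Xm \<omega>) (row a))) / 2 + 2 * (L * sqn d (row a)))"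
    using energy by (intro sum_mono add_mono q mult_left_mono) (auto simp: E_def)
  also have "\<dots> = (trm n \<omega> / \<gamma> + \<gamma> * trm (Suc n) \<omega>) / 2 + 2 * L * trm n \<omega>"
    unfolding t[symmetric] t'[symmetric]
    by (simp add: sum.distrib sum_divide_distrib[symmetric] sum_distrib_left[symmetric] add_divide_distrib)
  finally show ?thesis .
qed

lemma trm_nonneg: "0 \<le> trm r \<omega>"
  by (simp add: trm_def frob_nonneg)

text \<open>Summing \<open>resample\<close> over \<open>j\<close> returns half of the moment being
  estimated; it is finite because the vectors are bounded, so it may be subtracted. This leaves the
  factor s^2 + 4 L s.\<close>

lemma moment_step:
  assumes T: "T > 0"
  shows "(\<integral>\<omega>. trm (Suc n) \<omega> \<partial>PP) \<le> ((2 * T * real (2 * n + 1))\<^sup>2 + 8 * T * L * real (2 * n + 1)) * (\<integral>\<omega>. trm n \<omega> \<partial>PP)"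
proof -
  interpret PP: prob_space PP by (rule PP_prob)
  define s where "s = 2 * T * real (2 * n + 1)"
  \<comment> \<open>\<open>\<gamma> = 1 / s\<close> below lets the higher moment be absorbed into the left-hand side\<close>
  have s: "s > 0" using T by (simp add: s_def)
  let ?F = "\<lambda>j \<omega>. frob d (\<lambda>a b. \<psi> j (\<omega> j) a * \<psi> j (\<omega> j) b - Cm j a b) (mpow d (Xm \<omega>) (2 * n + 1))"
  let ?H = "\<lambda>j \<omega>. sqn d (matvec d (mpow d (Xm \<omega>) n) (\<psi> j (\<omega> j)))
        + (\<Sum>a<d. \<integral>x. (\<Sum>c<d. mpow d (Xm \<omega>) n a c * \<psi> j x c)\<^sup>2 \<partial>V)"
  have comp: "(\<lambda>\<omega>. \<omega> i) \<in> measurable PP V" if "i \<in> J" for i using that by auto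
  have Fi: "integrable PP (?F j)" if j: "j \<in> J" for j
    unfolding frob_def
    by (rule PP.bdm_integrable)
       (intro bdm_sum bdm_mult bdm_diff bdm_const mpow_bdm_comp comp bdm_compose[OF psi_bdm[OF j] comp[OF j]])
  have Hi: "integrable PP (?H j)" if j: "j \<in> J" for j
    unfolding sqn_def matvec_def energy_eq[OF j]
    by (rule PP.bdm_integrable)
       (intro bdm_sum bdm_mult bdm_add bdm_power2 bdm_const mpow_bdm_comp comp bdm_compose[OF psi_bdm[OF j] comp[OF j]])
  note ti = PP.bdm_integrable[OF trm_bdm]
  have "(\<integral>\<omega>. trm (Suc n) \<omega> \<partial>PP) = (\<Sum>j\<in>J. (\<integral>\<omega>. ?F j \<omega> \<partial>PP))"
    unfolding trm_Suc using Fi by (rule Bochner_Integration.integral_sum)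
  also have "\<dots> \<le> (\<Sum>j\<in>J. s * (\<integral>\<omega>. ?H j \<omega> \<partial>PP))"
    unfolding s_def by (rule sum_mono) (rule resample)
  also have "\<dots> = s * (\<integral>\<omega>. (\<Sum>j\<in>J. ?H j \<omega>) \<partial>PP)"
    by (subst Bochner_Integration.integral_sum[OF Hi]) (simp_all only: sum_distrib_left)
  also have "\<dots> \<le> s * (\<integral>\<omega>. (trm n \<omega> / (1/s) + (1/s) * trm (Suc n) \<omega>) / 2 + 2 * L * trm n \<omega> \<partial>PP)"
  proof (intro mult_left_mono integral_mono)
    show "integrable PP (\<lambda>\<omega>. \<Sum>j\<in>J. ?H j \<omega>)" using Hi by auto
    show "integrable PP (\<lambda>\<omega>. (trm n \<omega> / (1/s) + (1/s) * trm (Suc n) \<omega>) / 2 + 2 * L * trm n \<omega>)"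
      using ti by auto
    show "(\<Sum>j\<in>J. ?H j \<omega>) \<le> (trm n \<omega> / (1/s) + (1/s) * trm (Suc n) \<omega>) / 2 + 2 * L * trm n \<omega>" for \<omega>
      by (rule pointwise_energy_le) (use s in simp)
  qed (use s in simp)
  also have "\<dots> = s\<^sup>2 * (\<integral>\<omega>. trm n \<omega> \<partial>PP) / 2 + (\<integral>\<omega>. trm (Suc n) \<omega> \<partial>PP) / 2 + 2 * L * s * (\<integral>\<omega>. trm n \<omega> \<partial>PP)"
    using ti s by (simp add: field_simps power2_eq_square)
  finally have "(\<integral>\<omega>. trm (Suc n) \<omega> \<partial>PP) \<le> (s\<^sup>2 + 4 * L * s) * (\<integral>\<omega>. trm n \<omega> \<partial>PP)"
    by (simp add: field_simps)
  then show ?thesis by (simp add: s_def mult_ac)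
qed

text \<open>Up to order \<open>R\<close> the condition on \<open>T * real R\<close> keeps both terms
  of every recursion factor at most 16 \<kappa> L^2, where \<kappa> \<le> 1 absorbs a square of
  \<kappa>. The recursion starts from the trace of the identity.\<close>

lemma moment_le:
  assumes T: "T > 0" and L: "L \<ge> 0" and \<kappa>: "0 \<le> \<kappa>" "\<kappa> \<le> 1" and R: "T * real R \<le> \<kappa> * L" and "r \<le> R"
  shows "(\<integral>\<omega>. trm r \<omega> \<partial>PP) \<le> real d * (32 * \<kappa> * L\<^sup>2) ^ r"
  using \<open>r \<le> R\<close>
proof (induction r)
  case 0
  have "frob d (idm d) (idm d) = (\<Sum>i<d. \<Sum>j<d. if i = j then 1 else 0)"
    unfolding frob_def idm_def by (intro sum.cong) auto
  then show ?case using PP_prob by (simp add: trm_def mpow_def prob_space.prob_space)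
next
  case (Suc r)
  then have "real (2 * r + 1) \<le> 2 * real R" by simp
  then have "2 * T * real (2 * r + 1) \<le> 4 * (T * real R)" using T by simp
  with R have a: "2 * T * real (2 * r + 1) \<le> 4 * (\<kappa> * L)" by linarith
  have "(2 * T * real (2 * r + 1))\<^sup>2 \<le> (4 * (\<kappa> * L))\<^sup>2"
    using a T by (intro power_mono) auto
  also have "\<dots> = 16 * (\<kappa> * \<kappa>) * L\<^sup>2" by (simp add: power2_eq_square)
  also have "\<dots> \<le> 16 * (\<kappa> * 1) * L\<^sup>2" using \<kappa> by (intro mult_right_mono mult_left_mono) auto
  finally have b: "(2 * T * real (2 * r + 1))\<^sup>2 \<le> 16 * \<kappa> * L\<^sup>2" by simp
  have "4 * L * (2 * T * real (2 * r + 1)) \<le> 4 * L * (4 * (\<kappa> * L))"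
    using a L by (intro mult_left_mono) auto
  then have c: "8 * T * L * real (2 * r + 1) \<le> 16 * \<kappa> * L\<^sup>2" by (simp add: power2_eq_square mult_ac)
  have "(\<integral>\<omega>. trm (Suc r) \<omega> \<partial>PP) \<le> ((2 * T * real (2 * r + 1))\<^sup>2 + 8 * T * L * real (2 * r + 1)) * (\<integral>\<omega>. trm r \<omega> \<partial>PP)"
    by (rule moment_step) fact
  also have "\<dots> \<le> (32 * \<kappa> * L\<^sup>2) * (\<integral>\<omega>. trm r \<omega> \<partial>PP)"
  proof (rule mult_right_mono)
    show "(2 * T * real (2 * r + 1))\<^sup>2 + 8 * T * L * real (2 * r + 1) \<le> 32 * \<kappa> * L\<^sup>2"
      using b c by linarith
    show "0 \<le> (\<integral>\<omega>. trm r \<omega> \<partial>PP)" by (intro integral_nonneg_AE AE_I2 trm_nonneg)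
  qed
  also have "\<dots> \<le> (32 * \<kappa> * L\<^sup>2) * (real d * (32 * \<kappa> * L\<^sup>2) ^ r)"
    using Suc \<kappa> by (intro mult_left_mono) auto
  finally show ?case by (simp add: mult_ac)
qed

text \<open>The ratios of consecutive \<open>\<bar>X\<^sup>q w\<bar>\<^sup>2\<close> increase with \<open>q\<close>, so a large quadratic form would force
  \<open>\<bar>X\<^sup>R w\<bar>\<^sup>2\<close> above the trace bound.\<close>

lemma quadX_abs_le:
  assumes l: "lam \<ge> 0" and lt: "trm R \<omega> < lam ^ (2 * R)"
  shows "\<bar>quadX \<omega> w\<bar> \<le> lam * sqn d w"
proof (rule ccontr)
  assume neg: "\<not> ?thesis"
  define X where "X = Xm \<omega>"
  define w' where "w' i = (if i < d then w i else 0)" for i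
  define v where "v q = (matvec d X ^^ q) w'" for q
  define c where "c q = sqn d (v q)" for q
  have c0: "c 0 = sqn d w" by (simp add: c_def v_def w'_def sqn_def)
  have c_nn: "0 \<le> c q" for q by (simp add: c_def sqn_nonneg)
  have vS: "v (Suc q) = matvec d X (v q)" for q by (simp add: v_def)
  have adj: "(\<Sum>i<d. matvec d X a i * b i) = (\<Sum>i<d. a i * matvec d X b i)" for a b
  proof -
    have "(\<Sum>i<d. matvec d X a i * b i) = (\<Sum>i<d. \<Sum>k<d. X i k * a k * b i)"
      by (simp add: matvec_def sum_distrib_right)
    also have "\<dots> = (\<Sum>k<d. \<Sum>i<d. X i k * a k * b i)" by (rule sum.swap)
    also have "\<dots> = (\<Sum>i<d. a i * matvec d X b i)"
      unfolding matvec_def sum_distrib_left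
      by (intro sum.cong refl) (metis X_def Xm_sym mult.assoc mult.commute)
    finally show ?thesis .
  qed
  have cs: "(\<Sum>i<d. a i * b i)\<^sup>2 \<le> sqn d a * sqn d b" for a b :: "nat \<Rightarrow> real"
    unfolding sqn_def by (rule Cauchy_Schwarz_ineq_sum)
  \<comment> \<open>Log-convexity: X is symmetric, so |v (q+1)|^2 is the inner product of v q and v
    (q+2).\<close>
  have conv: "(c (Suc q))\<^sup>2 \<le> c q * c (Suc (Suc q))" for q
  proof -
    have "c (Suc q) = (\<Sum>i<d. v q i * v (Suc (Suc q)) i)"
      unfolding c_def sqn_def power2_eq_square vS[of "Suc q"] adj[symmetric] by (simp add: vS)
    then show ?thesis using cs[of "v q" "v (Suc (Suc q))"] by (simp add: c_def)
  qed
  have "quadX \<omega> w = (\<Sum>i<d. v 0 i * v (Suc 0) i)"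
    unfolding vS by (simp add: quadX_def v_def w'_def X_def matvec_def)
  then have q: "(quadX \<omega> w)\<^sup>2 \<le> c 0 * c 1" using cs[of "v 0" "v 1"] by (simp add: c_def)
  have lt': "lam * c 0 < \<bar>quadX \<omega> w\<bar>" using neg c0 by simp
  then have "(lam * c 0)\<^sup>2 < (quadX \<omega> w)\<^sup>2"
    using l c_nn[of 0] by (metis abs_ge_zero abs_of_nonneg mult_nonneg_nonneg power2_abs power_strict_mono zero_less_numeral)
  then have "(lam * c 0)\<^sup>2 < c 0 * c 1" using q by simp
  then have pos: "c 0 > 0" and one: "lam\<^sup>2 * c 0 < c 1"
    using c_nn[of 0] by (auto simp: power2_eq_square less_le mult_ac mult_less_cancel_left)
  have "c q > 0 \<and> lam\<^sup>2 * c q \<le> c (Suc q) \<and> c (Suc q) > 0" for q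
  proof (induction q)
    case 0
    have "0 \<le> lam\<^sup>2 * c 0" using c_nn[of 0] by simp
    with one have "0 < c 1" by linarith
    then show ?case using pos one by simp
  next
    case (Suc q)
    have "lam\<^sup>2 * c (Suc q) * c q \<le> c (Suc q) * c (Suc q)"
      using Suc by (simp add: mult_ac)
    also have "\<dots> \<le> c q * c (Suc (Suc q))" using conv[of q] by (simp add: power2_eq_square)
    finally have "lam\<^sup>2 * c (Suc q) \<le> c (Suc (Suc q))" using Suc by (simp add: mult.commute)
    moreover have "c (Suc (Suc q)) > 0"
    proof -
      have "0 < (c (Suc q))\<^sup>2" using Suc by simp
      then have "0 < c q * c (Suc (Suc q))" using conv[of q] by linarith
      then show ?thesis using Suc by (simp add: zero_less_mult_iff)
    qed
    ultimately show ?case using Suc by simp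
  qed
  then have g: "lam\<^sup>2 * c q \<le> c (Suc q)" for q by blast
  have "lam ^ (2 * q) * c 0 \<le> c q" for q
  proof (induction q)
    case (Suc q)
    have "lam ^ (2 * Suc q) * c 0 = lam\<^sup>2 * (lam ^ (2 * q) * c 0)" by (simp add: power2_eq_square)
    also have "\<dots> \<le> lam\<^sup>2 * c q" using Suc by (intro mult_left_mono) auto
    finally show ?case using g[of q] by simp
  qed simp
  then have "lam ^ (2 * R) * c 0 \<le> c R" .
  \<comment> \<open>Cauchy-Schwarz in each row: the Frobenius norm dominates the operator norm of
    X^R.\<close>
  also have "c R \<le> trm R \<omega> * c 0"
  proof -
    have "v R = matvec d (mpow d X R) w'" unfolding v_def
      by (rule matvec_funpow) (simp add: w'_def)
    then have "c R = (\<Sum>a<d. (\<Sum>k<d. mpow d X R a k * w' k)\<^sup>2)" by (simp add: c_def sqn_def matvec_def)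
    also have "\<dots> \<le> (\<Sum>a<d. sqn d (mpow d X R a) * sqn d w')" by (intro sum_mono cs)
    also have "\<dots> = trm R \<omega> * c 0"
      by (simp add: c_def v_def trm_def frob_def sqn_def power2_eq_square sum_distrib_right X_def)
    finally show ?thesis .
  qed
  also have "\<dots> < lam ^ (2 * R) * c 0" using lt pos by simp
  finally show False by simp
qed

text \<open>Markov's inequality for the trace of X^(2R) at level (\<epsilon> L)^(2R). One scalar
  event controls all directions \<open>w\<close> at once, so the price of uniformity is only the
  factor \<open>d\<close>.\<close>

theorem quadratic_form_lower_tail:
  assumes T: "T > 0" and L: "L > 0" and \<kappa>: "0 \<le> \<kappa>" "\<kappa> \<le> 1" and R: "T * real R \<le> \<kappa> * L" and \<epsilon>: "\<epsilon> > 0"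
  shows "\<exists>E \<in> sets PP. measure PP E \<ge> 1 - real d * (32 * \<kappa> / \<epsilon>\<^sup>2) ^ R \<and>
    (\<forall>\<omega>\<in>E. \<forall>w. (\<Sum>j\<in>J. \<integral>x. (\<Sum>c<d. w c * \<psi> j x c)\<^sup>2 \<partial>V) - \<epsilon> * L * sqn d w
        \<le> (\<Sum>j\<in>J. (\<Sum>c<d. w c * \<psi> j (\<omega> j) c)\<^sup>2))"
proof -
  interpret PP: prob_space PP by (rule PP_prob)
  define E where "E = {\<omega>\<in>space PP. trm R \<omega> < (\<epsilon> * L) ^ (2 * R)}"
  have tm: "trm R \<in> borel_measurable PP" using trm_bdm by (simp add: bdm_def)
  then have Es: "E \<in> sets PP" unfolding E_def by measurable
  have "measure PP {\<omega>\<in>space PP. (\<epsilon> * L) ^ (2 * R) \<le> trm R \<omega>} \<le> (\<integral>\<omega>. trm R \<omega> \<partial>PP) / (\<epsilon> * L) ^ (2 * R)"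
    by (rule integral_Markov_inequality_measure[OF PP.bdm_integrable[OF trm_bdm], of "{}"])
       (use \<epsilon> L in \<open>auto simp: trm_nonneg\<close>)
  also have "\<dots> \<le> real d * (32 * \<kappa> * L\<^sup>2) ^ R / (\<epsilon> * L) ^ (2 * R)"
    using moment_le[OF T _ \<kappa> R order_refl] L \<epsilon> by (intro divide_right_mono) auto
  also have "\<dots> = real d * (32 * \<kappa> / \<epsilon>\<^sup>2) ^ R"
  proof -
    have "(32 * \<kappa> * L\<^sup>2) ^ R / (\<epsilon> * L) ^ (2 * R) = ((32 * \<kappa> * L\<^sup>2) / (\<epsilon> * L)\<^sup>2) ^ R"
      by (simp add: power_mult power_divide)
    also have "(32 * \<kappa> * L\<^sup>2) / (\<epsilon> * L)\<^sup>2 = 32 * \<kappa> / \<epsilon>\<^sup>2"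
      using L \<epsilon> by (simp add: power_mult_distrib)
    finally show ?thesis by (simp only: times_divide_eq_right[symmetric])
  qed
  finally have "measure PP (space PP - E) \<le> real d * (32 * \<kappa> / \<epsilon>\<^sup>2) ^ R"
    by (simp add: E_def set_diff_eq not_less cong: conj_cong)
  then have "measure PP E \<ge> 1 - real d * (32 * \<kappa> / \<epsilon>\<^sup>2) ^ R"
    using PP.prob_compl[OF Es] by simp
  moreover have "(\<Sum>j\<in>J. \<integral>x. (\<Sum>c<d. w c * \<psi> j x c)\<^sup>2 \<partial>V) - \<epsilon> * L * sqn d w
        \<le> (\<Sum>j\<in>J. (\<Sum>c<d. w c * \<psi> j (\<omega> j) c)\<^sup>2)" if "\<omega> \<in> E" for \<omega> w
    using quadX_abs_le[of "\<epsilon> * L" R \<omega> w] that L \<epsilon> unfolding sum_sq_eq_quadX by (auto simp: E_def)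
  ultimately show ?thesis using Es by blast
qed

end

section \<open>Linear forms of sub-Gaussian vectors\<close>

text \<open>The infimum defining the norm need not be attained on \<open>subg_set\<close>, but twice the norm is admissible.\<close>

lemma subgaussian_norm_attained:
  assumes "prob_space M" and sM: "sets M = sets borel"
    and i2: "integrable M (\<lambda>x. x\<^sup>2)" "(\<integral>x. x\<^sup>2 \<partial>M) = 1" and ne: "subg_set M \<noteq> {}"
  shows "1 \<le> subgaussian_norm M" "2 * subgaussian_norm M \<in> subg_set M"
proof -
  interpret prob_space M by fact
  have [measurable_cong]: "sets M = sets borel" by fact
  \<comment> \<open>Unit variance and u + 1 \<le> exp u give 1/s^2 + 1 \<le> 2. A positive infimum
    is strictly below its double, so some admissible level lies in between.\<close>
  have ge1: "1 \<le> s" if "s \<in> subg_set M" for s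
  proof -
    from that have s: "s > 0" and le: "(\<integral>\<^sup>+ x. ennreal (exp (x\<^sup>2 / s\<^sup>2)) \<partial>M) \<le> 2" by (auto simp: subg_set_def)
    have "(\<integral>\<^sup>+ x. ennreal (x\<^sup>2 / s\<^sup>2) \<partial>M) = ennreal (\<integral>x. x\<^sup>2 / s\<^sup>2 \<partial>M)"
      using i2 by (intro nn_integral_eq_integral) auto
    then have e: "(\<integral>\<^sup>+ x. ennreal (x\<^sup>2 / s\<^sup>2) \<partial>M) = ennreal (1 / s\<^sup>2)" using i2 by simp
    have "ennreal (1 / s\<^sup>2) + 1 = (\<integral>\<^sup>+ x. ennreal (x\<^sup>2 / s\<^sup>2) + 1 \<partial>M)"
      using sM by (subst nn_integral_add) (auto simp: e emeasure_space_1)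
    also have "\<dots> \<le> (\<integral>\<^sup>+ x. ennreal (exp (x\<^sup>2 / s\<^sup>2)) \<partial>M)"
    proof (rule nn_integral_mono)
      fix x
      have "ennreal (x\<^sup>2 / s\<^sup>2) + 1 = ennreal (x\<^sup>2 / s\<^sup>2 + 1)" by (subst ennreal_plus) auto
      also have "\<dots> \<le> ennreal (exp (x\<^sup>2 / s\<^sup>2))" using exp_ge_add_one_self[of "x\<^sup>2 / s\<^sup>2"]
        by (intro ennreal_leI) linarith
      finally show "ennreal (x\<^sup>2 / s\<^sup>2) + 1 \<le> ennreal (exp (x\<^sup>2 / s\<^sup>2))" .
    qed
    also have "\<dots> \<le> 2" by fact
    finally have "ennreal (1 / s\<^sup>2 + 1) \<le> ennreal 2" by (simp add: ennreal_plus)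
    then have "1 / s\<^sup>2 \<le> 1" by (subst (asm) ennreal_le_iff) auto
    then have "1 \<le> s\<^sup>2" using s by (simp add: field_simps)
    then show ?thesis using s by (metis less_eq_real_def one_power2 power2_le_imp_le)
  qed
  show a1: "1 \<le> subgaussian_norm M"
    unfolding subgaussian_norm_def by (rule cInf_greatest[OF ne ge1])
  then have "Inf (subg_set M) < 2 * subgaussian_norm M" by (simp add: subgaussian_norm_def)
  then obtain s where s: "s \<in> subg_set M" "s < 2 * subgaussian_norm M"
    using cInf_lessD[OF ne] by blast
  let ?b = "2 * subgaussian_norm M"
  have s0: "s > 0" using s by (auto simp: subg_set_def)
  have "(\<integral>\<^sup>+ x. ennreal (exp (x\<^sup>2 / ?b\<^sup>2)) \<partial>M) \<le> (\<integral>\<^sup>+ x. ennreal (exp (x\<^sup>2 / s\<^sup>2)) \<partial>M)"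
  proof (rule nn_integral_mono, rule ennreal_leI)
    fix x :: real
    have "s\<^sup>2 \<le> ?b\<^sup>2" using s s0 by (intro power_mono) auto
    then show "exp (x\<^sup>2 / ?b\<^sup>2) \<le> exp (x\<^sup>2 / s\<^sup>2)" using s0 a1
      by (simp only: exp_le_cancel_iff) (intro divide_left_mono, auto)
  qed
  also have "\<dots> \<le> 2" using s by (simp add: subg_set_def)
  finally show "?b \<in> subg_set M" using a1 by (simp add: subg_set_def)
qed

text \<open>Made for centred variables: the linear term integrates to zero and an exponential moment
  of the square is left. On [-1, 0) it rests on (1 + y + y^2) (1 - y) = 1 - y^3 \<ge> 1 together
  with 1 - y \<le> exp (- y).\<close>

lemma exp_le_add_exp_square: "exp y \<le> y + exp (y\<^sup>2)" for y :: real
proof -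
  consider "0 \<le> y \<and> y \<le> 1" | "y > 1" | "-1 \<le> y \<and> y < 0" | "y < -1" by linarith
  then show ?thesis
  proof cases
    case 1
    then show ?thesis using exp_bound[of y] exp_ge_add_one_self[of "y\<^sup>2"] by linarith
  next
    case 2
    then have "exp y \<le> exp (y\<^sup>2)" by (simp add: power2_eq_square)
    with 2 show ?thesis by linarith
  next
    case 3
    have "exp y \<le> 1 + y + y\<^sup>2"
    proof -
      have "1 \<le> (1 + y + y\<^sup>2) * (1 - y)"
      proof -
        have "(1 + y + y\<^sup>2) * (1 - y) = 1 - y * y\<^sup>2" by (simp add: algebra_simps power2_eq_square)
        moreover have "y * y\<^sup>2 \<le> 0" using 3 by (simp add: mult_nonpos_nonneg)
        ultimately show ?thesis by simp
      qed
      also have "\<dots> \<le> (1 + y + y\<^sup>2) * exp (- y)"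
      proof (rule mult_left_mono)
        show "1 - y \<le> exp (- y)" using exp_ge_add_one_self[of "- y"] by simp
        show "0 \<le> 1 + y + y\<^sup>2" using 3 zero_le_power2[of y] by linarith
      qed
      finally show ?thesis by (simp add: exp_minus field_simps)
    qed
    then show ?thesis using exp_ge_add_one_self[of "y\<^sup>2"] by linarith
  next
    case 4
    then have "- y \<le> y\<^sup>2" using mult_right_mono[of 1 "- y" "- y"] by (simp add: power2_eq_square)
    moreover have "exp y \<le> 1" using 4 by simp
    ultimately show ?thesis using exp_ge_add_one_self[of "y\<^sup>2"] by linarith
  qed
qed

lemma exp_le_quadratic_remainder: "exp x \<le> 1 + x + x\<^sup>2 * exp x" if "0 \<le> x" for x :: real
proof -
  have e: "exp x - 1 \<le> x * exp x"
  proof -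
    have "(1 - x) * exp x \<le> exp (- x) * exp x"
      using exp_ge_add_one_self[of "- x"] by (intro mult_right_mono) auto
    then show ?thesis by (simp add: exp_minus algebra_simps)
  qed
  have "x * (exp x - 1) \<le> x * (x * exp x)" using e that by (rule mult_left_mono)
  with e show ?thesis by (simp add: power2_eq_square algebra_simps)
qed

lemma exp_ge_half_square: "x\<^sup>2 / 2 \<le> exp x" if "0 \<le> x" for x :: real
  using exp_lower_Taylor_quadratic[OF that] that by simp

text \<open>Constants depending on \<open>\<beta> = 2 \<alpha>\<close>: a rate for the exponential moment of a squared unit linear
  form, the resulting tail exponent for sums of such squares, and the level of truncation.\<close>

definition exp_square_rate :: "real \<Rightarrow> real" where
  "exp_square_rate \<beta> = 3 / (16 * \<beta>\<^sup>2)"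

definition chernoff_rate :: "real \<Rightarrow> real" where
  "chernoff_rate \<beta> = (exp_square_rate \<beta>)\<^sup>2 / 6400"

definition truncation_const :: "real \<Rightarrow> real" where
  "truncation_const \<beta> = 1600 / (exp_square_rate \<beta>)\<^sup>2"

text \<open>One summand per demand: 1 for crude lower bounds on the sample size, the middle term for
  the trace moments, the last for the union bound over the net.\<close>

definition sample_size_const :: "real \<Rightarrow> real" where
  "sample_size_const \<beta> = 1 + truncation_const \<beta> * 12800 * exp 2 + 2 / chernoff_rate \<beta>"

lemma sample_size_const_pos: "0 < sample_size_const \<beta>"
  unfolding sample_size_const_def truncation_const_def chernoff_rate_def
  by (intro add_pos_nonneg) auto

definition lin :: "nat \<Rightarrow> (nat \<Rightarrow> real) \<Rightarrow> (nat \<Rightarrow> real) \<Rightarrow> real" where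
  "lin n y a = (\<Sum>r<n. a r * y r)"

lemma lin_scale: "lin n (\<lambda>r. c * y r) a = c * lin n y a"
  by (simp add: lin_def sum_distrib_left mult_ac)

lemma sqn_scale: "sqn n (\<lambda>r. c * y r) = c\<^sup>2 * sqn n y"
  by (simp add: sqn_def sum_distrib_left power_mult_distrib)

locale unit_subgaussian = prob_space M for M :: "real measure" +
  fixes \<beta> :: real
  assumes sets_M: "sets M = sets borel"
    and int1: "integrable M (\<lambda>x. x)" and mean0: "(\<integral>x. x \<partial>M) = 0"
    and int2: "integrable M (\<lambda>x. x\<^sup>2)" and var1: "(\<integral>x. x\<^sup>2 \<partial>M) = 1"
    and beta2: "\<beta> \<ge> 2" and psi2: "(\<integral>\<^sup>+ x. ennreal (exp (x\<^sup>2 / \<beta>\<^sup>2)) \<partial>M) \<le> 2"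
begin

lemma sets_M' [measurable_cong]: "sets M = sets borel" by (rule sets_M)

lemma psi2_integrable: "integrable M (\<lambda>x. exp (x\<^sup>2 / \<beta>\<^sup>2))" "(\<integral>x. exp (x\<^sup>2 / \<beta>\<^sup>2) \<partial>M) \<le> 2"
proof -
  show i: "integrable M (\<lambda>x. exp (x\<^sup>2 / \<beta>\<^sup>2))"
    using psi2 by (intro integrableI_bounded) (auto simp: order_le_less_trans[OF psi2])
  have "ennreal (\<integral>x. exp (x\<^sup>2 / \<beta>\<^sup>2) \<partial>M) = (\<integral>\<^sup>+ x. ennreal (exp (x\<^sup>2 / \<beta>\<^sup>2)) \<partial>M)"
    by (rule nn_integral_eq_integral[symmetric]) (use i in auto)
  then show "(\<integral>x. exp (x\<^sup>2 / \<beta>\<^sup>2) \<partial>M) \<le> 2"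
    using psi2 by (metis ennreal_le_iff ennreal_numeral zero_le_numeral)
qed

lemma exp_power_le: "exp (\<theta> * y) \<le> 1 + \<theta> * (exp y - 1)" if "0 \<le> \<theta>" "\<theta> \<le> 1" for \<theta> y :: real
  using convex_onD[OF exp_convex, of \<theta> 0 y] that by (simp add: algebra_simps)

text \<open>Two regimes of \<theta> = \<beta>^2 s^2. For \<theta> \<le> 1 centring removes the
  linear term and convexity bounds the rest by 1 + \<theta> (g - 1), with mean at most 1 + \<theta>.
  For larger \<theta> Young's inequality gives s x \<le> \<theta>/2 + x^2 / (2 \<beta>^2), and the
  remaining mean is at most 3/2, hence at most exp (\<theta>/2).\<close>

lemma mgf_le: "(\<integral>\<^sup>+ x. ennreal (exp (s * x)) \<partial>M) \<le> ennreal (exp (\<beta>\<^sup>2 * s\<^sup>2))"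
proof -
  have b: "\<beta> > 0" using beta2 by simp
  define g where "g x = exp (x\<^sup>2 / \<beta>\<^sup>2)" for x
  have gi: "integrable M g" "(\<integral>x. g x \<partial>M) \<le> 2" using psi2_integrable by (auto simp: g_def[abs_def])
  define \<theta> where "\<theta> = \<beta>\<^sup>2 * s\<^sup>2"
  have t0: "0 \<le> \<theta>" by (simp add: \<theta>_def)
  obtain f where f: "integrable M f" "\<And>x. exp (s * x) \<le> f x" "(\<integral>x. f x \<partial>M) \<le> exp \<theta>"
  proof (cases "\<theta> \<le> 1")
    case True
    show ?thesis
    proof (rule that[of "\<lambda>x. s * x + (1 + \<theta> * (g x - 1))"])
      show "integrable M (\<lambda>x. s * x + (1 + \<theta> * (g x - 1)))" using gi int1 by auto
      show "exp (s * x) \<le> s * x + (1 + \<theta> * (g x - 1))" for x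
      proof -
        have e: "(s * x)\<^sup>2 = \<theta> * (x\<^sup>2 / \<beta>\<^sup>2)" using b by (simp add: \<theta>_def power_mult_distrib)
        show ?thesis
          using exp_le_add_exp_square[of "s * x"] exp_power_le[OF t0 True, of "x\<^sup>2 / \<beta>\<^sup>2"]
          unfolding e g_def by linarith
      qed
      have "(\<integral>x. s * x + (1 + \<theta> * (g x - 1)) \<partial>M) = 1 + \<theta> * ((\<integral>x. g x \<partial>M) - 1)"
        using gi int1 mean0 by (simp add: prob_space)
      also have "\<dots> \<le> 1 + \<theta> * 1" using gi t0 by (intro add_left_mono mult_left_mono) auto
      also have "\<dots> \<le> exp \<theta>" by simp
      finally show "(\<integral>x. s * x + (1 + \<theta> * (g x - 1)) \<partial>M) \<le> exp \<theta>" .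
    qed
  next
    case False
    show ?thesis
    proof (rule that[of "\<lambda>x. exp (\<theta> / 2) * (1 + 1/2 * (g x - 1))"])
      show "integrable M (\<lambda>x. exp (\<theta> / 2) * (1 + 1/2 * (g x - 1)))" using gi by auto
      show "exp (s * x) \<le> exp (\<theta> / 2) * (1 + 1/2 * (g x - 1))" for x
      proof -
        have "0 \<le> (\<beta> * s - x / \<beta>)\<^sup>2" by simp
        then have "s * x \<le> \<theta> / 2 + 1/2 * (x\<^sup>2 / \<beta>\<^sup>2)"
          using b by (simp add: \<theta>_def power2_diff power_mult_distrib power_divide)
        then have "exp (s * x) \<le> exp (\<theta> / 2) * exp (1/2 * (x\<^sup>2 / \<beta>\<^sup>2))"
          by (simp only: exp_add[symmetric] exp_le_cancel_iff)
        also have "\<dots> \<le> exp (\<theta> / 2) * (1 + 1/2 * (g x - 1))"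
          unfolding g_def by (intro mult_left_mono exp_power_le) auto
        finally show ?thesis .
      qed
      have "(\<integral>x. exp (\<theta> / 2) * (1 + 1/2 * (g x - 1)) \<partial>M) = exp (\<theta> / 2) * (1 + 1/2 * ((\<integral>x. g x \<partial>M) - 1))"
        using gi by (simp add: prob_space)
      also have "\<dots> \<le> exp (\<theta> / 2) * (1 + \<theta> / 2)"
        using gi False by (intro mult_left_mono) auto
      also have "\<dots> \<le> exp (\<theta> / 2) * exp (\<theta> / 2)" by (intro mult_left_mono) auto
      also have "\<dots> = exp \<theta>" by (simp add: exp_add[symmetric])
      finally show "(\<integral>x. exp (\<theta> / 2) * (1 + 1/2 * (g x - 1)) \<partial>M) \<le> exp \<theta>" .
    qed
  qed
  have f0: "0 \<le> f x" for x using f(2)[of x] exp_ge_zero[of "s * x"] by linarith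
  have "(\<integral>\<^sup>+ x. ennreal (exp (s * x)) \<partial>M) \<le> (\<integral>\<^sup>+ x. ennreal (f x) \<partial>M)"
    by (intro nn_integral_mono ennreal_leI f(2))
  also have "\<dots> = ennreal (\<integral>x. f x \<partial>M)" by (rule nn_integral_eq_integral[OF f(1)]) (simp add: f0)
  also have "\<dots> \<le> ennreal (exp \<theta>)" by (rule ennreal_leI) (rule f(3))
  finally show ?thesis by (simp add: \<theta>_def)
qed

abbreviation lam0 :: real where "lam0 \<equiv> exp_square_rate \<beta>"

lemma lam0_bounds: "0 < lam0" "lam0 \<le> 1"
proof -
  have "2\<^sup>2 \<le> \<beta>\<^sup>2" using beta2 by (intro power_mono) auto
  then have "3 \<le> 16 * \<beta>\<^sup>2" "0 < \<beta>\<^sup>2" by auto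
  then show "0 < lam0" "lam0 \<le> 1" unfolding exp_square_rate_def by (auto simp: divide_le_eq)
qed

text \<open>Law of one row of a measurement matrix.\<close>

definition VV :: "nat \<Rightarrow> (nat \<Rightarrow> real) measure" where
  "VV n = PiM {..<n} (\<lambda>_. M)"

lemma VV_prob: "prob_space (VV n)"
  unfolding VV_def by (rule prob_space_PiM) (rule prob_space_axioms)

lemma coord_meas: "r < n \<Longrightarrow> (\<lambda>a. a r) \<in> borel_measurable (VV n)"
  unfolding VV_def using sets_M by measurable

lemma lin_meas [measurable]: "lin n y \<in> borel_measurable (VV n)"
  unfolding lin_def by (intro borel_measurable_sum borel_measurable_times coord_meas) auto

lemma lin_mgf_le: "(\<integral>\<^sup>+ a. ennreal (exp (s * lin n y a)) \<partial>VV n) \<le> ennreal (exp (\<beta>\<^sup>2 * s\<^sup>2 * sqn n y))"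
proof -
  interpret product_sigma_finite "\<lambda>_::nat. M" by standard
  have "(\<integral>\<^sup>+ a. ennreal (exp (s * lin n y a)) \<partial>VV n)
      = (\<integral>\<^sup>+ a. (\<Prod>r<n. ennreal (exp ((s * y r) * a r))) \<partial>VV n)"
    by (simp add: lin_def sum_distrib_left exp_sum prod_ennreal mult_ac)
  also have "\<dots> = (\<Prod>r<n. (\<integral>\<^sup>+ x. ennreal (exp ((s * y r) * x)) \<partial>M))"
    unfolding VV_def by (rule product_nn_integral_prod) auto
  also have "\<dots> \<le> (\<Prod>r<n. ennreal (exp (\<beta>\<^sup>2 * (s * y r)\<^sup>2)))"
    by (rule prod_mono_ennreal) (rule mgf_le)
  also have "\<dots> = ennreal (exp (\<beta>\<^sup>2 * s\<^sup>2 * sqn n y))"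
    by (simp add: prod_ennreal exp_sum[symmetric] sqn_def sum_distrib_left power_mult_distrib mult_ac)
  finally show ?thesis .
qed

text \<open>Averaging the bound for \<open>exp (s * lin n y)\<close> over a Gaussian \<open>s\<close> turns it into a bound for
  the exponential of the square.\<close>

lemma exp_square_le:
  assumes "sqn n y \<le> 1"
  shows "(\<integral>\<^sup>+ a. ennreal (exp (lam0 * (lin n y a)\<^sup>2)) \<partial>VV n) \<le> 2"
proof -
  interpret VV: prob_space "VV n" by (rule VV_prob)
  interpret P: pair_sigma_finite "VV n" lborel
    by (simp add: pair_sigma_finite_def VV.sigma_finite_measure_axioms lborel.sigma_finite_measure_axioms)
  define \<tau> where "\<tau> = sqrt (2 * lam0)"
  have t2: "\<tau>\<^sup>2 = 2 * lam0" using lam0_bounds by (simp add: \<tau>_def)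
  \<comment> \<open>Completing the square: the left-hand side is the moment generating function of a
    standard Gaussian at \<tau> x, as \<tau>^2 / 2 = \<open>lam0\<close>.\<close>
  have gauss: "ennreal (exp (lam0 * x\<^sup>2)) = (\<integral>\<^sup>+ g. ennreal (exp ((\<tau> * g) * x) * std_normal_density g) \<partial>lborel)" for x
  proof -
    have "exp ((\<tau> * g) * x) * std_normal_density g = exp (lam0 * x\<^sup>2) * normal_density (\<tau> * x) 1 g" for g
    proof -
      have "(\<tau> * g) * x + (- g\<^sup>2 / 2) = lam0 * x\<^sup>2 + (- (g - \<tau> * x)\<^sup>2 / 2)"
        using t2 by (simp add: power2_diff power_mult_distrib field_simps)
      then show ?thesis
        by (simp add: std_normal_density_def normal_density_def exp_add[symmetric])
    qed
    then have "(\<integral>\<^sup>+ g. ennreal (exp ((\<tau> * g) * x) * std_normal_density g) \<partial>lborel)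
      = (\<integral>\<^sup>+ g. ennreal (exp (lam0 * x\<^sup>2)) * ennreal (normal_density (\<tau> * x) 1 g) \<partial>lborel)"
      by (simp add: ennreal_mult)
    also have "\<dots> = ennreal (exp (lam0 * x\<^sup>2)) * (\<integral>\<^sup>+ g. ennreal (normal_density (\<tau> * x) 1 g) \<partial>lborel)"
      by (rule nn_integral_cmult) simp
    also have "(\<integral>\<^sup>+ g. ennreal (normal_density (\<tau> * x) 1 g) \<partial>lborel) = 1"
      by (subst nn_integral_eq_integral) auto
    finally show ?thesis by simp
  qed
  have "(\<integral>\<^sup>+ a. ennreal (exp (lam0 * (lin n y a)\<^sup>2)) \<partial>VV n)
      = (\<integral>\<^sup>+ a. (\<integral>\<^sup>+ g. ennreal (exp ((\<tau> * g) * lin n y a) * std_normal_density g) \<partial>lborel) \<partial>VV n)"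
    by (simp only: gauss)
  also have "\<dots> = (\<integral>\<^sup>+ g. (\<integral>\<^sup>+ a. ennreal (exp ((\<tau> * g) * lin n y a) * std_normal_density g) \<partial>VV n) \<partial>lborel)"
    by (rule P.Fubini'[symmetric]) measurable
  also have "\<dots> \<le> (\<integral>\<^sup>+ g. 2 * ennreal (normal_density 0 2 g) \<partial>lborel)"
  proof (rule nn_integral_mono)
    fix g :: real
    have "(\<integral>\<^sup>+ a. ennreal (exp ((\<tau> * g) * lin n y a) * std_normal_density g) \<partial>VV n)
      = (\<integral>\<^sup>+ a. ennreal (exp ((\<tau> * g) * lin n y a)) * ennreal (std_normal_density g) \<partial>VV n)"
      by (simp add: ennreal_mult)
    also have "\<dots> = (\<integral>\<^sup>+ a. ennreal (exp ((\<tau> * g) * lin n y a)) \<partial>VV n) * ennreal (std_normal_density g)"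
      by (rule nn_integral_multc) measurable
    also have "\<dots> \<le> ennreal (exp (\<beta>\<^sup>2 * (\<tau> * g)\<^sup>2 * sqn n y)) * ennreal (std_normal_density g)"
      by (intro mult_right_mono lin_mgf_le) auto
    also have "\<dots> \<le> ennreal (exp (\<beta>\<^sup>2 * (\<tau> * g)\<^sup>2 * 1)) * ennreal (std_normal_density g)"
      using mult_left_mono[OF assms, of "\<beta>\<^sup>2 * (\<tau> * g)\<^sup>2"]
      by (intro mult_right_mono ennreal_leI) auto
    also have "\<dots> = ennreal (exp (\<beta>\<^sup>2 * (\<tau> * g)\<^sup>2 * 1) * std_normal_density g)"
      by (simp add: ennreal_mult)
    also have "exp (\<beta>\<^sup>2 * (\<tau> * g)\<^sup>2 * 1) * std_normal_density g = 2 * normal_density 0 2 g"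
    proof -
      \<comment> \<open>This fixes the value of \<open>exp_square_rate\<close>: \<beta>^2 \<tau>^2 =
        3/8, and 3/8 - 1/2 = -1/8 is the exponent of a Gaussian with standard deviation 2. Its
        normalisation supplies the factor 2 of the bound.\<close>
      have e: "\<beta>\<^sup>2 * (\<tau> * g)\<^sup>2 * 1 + (- g\<^sup>2 / 2) = - (g - 0)\<^sup>2 / (2 * 2\<^sup>2)"
        using beta2 by (simp add: power_mult_distrib t2 exp_square_rate_def field_simps)
      have "sqrt (2 * pi * 2\<^sup>2) = 2 * sqrt (2 * pi)"
        by (subst real_sqrt_mult) (simp add: real_sqrt_abs)
      then show ?thesis
        using e by (simp add: std_normal_density_def normal_density_def exp_add[symmetric])
    qed
    finally show "(\<integral>\<^sup>+ a. ennreal (exp ((\<tau> * g) * lin n y a) * std_normal_density g) \<partial>VV n)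
      \<le> 2 * ennreal (normal_density 0 2 g)" by (simp add: ennreal_mult)
  qed
  also have "\<dots> = 2 * (\<integral>\<^sup>+ g. ennreal (normal_density 0 2 g) \<partial>lborel)"
    by (rule nn_integral_cmult) simp
  also have "(\<integral>\<^sup>+ g. ennreal (normal_density 0 2 g) \<partial>lborel) = 1"
    by (subst nn_integral_eq_integral) auto
  finally show ?thesis by simp
qed

lemma exp_square_integrable:
  assumes "sqn n y \<le> 1"
  shows "integrable (VV n) (\<lambda>a. exp (lam0 * (lin n y a)\<^sup>2))" "(\<integral>a. exp (lam0 * (lin n y a)\<^sup>2) \<partial>VV n) \<le> 2"
proof -
  note le = exp_square_le[OF assms]
  show i: "integrable (VV n) (\<lambda>a. exp (lam0 * (lin n y a)\<^sup>2))"
    by (intro integrableI_bounded) (auto simp: order_le_less_trans[OF le])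
  have "ennreal (\<integral>a. exp (lam0 * (lin n y a)\<^sup>2) \<partial>VV n) = (\<integral>\<^sup>+ a. ennreal (exp (lam0 * (lin n y a)\<^sup>2)) \<partial>VV n)"
    by (rule nn_integral_eq_integral[symmetric]) (use i in auto)
  then show "(\<integral>a. exp (lam0 * (lin n y a)\<^sup>2) \<partial>VV n) \<le> 2"
    using le by (metis ennreal_le_iff ennreal_numeral zero_le_numeral)
qed

lemma coord_product:
  assumes "r < n" "s < n"
  shows "integrable (VV n) (\<lambda>a. a r * a s)" "(\<integral>a. a r * a s \<partial>VV n) = (if r = s then 1 else 0)"
proof -
  interpret product_sigma_finite "\<lambda>_::nat. M" by standard
  \<comment> \<open>A monomial of degree two as a product over all coordinates, with factors x^2, x
    or 1, so that the integral factorises also for \<open>r = s\<close>.\<close>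
  define f where "f i x = (if i = r then x else 1) * (if i = s then x else (1::real))" for i :: nat and x :: real
  have fi: "integrable M (f i)" and fint: "(\<integral>x. f i x \<partial>M) = (if i = r then (if i = s then 1 else 0) else if i = s then 0 else 1)" for i
  proof -
    consider "f i = (\<lambda>x. x\<^sup>2)" "i = r" "i = s" | "f i = (\<lambda>x. x)" "(i = r) \<noteq> (i = s)" | "f i = (\<lambda>_. 1)" "i \<noteq> r" "i \<noteq> s"
      by (cases "i = r"; cases "i = s") (auto simp: f_def fun_eq_iff power2_eq_square)
    then have "integrable M (f i) \<and> (\<integral>x. f i x \<partial>M) = (if i = r then (if i = s then 1 else 0) else if i = s then 0 else 1)"
    proof cases
      case 1 show ?thesis unfolding 1(1) using 1(2,3) int2 var1 by simp
    next
      case 2 show ?thesis unfolding 2(1) using 2(2) int1 mean0 by auto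
    next
      case 3 show ?thesis unfolding 3(1) using 3(2,3) by (simp add: prob_space)
    qed
    then show "integrable M (f i)" "(\<integral>x. f i x \<partial>M) = (if i = r then (if i = s then 1 else 0) else if i = s then 0 else 1)" by auto
  qed
  have e: "(\<Prod>i<n. f i (a i)) = a r * a s" for a
    using assms by (simp add: f_def prod.distrib)
  show "integrable (VV n) (\<lambda>a. a r * a s)"
    unfolding VV_def e[symmetric] by (rule product_integrable_prod) (simp, rule fi)
  have "(\<integral>a. a r * a s \<partial>VV n) = (\<Prod>i<n. (\<integral>x. f i x \<partial>M))"
    unfolding VV_def e[symmetric] by (rule product_integral_prod) (simp, rule fi)
  also have "\<dots> = (if r = s then 1 else 0)"
  proof (cases "r = s")
    case False
    then have "(\<integral>x. f r x \<partial>M) = 0" by (simp add: fint)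
    then show ?thesis using assms False by (auto intro: prod_zero)
  next
    case True
    then have "(\<integral>x. f i x \<partial>M) = 1" for i unfolding fint by simp
    then show ?thesis using True by simp
  qed
  finally show "(\<integral>a. a r * a s \<partial>VV n) = (if r = s then 1 else 0)" .
qed

lemma lin_square:
  "integrable (VV n) (\<lambda>a. (lin n y a)\<^sup>2)" "(\<integral>a. (lin n y a)\<^sup>2 \<partial>VV n) = sqn n y"
proof -
  have e: "(lin n y a)\<^sup>2 = (\<Sum>r<n. \<Sum>s<n. (y r * y s) * (a r * a s))" for a
    by (simp add: lin_def power2_eq_square sum_product mult_ac)
  show "integrable (VV n) (\<lambda>a. (lin n y a)\<^sup>2)"
    unfolding e by (intro Bochner_Integration.integrable_sum integrable_mult_right coord_product) auto
  have i: "integrable (VV n) (\<lambda>a. (y r * y s) * (a r * a s))" if "r < n" "s < n" for r s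
    by (intro integrable_mult_right coord_product that)
  have "(\<integral>a. (lin n y a)\<^sup>2 \<partial>VV n) = (\<Sum>r<n. (\<integral>a. (\<Sum>s<n. (y r * y s) * (a r * a s)) \<partial>VV n))"
    unfolding e by (rule Bochner_Integration.integral_sum) (auto intro!: Bochner_Integration.integrable_sum i)
  also have "\<dots> = (\<Sum>r<n. \<Sum>s<n. (\<integral>a. (y r * y s) * (a r * a s) \<partial>VV n))"
    by (rule sum.cong[OF refl], rule Bochner_Integration.integral_sum) (rule i; simp)
  also have "\<dots> = (\<Sum>r<n. \<Sum>s<n. (y r * y s) * (if r = s then 1 else 0))"
    by (intro sum.cong refl) (simp add: coord_product)
  also have "\<dots> = sqn n y"
    by (simp add: sqn_def power2_eq_square if_distrib[of "\<lambda>x. _ * x"] cong: if_cong)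
  finally show "(\<integral>a. (lin n y a)\<^sup>2 \<partial>VV n) = sqn n y" .
qed

lemma lin_fourth_unit:
  assumes "sqn n y \<le> 1"
  shows "integrable (VV n) (\<lambda>a. (lin n y a) ^ 4)" "(\<integral>a. (lin n y a) ^ 4 \<partial>VV n) \<le> 4 / lam0\<^sup>2"
proof -
  note ex = exp_square_integrable[OF assms]
  have le: "(lin n y a) ^ 4 \<le> 2 / lam0\<^sup>2 * exp (lam0 * (lin n y a)\<^sup>2)" for a
    using exp_ge_half_square[of "lam0 * (lin n y a)\<^sup>2"] lam0_bounds
    by (simp add: power_mult_distrib field_simps)
  show i: "integrable (VV n) (\<lambda>a. (lin n y a) ^ 4)"
    by (rule Bochner_Integration.integrable_bound[of _ "\<lambda>a. 2 / lam0\<^sup>2 * exp (lam0 * (lin n y a)\<^sup>2)"])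
       (use ex le in \<open>auto intro!: AE_I2 order_trans[OF le]\<close>)
  have "(\<integral>a. (lin n y a) ^ 4 \<partial>VV n) \<le> (\<integral>a. 2 / lam0\<^sup>2 * exp (lam0 * (lin n y a)\<^sup>2) \<partial>VV n)"
    by (rule integral_mono[OF i]) (use ex le in auto)
  also have "\<dots> \<le> 2 / lam0\<^sup>2 * 2" using ex by (simp add: mult_left_mono divide_right_mono)
  finally show "(\<integral>a. (lin n y a) ^ 4 \<partial>VV n) \<le> 4 / lam0\<^sup>2" by simp
qed

lemma lin_fourth:
  "integrable (VV n) (\<lambda>a. (lin n y a) ^ 4)" "(\<integral>a. (lin n y a) ^ 4 \<partial>VV n) \<le> 4 / lam0\<^sup>2 * (sqn n y)\<^sup>2"
proof -
  define c where "c = sqrt (sqn n y)"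
  have c2: "c\<^sup>2 = sqn n y" by (simp add: c_def sqn_nonneg)
  have "integrable (VV n) (\<lambda>a. (lin n y a) ^ 4) \<and> (\<integral>a. (lin n y a) ^ 4 \<partial>VV n) \<le> 4 / lam0\<^sup>2 * (sqn n y)\<^sup>2"
  proof (cases "c = 0")
    case True
    then have "sqn n y = 0" using c2 by simp
    then have "\<forall>r<n. y r = 0" by (simp add: sqn_def sum_nonneg_eq_0_iff)
    then have "lin n y a = 0" for a by (simp add: lin_def)
    then show ?thesis by simp
  next
    case False
    define y' where "y' r = (1 / c) * y r" for r
    have u: "sqn n y' \<le> 1" unfolding y'_def sqn_scale c2[symmetric] using False by (simp add: power_divide)
    have l: "lin n y a = c * lin n y' a" for a unfolding y'_def lin_scale using False by simp
    show ?thesis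
      unfolding l power_mult_distrib c2[symmetric]
    proof (intro conjI)
      show "integrable (VV n) (\<lambda>a. c ^ 4 * lin n y' a ^ 4)" using lin_fourth_unit[OF u] by auto
      have "c ^ 4 * (\<integral>a. lin n y' a ^ 4 \<partial>VV n) \<le> c ^ 4 * (4 / lam0\<^sup>2)"
        using lin_fourth_unit[OF u] by (intro mult_left_mono) auto
      then show "(\<integral>a. c ^ 4 * lin n y' a ^ 4 \<partial>VV n) \<le> 4 / lam0\<^sup>2 * (c\<^sup>2)\<^sup>2" by (simp add: mult.commute)
    qed
  qed
  then show "integrable (VV n) (\<lambda>a. (lin n y a) ^ 4)" "(\<integral>a. (lin n y a) ^ 4 \<partial>VV n) \<le> 4 / lam0\<^sup>2 * (sqn n y)\<^sup>2" by auto
qed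

text \<open>A second order expansion whose linear coefficient is the variance bound 1, so a small
  \<open>l\<close> allows tail levels close to 1. Half of the rate \<open>lam0\<close> pays for u^2
  \<le> 8 / lam0^2 * exp (lam0 u / 2), the other half for exp (l u); the moment bound 2 turns 8 into
  16.\<close>

lemma square_mgf_le:
  assumes "sqn n y \<le> 1" and l: "0 \<le> l" "l \<le> lam0 / 2"
  shows "(\<integral>\<^sup>+ a. ennreal (exp (l * (lin n y a)\<^sup>2)) \<partial>VV n) \<le> ennreal (exp (l + 16 / lam0\<^sup>2 * l\<^sup>2))"
proof -
  interpret VV: prob_space "VV n" by (rule VV_prob)
  note ex = exp_square_integrable[OF assms(1)]
  define f where "f a = 1 + l * (lin n y a)\<^sup>2 + 8 / lam0\<^sup>2 * l\<^sup>2 * exp (lam0 * (lin n y a)\<^sup>2)" for a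
  have fi: "integrable (VV n) f" unfolding f_def using ex lin_square by auto
  have le: "exp (l * (lin n y a)\<^sup>2) \<le> f a" for a
  proof -
    define u where "u = (lin n y a)\<^sup>2"
    have u: "0 \<le> u" by (simp add: u_def)
    have "u\<^sup>2 \<le> 8 / lam0\<^sup>2 * exp (lam0 / 2 * u)"
      using exp_ge_half_square[of "lam0 / 2 * u"] lam0_bounds u
      by (simp add: power_mult_distrib power_divide field_simps)
    then have "u\<^sup>2 * exp (l * u) \<le> 8 / lam0\<^sup>2 * exp (lam0 / 2 * u) * exp (lam0 / 2 * u)"
      using mult_right_mono[OF l(2) u] by (intro mult_mono) auto
    also have "\<dots> = 8 / lam0\<^sup>2 * exp (lam0 * u)"
      by (simp add: mult.assoc exp_add[symmetric])
    finally have "l\<^sup>2 * (u\<^sup>2 * exp (l * u)) \<le> l\<^sup>2 * (8 / lam0\<^sup>2 * exp (lam0 * u))"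
      by (rule mult_left_mono) simp
    moreover have "exp (l * u) \<le> 1 + l * u + (l * u)\<^sup>2 * exp (l * u)"
      by (rule exp_le_quadratic_remainder) (use l u in simp)
    ultimately show ?thesis unfolding f_def u_def[symmetric] by (simp add: power_mult_distrib mult_ac)
  qed
  have f0: "0 \<le> f a" for a using le[of a] exp_ge_zero[of "l * (lin n y a)\<^sup>2"] by linarith
  have "(\<integral>a. f a \<partial>VV n) = 1 + l * sqn n y + 8 / lam0\<^sup>2 * l\<^sup>2 * (\<integral>a. exp (lam0 * (lin n y a)\<^sup>2) \<partial>VV n)"
    unfolding f_def using ex lin_square by (simp add: VV.prob_space)
  also have "\<dots> \<le> 1 + l * 1 + 8 / lam0\<^sup>2 * l\<^sup>2 * 2"
    using ex assms by (intro add_mono mult_left_mono) auto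
  also have "\<dots> \<le> exp (l + 16 / lam0\<^sup>2 * l\<^sup>2)"
    using exp_ge_add_one_self[of "l + 16 / lam0\<^sup>2 * l\<^sup>2"] by (simp only: mult_1_right)
  finally have b: "(\<integral>a. f a \<partial>VV n) \<le> exp (l + 16 / lam0\<^sup>2 * l\<^sup>2)" .
  have "(\<integral>\<^sup>+ a. ennreal (exp (l * (lin n y a)\<^sup>2)) \<partial>VV n) \<le> (\<integral>\<^sup>+ a. ennreal (f a) \<partial>VV n)"
    by (intro nn_integral_mono ennreal_leI le)
  also have "\<dots> = ennreal (\<integral>a. f a \<partial>VV n)" by (rule nn_integral_eq_integral[OF fi]) (simp add: f0)
  also have "\<dots> \<le> ennreal (exp (l + 16 / lam0\<^sup>2 * l\<^sup>2))" by (rule ennreal_leI) (rule b)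
  finally show ?thesis .
qed

abbreviation cU :: real where "cU \<equiv> chernoff_rate \<beta>"

lemma cU_pos: "0 < cU" using lam0_bounds by (simp add: chernoff_rate_def)

lemma square_sum_tail:
  assumes "sqn n y \<le> 1" and J: "finite J"
  shows "measure (PiM J (\<lambda>_. VV n)) {\<omega> \<in> space (PiM J (\<lambda>_. VV n)). (\<Sum>j\<in>J. (lin n y (\<omega> j))\<^sup>2) > 11 / 10 * card J}
    \<le> exp (- cU * card J)"
proof -
  interpret VV: prob_space "VV n" by (rule VV_prob)
  interpret product_sigma_finite "\<lambda>_. VV n" by standard
  let ?PP = "PiM J (\<lambda>_. VV n)"
  interpret PP: prob_space ?PP by (rule prob_space_PiM) (rule VV_prob)
  \<comment> \<open>The minimiser of 16 l^2 / lam0^2 - l / 10, the exponent per summand at level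
    11/10; the minimum is \<open>- cU\<close>.\<close>
  define l where "l = lam0\<^sup>2 / 320"
  have l: "0 < l" "l \<le> lam0 / 2"
    using lam0_bounds mult_right_mono[of lam0 1 lam0] by (auto simp: l_def power2_eq_square)
  define N where "N = real (card J)"
  have "(\<integral>\<^sup>+ \<omega>. ennreal (exp (l * (\<Sum>j\<in>J. (lin n y (\<omega> j))\<^sup>2))) \<partial>?PP)
     = (\<integral>\<^sup>+ \<omega>. (\<Prod>j\<in>J. ennreal (exp (l * (lin n y (\<omega> j))\<^sup>2))) \<partial>?PP)"
    using J by (simp add: sum_distrib_left exp_sum prod_ennreal)
  also have "\<dots> = (\<Prod>j\<in>J. (\<integral>\<^sup>+ a. ennreal (exp (l * (lin n y a)\<^sup>2)) \<partial>VV n))"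
    by (rule product_nn_integral_prod[OF J]) measurable
  also have "\<dots> \<le> (\<Prod>j\<in>J. ennreal (exp (l + 16 / lam0\<^sup>2 * l\<^sup>2)))"
    by (rule prod_mono_ennreal) (rule square_mgf_le[OF assms(1) less_imp_le[OF l(1)] l(2)])
  also have "\<dots> = ennreal (exp ((l + 16 / lam0\<^sup>2 * l\<^sup>2) * N))"
    by (simp add: ennreal_power exp_of_nat_mult[symmetric] N_def mult.commute)
  finally have E: "(\<integral>\<^sup>+ \<omega>. ennreal (exp (l * (\<Sum>j\<in>J. (lin n y (\<omega> j))\<^sup>2))) \<partial>?PP) \<le> ennreal (exp ((l + 16 / lam0\<^sup>2 * l\<^sup>2) * N))" .
  define S where "S \<omega> = (\<Sum>j\<in>J. (lin n y (\<omega> j))\<^sup>2)" for \<omega>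
  have Sm [measurable]: "S \<in> borel_measurable ?PP" unfolding S_def by measurable
  let ?A = "{\<omega> \<in> space ?PP. S \<omega> > 11 / 10 * N}"
  have A: "?A \<in> sets ?PP" by measurable
  have "ennreal (exp (l * (11 / 10 * N))) * emeasure ?PP ?A = (\<integral>\<^sup>+ \<omega>. ennreal (exp (l * (11 / 10 * N))) * indicator ?A \<omega> \<partial>?PP)"
    using A by (simp add: nn_integral_cmult_indicator)
  also have "\<dots> \<le> (\<integral>\<^sup>+ \<omega>. ennreal (exp (l * S \<omega>)) \<partial>?PP)"
    using l by (intro nn_integral_mono) (auto split: split_indicator intro!: ennreal_leI)
  also have "\<dots> \<le> ennreal (exp ((l + 16 / lam0\<^sup>2 * l\<^sup>2) * N))" using E by (simp add: S_def)
  finally have "ennreal (exp (l * (11 / 10 * N)) * measure ?PP ?A) \<le> ennreal (exp ((l + 16 / lam0\<^sup>2 * l\<^sup>2) * N))"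
    by (simp add: PP.emeasure_eq_measure ennreal_mult)
  then have "exp (l * (11 / 10 * N)) * measure ?PP ?A \<le> exp ((l + 16 / lam0\<^sup>2 * l\<^sup>2) * N)"
    by (subst (asm) ennreal_le_iff) auto
  then have "measure ?PP ?A \<le> exp ((l + 16 / lam0\<^sup>2 * l\<^sup>2) * N) / exp (l * (11 / 10 * N))"
    by (simp add: field_simps)
  also have "\<dots> = exp ((l + 16 / lam0\<^sup>2 * l\<^sup>2) * N - l * (11 / 10 * N))" by (simp add: exp_diff)
  also have "(l + 16 / lam0\<^sup>2 * l\<^sup>2) * N - l * (11 / 10 * N) = - cU * N"
  proof -
    have "16 / lam0\<^sup>2 * l\<^sup>2 = lam0\<^sup>2 / 6400"
      using lam0_bounds by (simp add: l_def power_divide power2_eq_square field_simps)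
    then show ?thesis by (simp only:) (simp add: l_def chernoff_rate_def field_simps)
  qed
  finally show ?thesis by (simp add: S_def N_def)
qed

end

section \<open>Uniform bounds for quadratic forms\<close>

lemma int_abs_le_square: "\<bar>q\<bar> \<le> q\<^sup>2" for q :: int
proof (cases "q = 0")
  case False
  then have "\<bar>q\<bar> * 1 \<le> \<bar>q\<bar> * \<bar>q\<bar>" by (intro mult_left_mono) auto
  then show ?thesis by (simp add: power2_eq_square)
qed simp

lemma sum_half_power_abs_le: "(\<Sum>x\<in>{- int R..int R}. (1/2::real) ^ nat \<bar>x\<bar>) \<le> 3 - 2 * (1/2) ^ R"
proof (induction R)
  case (Suc R)
  have "{- int (Suc R)..int (Suc R)} = insert (- int (Suc R)) (insert (int (Suc R)) {- int R..int R})" by auto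
  then have "(\<Sum>x\<in>{- int (Suc R)..int (Suc R)}. (1/2::real) ^ nat \<bar>x\<bar>)
     = (1/2) ^ Suc R + ((1/2) ^ Suc R + (\<Sum>x\<in>{- int R..int R}. (1/2::real) ^ nat \<bar>x\<bar>))"
    by (simp add: nat_add_distrib)
  then show ?case using Suc by simp
qed simp

text \<open>The net consists of the points of the lattice \<open>(1 / (4 sqrt k)) \<int>\<^sup>k\<close> in the unit ball; rounding
  the coordinates towards zero does not leave the ball, and the cardinality is bounded by weighting
  each lattice point \<open>q\<close> with \<open>2 powr (- \<bar>q\<bar>\<^sub>1)\<close>.\<close>

lemma unit_ball_net:
  obtains S :: "(nat \<Rightarrow> real) set"
  where "finite S" "card S \<le> (3 * 2 ^ 16) ^ k" "\<And>p. p \<in> S \<Longrightarrow> sqn k p \<le> 1"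
    "\<And>u. sqn k u \<le> 1 \<Longrightarrow> \<exists>p\<in>S. sqn k (\<lambda>c. u c - p c) \<le> 1 / 16"
proof (cases "k = 0")
  case True
  show ?thesis by (rule that[of "{\<lambda>_. 0}"]) (auto simp: True sqn_def)
next
  case False
  define s where "s = 4 * sqrt (real k)"
  have s: "s > 0" "s\<^sup>2 = 16 * real k" using False by (auto simp: s_def power_mult_distrib)
  define R where "R = 16 * k"
  define Q where "Q = {q \<in> PiE {..<k} (\<lambda>_. {- int R..int R}). (\<Sum>c<k. (real_of_int (q c))\<^sup>2) \<le> 16 * real k}"
  define pt where "pt q = (\<lambda>c. real_of_int (q c) / s)" for q :: "nat \<Rightarrow> int"
  have finP: "finite (PiE {..<k} (\<lambda>_. {- int R..int R}))" by (rule finite_PiE) auto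
  then have finQ: "finite Q" by (simp add: Q_def)
  show ?thesis
  proof (rule that[of "pt ` Q"])
    show "finite (pt ` Q)" using finQ by simp
    have "real (card Q) = (\<Sum>q\<in>Q. 1)" by simp
    \<comment> \<open>Each point of \<open>Q\<close> has weight at least 1: for integers |q| \<le>
      q^2, so its sum of absolute values is at most 16 k. The total weight then factorises over the
      coordinates.\<close>
    also have "\<dots> \<le> (\<Sum>q\<in>Q. \<Prod>c<k. 2 ^ 16 * (1/2) ^ nat \<bar>q c\<bar>)"
    proof (rule sum_mono)
      fix q assume q: "q \<in> Q"
      have "(\<Sum>c<k. real (nat \<bar>q c\<bar>)) \<le> (\<Sum>c<k. (real_of_int (q c))\<^sup>2)"
      proof (rule sum_mono)
        fix c
        have "real_of_int \<bar>q c\<bar> \<le> real_of_int ((q c)\<^sup>2)" using int_abs_le_square by (simp only: of_int_le_iff)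
        then show "real (nat \<bar>q c\<bar>) \<le> (real_of_int (q c))\<^sup>2" by simp
      qed
      also have "\<dots> \<le> 16 * real k" using q by (simp add: Q_def)
      finally have "real (\<Sum>c<k. nat \<bar>q c\<bar>) \<le> real (16 * k)" by simp
      then have "(\<Sum>c<k. nat \<bar>q c\<bar>) \<le> 16 * k" by (simp only: of_nat_le_iff)
      then have "(2::real) ^ (\<Sum>c<k. nat \<bar>q c\<bar>) \<le> 2 ^ (16 * k)" by (rule power_increasing) simp
      then have "(1::real) \<le> 2 ^ (16 * k) * (1/2) ^ (\<Sum>c<k. nat \<bar>q c\<bar>)" by (simp add: power_one_over)
      also have "\<dots> = (\<Prod>c<k. 2 ^ 16 * (1/2) ^ nat \<bar>q c\<bar>)"
        by (simp only: prod.distrib power_sum prod_constant power_mult card_lessThan)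
      finally show "1 \<le> (\<Prod>c<k. (2::real) ^ 16 * (1/2) ^ nat \<bar>q c\<bar>)" .
    qed
    also have "\<dots> \<le> (\<Sum>q\<in>PiE {..<k} (\<lambda>_. {- int R..int R}). \<Prod>c<k. 2 ^ 16 * (1/2) ^ nat \<bar>q c\<bar>)"
      by (rule sum_mono2[OF finP]) (unfold Q_def, blast, intro prod_nonneg ballI mult_nonneg_nonneg, auto)
    also have "\<dots> = (\<Prod>c<k. \<Sum>x\<in>{- int R..int R}. 2 ^ 16 * (1/2) ^ nat \<bar>x\<bar>)"
      by (rule prod_sum_PiE[symmetric]) auto
    also have "\<dots> \<le> (\<Prod>c<k. 2 ^ 16 * 3)"
    proof (intro prod_mono conjI)
      fix c
      show "0 \<le> (\<Sum>x\<in>{- int R..int R}. (2::real) ^ 16 * (1/2) ^ nat \<bar>x\<bar>)" by (intro sum_nonneg) auto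
      have "(\<Sum>x\<in>{- int R..int R}. (1/2::real) ^ nat \<bar>x\<bar>) \<le> 3 - 2 * (1/2) ^ R" by (rule sum_half_power_abs_le)
      also have "\<dots> \<le> 3" by simp
      finally show "(\<Sum>x\<in>{- int R..int R}. (2::real) ^ 16 * (1/2) ^ nat \<bar>x\<bar>) \<le> 2 ^ 16 * 3"
        unfolding sum_distrib_left[symmetric] by (rule mult_left_mono) simp
    qed
    also have "\<dots> = real ((3 * 2 ^ 16) ^ k)" by simp
    finally have "card Q \<le> (3 * 2 ^ 16) ^ k" by (simp only: of_nat_le_iff)
    then show "card (pt ` Q) \<le> (3 * 2 ^ 16) ^ k" using card_image_le[OF finQ, of pt] by linarith
    show "sqn k p \<le> 1" if pQ: "p \<in> pt ` Q" for p
    proof -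
      obtain q where q: "q \<in> Q" "p = pt q" using pQ by auto
      have "sqn k p = (\<Sum>c<k. (real_of_int (q c))\<^sup>2) / s\<^sup>2"
        by (simp add: sqn_def q pt_def power_divide sum_divide_distrib)
      then show ?thesis using q s False by (simp add: Q_def)
    qed
    fix u assume u: "sqn k u \<le> 1"
    \<comment> \<open>Rounding errs by at most 1/s per coordinate, in total k / s^2 = 1/16. The
      value \<open>undefined\<close> beyond \<open>k\<close> is what membership in
      \<open>PiE\<close> demands.\<close>
    define q where "q c = (if c < k then (if 0 \<le> u c then \<lfloor>u c * s\<rfloor> else \<lceil>u c * s\<rceil>) else undefined)" for c
    have q1: "\<bar>real_of_int (q c)\<bar> \<le> \<bar>u c * s\<bar>" "\<bar>u c * s - real_of_int (q c)\<bar> \<le> 1" if "c < k" for c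
    proof -
      show "\<bar>u c * s - real_of_int (q c)\<bar> \<le> 1" using that unfolding q_def by simp linarith
      show "\<bar>real_of_int (q c)\<bar> \<le> \<bar>u c * s\<bar>"
      proof (cases "0 \<le> u c")
        case True
        then have "0 \<le> u c * s" using s by simp
        then show ?thesis using that True unfolding q_def by simp
      next
        case False
        then have "u c * s \<le> 0" using s by (simp add: mult_nonpos_nonneg)
        moreover then have "real_of_int \<lceil>u c * s\<rceil> \<le> 0" by simp
        ultimately show ?thesis using that False unfolding q_def by simp
      qed
    qed
    have "(\<Sum>c<k. (real_of_int (q c))\<^sup>2) \<le> (\<Sum>c<k. (u c * s)\<^sup>2)"
      using q1(1) by (intro sum_mono) (simp add: abs_le_square_iff)
    also have "\<dots> = sqn k u * s\<^sup>2" by (simp add: sqn_def sum_distrib_right power_mult_distrib)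
    also have "\<dots> \<le> 1 * s\<^sup>2" using u by (rule mult_right_mono) simp
    finally have sq: "(\<Sum>c<k. (real_of_int (q c))\<^sup>2) \<le> 16 * real k" using s by simp
    have "q c \<in> {- int R..int R}" if c: "c < k" for c
    proof -
      have "(real_of_int (q c))\<^sup>2 \<le> (\<Sum>c<k. (real_of_int (q c))\<^sup>2)" by (rule member_le_sum) (use c in auto)
      with sq have "real_of_int ((q c)\<^sup>2) \<le> real_of_int (int R)" by (simp add: R_def)
      then have "(q c)\<^sup>2 \<le> int R" by (simp only: of_int_le_iff)
      moreover have "\<bar>q c\<bar> \<le> (q c)\<^sup>2" by (rule int_abs_le_square)
      ultimately show ?thesis by auto
    qed
    then have "q \<in> Q" using sq by (auto simp: Q_def PiE_def extensional_def q_def[of "_::nat"])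
    moreover have "sqn k (\<lambda>c. u c - pt q c) \<le> 1 / 16"
    proof -
      have "sqn k (\<lambda>c. u c - pt q c) \<le> (\<Sum>c<k. 1 / s\<^sup>2)"
        unfolding sqn_def
      proof (rule sum_mono)
        fix c assume "c \<in> {..<k}"
        then have "\<bar>u c * s - real_of_int (q c)\<bar> \<le> 1" using q1 by auto
        then have "(u c * s - real_of_int (q c))\<^sup>2 \<le> 1" by (simp add: abs_square_le_1)
        moreover have "u c - pt q c = (u c * s - real_of_int (q c)) / s" using s by (simp add: pt_def diff_divide_distrib)
        ultimately show "(u c - pt q c)\<^sup>2 \<le> 1 / s\<^sup>2" by (simp add: power_divide divide_right_mono)
      qed
      also have "\<dots> = 1 / 16" using s False by simp
      finally show ?thesis .
    qed
    ultimately show "\<exists>p\<in>pt ` Q. sqn k (\<lambda>c. u c - p c) \<le> 1 / 16" by blast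
  qed
qed

text \<open>Self-improvement of the supremum s over the unit ball, finite by Cauchy-Schwarz. A point
  of the ball is a net point plus a remainder of length at most 1/4, on which Q is at most s/16;
  with (a + b)^2 \<le> 4/3 a^2 + 4 b^2 this gives s \<le> 4/3 B + s/4.\<close>

lemma net_quadratic_form_le:
  fixes \<phi> :: "'j \<Rightarrow> nat \<Rightarrow> real" and J :: "'j set" and k :: nat
  defines "Q \<equiv> \<lambda>u. \<Sum>j\<in>J. (\<Sum>c<k. u c * \<phi> j c)\<^sup>2"
  assumes net: "\<And>u. sqn k u \<le> 1 \<Longrightarrow> \<exists>p\<in>S. sqn k (\<lambda>c. u c - p c) \<le> 1 / 16"
    and S: "\<And>p. p \<in> S \<Longrightarrow> Q p \<le> B"
  shows "Q u \<le> 16 / 9 * B * sqn k u"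
proof -
  have Qscale: "Q (\<lambda>c. t * u c) = t\<^sup>2 * Q u" for t u
  proof -
    have e: "(\<Sum>c<k. t * u c * \<phi> j c) = t * (\<Sum>c<k. u c * \<phi> j c)" for j
      by (simp add: sum_distrib_left mult.assoc)
    show ?thesis unfolding Q_def e power_mult_distrib by (rule sum_distrib_left[symmetric])
  qed
  define A where "A = {Q u |u. sqn k u \<le> 1}"
  have bdd: "bdd_above A"
  proof (rule bdd_aboveI)
    fix x assume "x \<in> A"
    then obtain u where u: "sqn k u \<le> 1" "x = Q u" by (auto simp: A_def)
    have "Q u \<le> (\<Sum>j\<in>J. sqn k u * sqn k (\<phi> j))"
      unfolding Q_def sqn_def by (intro sum_mono Cauchy_Schwarz_ineq_sum)
    also have "\<dots> \<le> (\<Sum>j\<in>J. 1 * sqn k (\<phi> j))" using u by (intro sum_mono mult_right_mono sqn_nonneg)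
    finally show "x \<le> (\<Sum>j\<in>J. sqn k (\<phi> j))" using u by simp
  qed
  define s where "s = Sup A"
  have le_s: "Q u \<le> s" if "sqn k u \<le> 1" for u
    unfolding s_def by (rule cSup_upper[OF _ bdd]) (use that in \<open>auto simp: A_def\<close>)
  have "s \<le> 4/3 * B + s / 4"
  proof -
    have "sqn k (\<lambda>_. 0) \<le> 1" by (simp add: sqn_def)
    then have "A \<noteq> {}" unfolding A_def by blast
    moreover have "x \<le> 4/3 * B + s / 4" if xA: "x \<in> A" for x
    proof -
      obtain u where u: "sqn k u \<le> 1" "x = Q u" using xA by (auto simp: A_def)
      obtain p where p: "p \<in> S" "sqn k (\<lambda>c. u c - p c) \<le> 1 / 16" using net[OF u(1)] by auto
      define v where "v c = u c - p c" for c
      have "sqn k (\<lambda>c. 4 * v c) = 16 * sqn k v" by (simp add: sqn_def power_mult_distrib sum_distrib_left)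
      also have "\<dots> \<le> 1" using p(2) unfolding v_def[abs_def] by simp
      finally have "Q (\<lambda>c. 4 * v c) \<le> s" by (rule le_s)
      then have v: "Q v \<le> s / 16" unfolding Qscale by simp
      have "Q u \<le> (\<Sum>j\<in>J. 4/3 * (\<Sum>c<k. p c * \<phi> j c)\<^sup>2 + 4 * (\<Sum>c<k. v c * \<phi> j c)\<^sup>2)"
        unfolding Q_def
      proof (rule sum_mono)
        fix j
        have e: "(\<Sum>c<k. u c * \<phi> j c) = (\<Sum>c<k. p c * \<phi> j c) + (\<Sum>c<k. v c * \<phi> j c)"
          by (simp add: v_def sum.distrib[symmetric] algebra_simps)
        have "(a + b)\<^sup>2 \<le> 4/3 * a\<^sup>2 + 4 * b\<^sup>2" for a b :: real
        proof -
          have "0 \<le> (a - 3 * b)\<^sup>2 / 3" by simp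
          then show ?thesis by (simp add: power2_eq_square algebra_simps)
        qed
        then show "(\<Sum>c<k. u c * \<phi> j c)\<^sup>2 \<le> 4/3 * (\<Sum>c<k. p c * \<phi> j c)\<^sup>2 + 4 * (\<Sum>c<k. v c * \<phi> j c)\<^sup>2"
          unfolding e by blast
      qed
      also have "\<dots> = 4/3 * Q p + 4 * Q v" by (simp add: Q_def sum.distrib sum_distrib_left)
      also have "\<dots> \<le> 4/3 * B + s / 4" using v S[OF p(1)] by simp
      finally show ?thesis using u by simp
    qed
    ultimately show ?thesis unfolding s_def by (rule cSup_least)
  qed
  then have s: "s \<le> 16/9 * B" by simp
  show ?thesis
  proof (cases "sqn k u = 0")
    case True
    then have "\<forall>c<k. u c = 0" by (simp add: sqn_def sum_nonneg_eq_0_iff)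
    then have "Q u = 0" by (simp add: Q_def)
    then show ?thesis using True by simp
  next
    case False
    define t where "t = sqrt (sqn k u)"
    have t: "t > 0" "t\<^sup>2 = sqn k u" using False sqn_nonneg[of k u] by (auto simp: t_def)
    have "sqn k (\<lambda>c. (1 / t) * u c) = (1 / t)\<^sup>2 * sqn k u" by (simp add: sqn_def power_divide sum_divide_distrib)
    also have "\<dots> = 1" using t False by (simp add: power_divide)
    finally have "Q (\<lambda>c. (1 / t) * u c) \<le> 16/9 * B" using le_s[of "\<lambda>c. (1 / t) * u c"] s by linarith
    then have "Q u / t\<^sup>2 \<le> 16/9 * B" unfolding Qscale by (simp add: power_divide)
    moreover have "0 < t\<^sup>2" using t(1) by simp
    ultimately have "Q u \<le> 16/9 * B * t\<^sup>2" by (simp only: divide_le_eq if_True)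
    then show ?thesis using t by simp
  qed
qed

lemma sqn_matvec_orthonormal:
  assumes "\<And>a a'. a < k \<Longrightarrow> a' < k \<Longrightarrow> (\<Sum>r<n. Z r a * Z r a') = (if a = a' then 1 else 0)"
  shows "sqn n (matvec k Z u) = sqn k u"
    "(\<Sum>r<n. matvec k Z u r * matvec k Z v r) = (\<Sum>a<k. u a * v a)"
proof -
  show i: "(\<Sum>r<n. matvec k Z u r * matvec k Z v r) = (\<Sum>a<k. u a * v a)" for u v
  proof -
    have "(\<Sum>r<n. matvec k Z u r * matvec k Z v r) = (\<Sum>r<n. \<Sum>a<k. \<Sum>a'<k. u a * v a' * (Z r a * Z r a'))"
      by (simp add: matvec_def sum_product mult_ac)
    also have "\<dots> = (\<Sum>a<k. \<Sum>a'<k. \<Sum>r<n. u a * v a' * (Z r a * Z r a'))"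
      by (subst sum.swap) (intro sum.cong refl sum.swap)
    also have "\<dots> = (\<Sum>a<k. \<Sum>a'<k. u a * v a' * (if a = a' then 1 else 0))"
      using assms by (intro sum.cong refl) (simp add: sum_distrib_left[symmetric])
    also have "\<dots> = (\<Sum>a<k. u a * v a)"
      by (simp add: if_distrib[of "\<lambda>x. _ * x"] cong: if_cong)
    finally show ?thesis .
  qed
  show "sqn n (matvec k Z u) = sqn k u" using i[of u u] by (simp add: sqn_def power2_eq_square)
qed

lemma lin_matvec: "lin n (matvec k Z u) a = (\<Sum>c<k. u c * lin n (\<lambda>r. Z r c) a)"
proof -
  have "lin n (matvec k Z u) a = (\<Sum>r<n. \<Sum>c<k. u c * (a r * Z r c))"
    by (simp add: lin_def matvec_def sum_distrib_left mult_ac)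
  also have "\<dots> = (\<Sum>c<k. \<Sum>r<n. u c * (a r * Z r c))" by (rule sum.swap)
  finally show ?thesis by (simp add: lin_def sum_distrib_left)
qed

context unit_subgaussian
begin

text \<open>Union bound over the net, at the level 11/10 of \<open>square_sum_tail\<close>. Passing
  from the net to the whole ball costs 16/9, and 16/9 * 11/10 is still below 2.\<close>

theorem sample_covariance_upper_tail:
  assumes Z: "\<And>a a'. a < k \<Longrightarrow> a' < k \<Longrightarrow> (\<Sum>r<n. Z r a * Z r a') = (if a = a' then 1 else 0)"
    and J: "finite J"
  shows "\<exists>E\<in>sets (PiM J (\<lambda>_. VV n)). measure (PiM J (\<lambda>_. VV n)) E \<ge> 1 - (3 * 2 ^ 16) ^ k * exp (- cU * card J) \<and>
    (\<forall>\<omega>\<in>E. \<forall>u. (\<Sum>j\<in>J. (lin n (matvec k Z u) (\<omega> j))\<^sup>2) \<le> 2 * card J * sqn k u)"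
proof -
  let ?PP = "PiM J (\<lambda>_. VV n)"
  interpret PP: prob_space ?PP by (rule prob_space_PiM) (rule VV_prob)
  obtain S where S: "finite S" "card S \<le> (3 * 2 ^ 16) ^ k" "\<And>p. p \<in> S \<Longrightarrow> sqn k p \<le> 1"
    "\<And>u. sqn k u \<le> 1 \<Longrightarrow> \<exists>p\<in>S. sqn k (\<lambda>c. u c - p c) \<le> 1 / 16"
    using unit_ball_net[of k] by blast
  define B where "B p = {\<omega> \<in> space ?PP. (\<Sum>j\<in>J. (lin n (matvec k Z p) (\<omega> j))\<^sup>2) > 11 / 10 * card J}" for p
  have Bs: "B p \<in> sets ?PP" for p unfolding B_def by measurable
  define E where "E = space ?PP - (\<Union>p\<in>S. B p)"
  have "measure ?PP (\<Union>p\<in>S. B p) \<le> (\<Sum>p\<in>S. measure ?PP (B p))"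
    by (rule PP.finite_measure_subadditive_finite) (use S Bs in auto)
  also have "\<dots> \<le> (\<Sum>p\<in>S. exp (- cU * card J))"
    unfolding B_def using S(3) J
    by (intro sum_mono square_sum_tail) (simp_all add: sqn_matvec_orthonormal(1)[OF Z])
  also have "\<dots> \<le> (3 * 2 ^ 16) ^ k * exp (- cU * card J)"
  proof -
    have "real (card S) \<le> real ((3 * 2 ^ 16) ^ k)" using S(2) by (simp only: of_nat_le_iff)
    then show ?thesis by (simp add: mult_right_mono)
  qed
  finally have m: "measure ?PP (\<Union>p\<in>S. B p) \<le> (3 * 2 ^ 16) ^ k * exp (- cU * card J)" .
  have Us: "(\<Union>p\<in>S. B p) \<in> sets ?PP" using S(1) Bs by (intro sets.finite_UN) auto
  have "measure ?PP E \<ge> 1 - (3 * 2 ^ 16) ^ k * exp (- cU * card J)"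
    unfolding E_def using PP.prob_compl[OF Us] m by linarith
  moreover have "E \<in> sets ?PP" unfolding E_def using Us by auto
  moreover have "(\<Sum>j\<in>J. (lin n (matvec k Z u) (\<omega> j))\<^sup>2) \<le> 2 * card J * sqn k u" if "\<omega> \<in> E" for \<omega> u
  proof -
    have "(\<Sum>j\<in>J. (lin n (matvec k Z p) (\<omega> j))\<^sup>2) \<le> 11 / 10 * card J" if "p \<in> S" for p
      using \<open>\<omega> \<in> E\<close> that by (auto simp: E_def B_def not_less)
    then have "(\<Sum>j\<in>J. (\<Sum>c<k. u c * lin n (\<lambda>r. Z r c) (\<omega> j))\<^sup>2) \<le> 16 / 9 * (11 / 10 * card J) * sqn k u"
      unfolding lin_matvec by (intro net_quadratic_form_le[OF S(4)])
    also have "\<dots> \<le> 2 * card J * sqn k u"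
      using sqn_nonneg[of k u] by (intro mult_right_mono) auto
    finally show ?thesis unfolding lin_matvec .
  qed
  ultimately show ?thesis by blast
qed

abbreviation tauL :: real where "tauL \<equiv> truncation_const \<beta>"

lemma tauL_pos: "0 < tauL" using lam0_bounds by (simp add: truncation_const_def)

text \<open>Truncating the vectors only decreases the quadratic form, so no tail bound for their lengths is
  needed: a fourth moment controls the loss in expectation.\<close>

theorem anisotropic_lower_tail:
  fixes y :: "'j \<Rightarrow> nat \<Rightarrow> nat \<Rightarrow> real"
  assumes J: "finite J" and ne: "J \<noteq> {}" and S0: "S0 > 0"
    and trace: "\<And>j. j \<in> J \<Longrightarrow> (\<Sum>c<d. sqn n (y j c)) \<le> S0"
    and upper: "\<And>w. (\<Sum>j\<in>J. sqn n (\<lambda>r. \<Sum>c<d. w c * y j c r)) \<le> card J * sqn d w"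
    and R: "tauL * S0 * real R \<le> exp (-2) / 12800 * card J"
  shows "\<exists>E\<in>sets (PiM J (\<lambda>_. VV n)). measure (PiM J (\<lambda>_. VV n)) E \<ge> 1 - d * exp (-2) ^ R \<and>
    (\<forall>\<omega>\<in>E. \<forall>w. 19/20 * (\<Sum>j\<in>J. sqn n (\<lambda>r. \<Sum>c<d. w c * y j c r)) - 1/20 * card J * sqn d w
       \<le> (\<Sum>j\<in>J. (lin n (\<lambda>r. \<Sum>c<d. w c * y j c r) (\<omega> j))\<^sup>2))"
proof -
  interpret VV: prob_space "VV n" by (rule VV_prob)
  define T where "T = tauL * S0"
  have T: "T > 0" using tauL_pos S0 by (simp add: T_def)
  define \<phi> where "\<phi> j a c = (if c < d then lin n (y j c) a else 0)" for j a c
  define \<psi> where "\<psi> j a c = (if sqn d (\<phi> j a) \<le> T then \<phi> j a c else 0)" for j a c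
  have comb: "(\<Sum>c<d. w c * \<phi> j a c) = lin n (\<lambda>r. \<Sum>c<d. w c * y j c r) a" for w j a
  proof -
    have "(\<Sum>c<d. w c * \<phi> j a c) = (\<Sum>c<d. \<Sum>r<n. a r * (w c * y j c r))"
      by (simp add: \<phi>_def lin_def sum_distrib_left mult_ac)
    also have "\<dots> = (\<Sum>r<n. \<Sum>c<d. a r * (w c * y j c r))" by (rule sum.swap)
    finally show ?thesis by (simp add: lin_def sum_distrib_left)
  qed
  have sqphi: "sqn d (\<phi> j a) = (\<Sum>c<d. (lin n (y j c) a)\<^sup>2)" for j a by (simp add: sqn_def \<phi>_def)
  have phim [measurable]: "(\<lambda>a. \<phi> j a c) \<in> borel_measurable (VV n)" for j c
    unfolding \<phi>_def by measurable
  have sqm [measurable]: "(\<lambda>a. sqn d (\<phi> j a)) \<in> borel_measurable (VV n)" for j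
    unfolding sqphi by measurable
  have psim [measurable]: "(\<lambda>a. \<psi> j a c) \<in> borel_measurable (VV n)" for j c
    unfolding \<psi>_def by measurable
  have psi_comb: "(\<Sum>c<d. w c * \<psi> j a c) = (if sqn d (\<phi> j a) \<le> T then lin n (\<lambda>r. \<Sum>c<d. w c * y j c r) a else 0)" for w j a
    unfolding \<psi>_def comb[symmetric] by simp
  have psi_le: "(\<Sum>c<d. w c * \<psi> j a c)\<^sup>2 \<le> (lin n (\<lambda>r. \<Sum>c<d. w c * y j c r) a)\<^sup>2" for w j a
    unfolding psi_comb by simp
  have psi_int: "integrable (VV n) (\<lambda>a. (\<Sum>c<d. w c * \<psi> j a c)\<^sup>2)" for w j
    by (rule Bochner_Integration.integrable_bound[OF lin_square(1)[of n "\<lambda>r. \<Sum>c<d. w c * y j c r"]])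
       (use psi_le in auto)
  have psi_energy_le: "(\<integral>a. (\<Sum>c<d. w c * \<psi> j a c)\<^sup>2 \<partial>VV n) \<le> sqn n (\<lambda>r. \<Sum>c<d. w c * y j c r)" for w j
    unfolding lin_square(2)[symmetric] by (rule integral_mono[OF psi_int lin_square(1) psi_le])
  have psi_energy_ge: "19/20 * sqn n (\<lambda>r. \<Sum>c<d. w c * y j c r) \<le> (\<integral>a. (\<Sum>c<d. w c * \<psi> j a c)\<^sup>2 \<partial>VV n)"
    if j: "j \<in> J" for w j
  proof -
    define v where "v r = (\<Sum>c<d. w c * y j c r)" for r
    have ve: "v = (\<lambda>r. \<Sum>c<d. w c * y j c r)" by (simp add: v_def fun_eq_iff)
    define q where "q = sqn n v"
    show ?thesis
    proof (cases "q = 0")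
      case True then show ?thesis by (simp add: v_def[symmetric] q_def[symmetric] integral_nonneg_AE)
    next
      case False
      then have q: "q > 0" using sqn_nonneg[of n v] by (simp add: q_def)
      define C where "C = 4 / lam0\<^sup>2"
      have C: "C > 0" using lam0_bounds by (simp add: C_def)
      \<comment> \<open>Where the vector is cut off, x \<le> e/(2q) x^2 + q/(2e) and the last term
        may be multiplied by the squared length over \<open>T\<close>, which exceeds 1. With this
        \<open>e\<close> the fourth moment term costs q/40; with \<open>T\<close> = 400 C S0 the
        length term costs q/40 as well. Together this is the loss of 1/20.\<close>
      define e where "e = 1 / (20 * C)"
      have e: "e > 0" using C by (simp add: e_def)
      have pw: "(lin n v a)\<^sup>2 - (e / (2 * q) * (lin n v a) ^ 4 + q / (2 * e) * (sqn d (\<phi> j a) / T))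
         \<le> (\<Sum>c<d. w c * \<psi> j a c)\<^sup>2" for a
      proof (cases "sqn d (\<phi> j a) \<le> T")
        case True
        have "0 \<le> e / (2 * q) * (lin n v a) ^ 4 + q / (2 * e) * (sqn d (\<phi> j a) / T)"
          using e q T by (intro add_nonneg_nonneg mult_nonneg_nonneg divide_nonneg_nonneg sqn_nonneg) auto
        then show ?thesis unfolding psi_comb ve[symmetric] using True by simp
      next
        case F: False
        define x where "x = (lin n v a)\<^sup>2"
        have "0 \<le> (x * e - q)\<^sup>2 / (2 * q * e)" using e q by simp
        also have "\<dots> = e / (2 * q) * x\<^sup>2 + q / (2 * e) - x"
          using e q by (simp add: power2_eq_square field_simps)
        finally have "x \<le> e / (2 * q) * x\<^sup>2 + q / (2 * e) * 1" by simp
        also have "\<dots> \<le> e / (2 * q) * x\<^sup>2 + q / (2 * e) * (sqn d (\<phi> j a) / T)"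
          using F T e q by (intro add_left_mono mult_left_mono) auto
        finally have "(lin n v a)\<^sup>2 \<le> e / (2 * q) * (lin n v a) ^ 4 + q / (2 * e) * (sqn d (\<phi> j a) / T)"
          by (simp add: x_def)
        then show ?thesis unfolding psi_comb ve[symmetric] using F by simp
      qed
      have si: "integrable (VV n) (\<lambda>a. sqn d (\<phi> j a))" "(\<integral>a. sqn d (\<phi> j a) \<partial>VV n) \<le> S0"
        unfolding sqphi using lin_square trace[OF j] by auto
      have "(\<integral>a. (lin n v a)\<^sup>2 - (e / (2 * q) * (lin n v a) ^ 4 + q / (2 * e) * (sqn d (\<phi> j a) / T)) \<partial>VV n)
        = q - (e / (2 * q) * (\<integral>a. (lin n v a) ^ 4 \<partial>VV n) + q / (2 * e) * ((\<integral>a. sqn d (\<phi> j a) \<partial>VV n) / T))"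
        using si lin_square[of n v] lin_fourth[of n v] by (simp add: q_def)
      moreover have "(\<integral>a. (lin n v a)\<^sup>2 - (e / (2 * q) * (lin n v a) ^ 4 + q / (2 * e) * (sqn d (\<phi> j a) / T)) \<partial>VV n)
        \<le> (\<integral>a. (\<Sum>c<d. w c * \<psi> j a c)\<^sup>2 \<partial>VV n)"
        by (rule integral_mono[OF _ psi_int pw]) (use si lin_square[of n v] lin_fourth[of n v] in auto)
      moreover have "e / (2 * q) * (\<integral>a. (lin n v a) ^ 4 \<partial>VV n) \<le> e / (2 * q) * (C * q\<^sup>2)"
        using lin_fourth[of n v] e q by (intro mult_left_mono) (auto simp: C_def q_def)
      moreover have "e / (2 * q) * (C * q\<^sup>2) = q / 40" using C q by (simp add: e_def power2_eq_square)
      moreover have "q / (2 * e) * ((\<integral>a. sqn d (\<phi> j a) \<partial>VV n) / T) \<le> q / (2 * e) * (S0 / T)"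
        using si e q T by (intro mult_left_mono divide_right_mono) auto
      moreover have "q / (2 * e) * (S0 / T) = q / 40"
      proof -
        have "S0 / T = 1 / (400 * C)" using S0 by (simp add: T_def truncation_const_def C_def)
        then show ?thesis using C by (simp add: e_def)
      qed
      ultimately have "19/20 * q \<le> (\<integral>a. (\<Sum>c<d. w c * \<psi> j a c)\<^sup>2 \<partial>VV n)" by linarith
      then show ?thesis unfolding q_def ve .
    qed
  qed
  interpret BV: bounded_vectors "VV n" J d \<psi> T "card J"
  proof
    show "finite J" by (rule J)
    show "(\<lambda>x. \<psi> j x c) \<in> borel_measurable (VV n)" for j c by (rule psim)
    show "\<psi> j x c = 0" if "d \<le> c" for j x c using that by (simp add: \<psi>_def \<phi>_def)
    show "sqn d (\<psi> j x) \<le> T" for j x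
      using T by (cases "sqn d (\<phi> j x) \<le> T") (auto simp: \<psi>_def sqn_def)
    show "(\<Sum>j\<in>J. \<integral>x. (\<Sum>c<d. w c * \<psi> j x c)\<^sup>2 \<partial>VV n) \<le> real (card J) * sqn d w" for w
      using upper[of w] by (intro order_trans[OF sum_mono[OF psi_energy_le]]) auto
  qed
  have N: "real (card J) > 0" using J ne by (simp add: card_gt_0_iff)
  have "exp (-2) / 12800 \<le> (1::real)" by (rule order_trans[of _ "exp (-2)"]) auto
  then obtain E where E: "E \<in> sets BV.PP" "measure BV.PP E \<ge> 1 - real d * (32 * (exp (-2) / 12800) / (1/20)\<^sup>2) ^ R"
    and Ew: "\<And>\<omega> w. \<omega> \<in> E \<Longrightarrow> (\<Sum>j\<in>J. \<integral>x. (\<Sum>c<d. w c * \<psi> j x c)\<^sup>2 \<partial>VV n) - 1/20 * card J * sqn d w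
        \<le> (\<Sum>j\<in>J. (\<Sum>c<d. w c * \<psi> j (\<omega> j) c)\<^sup>2)"
    using BV.quadratic_form_lower_tail[OF T N, of "exp (-2) / 12800" R "1/20"] R by (auto simp: T_def)
  \<comment> \<open>Origin of 12800 = 32 * 20^2: each further order of the trace then gains a factor
    exp (-2) at accuracy 1/20.\<close>
  have "32 * (exp (-2) / 12800) / (1/20)\<^sup>2 = (exp (-2) :: real)" by (simp add: power2_eq_square)
  then have m: "measure BV.PP E \<ge> 1 - real d * exp (-2) ^ R" using E(2) by simp
  have "19/20 * (\<Sum>j\<in>J. sqn n (\<lambda>r. \<Sum>c<d. w c * y j c r)) - 1/20 * card J * sqn d w
       \<le> (\<Sum>j\<in>J. (lin n (\<lambda>r. \<Sum>c<d. w c * y j c r) (\<omega> j))\<^sup>2)" if "\<omega> \<in> E" for \<omega> w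
  proof -
    have "19/20 * (\<Sum>j\<in>J. sqn n (\<lambda>r. \<Sum>c<d. w c * y j c r)) \<le> (\<Sum>j\<in>J. \<integral>x. (\<Sum>c<d. w c * \<psi> j x c)\<^sup>2 \<partial>VV n)"
      unfolding sum_distrib_left by (rule sum_mono) (rule psi_energy_ge)
    moreover have "(\<Sum>j\<in>J. (\<Sum>c<d. w c * \<psi> j (\<omega> j) c)\<^sup>2) \<le> (\<Sum>j\<in>J. (lin n (\<lambda>r. \<Sum>c<d. w c * y j c r) (\<omega> j))\<^sup>2)"
      by (rule sum_mono) (rule psi_le)
    ultimately show ?thesis using Ew[OF that, of w] by linarith
  qed
  then show ?thesis using E(1) m by blast
qed

end

section \<open>Deterministic convergence\<close>

lemma matvec_add: "matvec d M (\<lambda>a. u a + v a) i = matvec d M u i + matvec d M v i"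
  by (simp add: matvec_def algebra_simps sum.distrib)

lemma matvec_diff: "matvec d M (\<lambda>a. u a - v a) i = matvec d M u i - matvec d M v i"
  by (simp add: matvec_def algebra_simps sum_subtractf)

lemma matvec_scale: "matvec d M (\<lambda>a. t * u a) i = t * matvec d M u i"
  by (simp add: matvec_def sum_distrib_left mult_ac)

lemma matvec_upd: "a < d \<Longrightarrow> matvec d M (v(a := v a + s)) i = matvec d M v i + s * M i a"
proof -
  assume a: "a < d"
  have "matvec d M (v(a := v a + s)) i = (\<Sum>c<d. M i c * v c + (if c = a then s * M i a else 0))"
    unfolding matvec_def by (intro sum.cong) (auto simp: algebra_simps)
  then show ?thesis using a by (simp add: sum.distrib matvec_def)
qed

lemma sqn_eq_0_iff: "sqn d v = 0 \<longleftrightarrow> (\<forall>a<d. v a = 0)"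
  by (auto simp: sqn_def sum_nonneg_eq_0_iff)

section \<open>The constraint set and the projection onto it\<close>

lemma continuous_on_coord: "continuous_on S (\<lambda>v :: nat \<Rightarrow> real. v a)"
  by (rule continuous_on_subset[OF continuous_on_product_coordinates]) simp

text \<open>Orthonormal columns make |v| equal to |B v|, which the entrywise constraint bounds; so
  the set is a closed part of a product of intervals, compact in the product topology. This ensures
  that the minimiser chosen in \<open>proj\<close> exists.\<close>

lemma B_rho_compact:
  assumes orth: "\<And>a a'. a < h \<Longrightarrow> a' < h \<Longrightarrow> (\<Sum>i<m. B i a * B i a') = (if a = a' then 1 else 0)"
  shows "compact (B_rho m h B \<rho>)"
proof -
  define r where "r = sqrt (real m * (1 + \<bar>\<rho>\<bar>)\<^sup>2)"
  define K :: "(nat \<Rightarrow> real) set" where "K = PiE UNIV (\<lambda>a. {- r..r})"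
  have "compactin (product_topology (\<lambda>_::nat. euclideanreal) UNIV) K"
    unfolding K_def compactin_PiE by auto
  then have K: "compact K" by (simp add: euclidean_product_topology)
  have "B_rho m h B \<rho> \<subseteq> K"
  proof
    fix v assume v: "v \<in> B_rho m h B \<rho>"
    have "sqn h v = sqn m (matvec h B v)"
      by (rule sqn_matvec_orthonormal(1)[symmetric]) (rule orth)
    also have "\<dots> \<le> (\<Sum>i<m. (1 + \<bar>\<rho>\<bar>)\<^sup>2)"
      unfolding sqn_def
    proof (rule sum_mono)
      fix i assume "i \<in> {..<m}"
      then have "\<bar>matvec h B v i - 1\<bar> \<le> \<rho>" using v by (auto simp: B_rho_def G_rho_def)
      then have "\<bar>matvec h B v i\<bar> \<le> \<bar>1 + \<bar>\<rho>\<bar>\<bar>" by linarith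
      then show "(matvec h B v i)\<^sup>2 \<le> (1 + \<bar>\<rho>\<bar>)\<^sup>2" by (simp only: abs_le_square_iff)
    qed
    finally have le: "sqn h v \<le> real m * (1 + \<bar>\<rho>\<bar>)\<^sup>2" by simp
    have "\<bar>v a\<bar> \<le> r" for a
    proof (cases "a < h")
      case True
      have "(v a)\<^sup>2 \<le> sqn h v" unfolding sqn_def by (rule member_le_sum) (use True in auto)
      then have "sqrt ((v a)\<^sup>2) \<le> r" unfolding r_def using le by (intro real_sqrt_le_mono) linarith
      then show ?thesis by simp
    next
      case False
      then have "v a = 0" using v by (simp add: B_rho_def)
      then show ?thesis by (simp add: r_def)
    qed
    then have "\<And>a. v a \<in> {- r..r}" by (simp add: abs_le_iff) (metis minus_le_iff)
    then show "v \<in> K" by (simp add: K_def PiE_UNIV_domain)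
  qed
  moreover have "closed (B_rho m h B \<rho>)"
  proof -
    have c: "continuous_on UNIV (\<lambda>v. matvec h B v i)" for i
      unfolding matvec_def by (intro continuous_intros continuous_on_coord)
    have "B_rho m h B \<rho> = (\<Inter>a\<in>{h..}. {v. v a = 0}) \<inter> {v. (\<Sum>i<m. matvec h B v i - 1) = 0}
        \<inter> (\<Inter>i\<in>{..<m}. {v. \<bar>matvec h B v i - 1\<bar> \<le> \<rho>})"
      by (auto simp: B_rho_def G_rho_def)
    also have "closed \<dots>"
      by (intro closed_Int closed_INT ballI closed_Collect_eq closed_Collect_le continuous_intros continuous_on_coord c)
    finally show ?thesis .
  qed
  ultimately show ?thesis using K by (metis compact_Int_closed inf.absorb_iff2)
qed

lemma B_rho_convex:
  assumes "u \<in> B_rho m h B \<rho>" "v \<in> B_rho m h B \<rho>" "0 \<le> t" "t \<le> 1"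
  shows "(\<lambda>a. v a + t * (u a - v a)) \<in> B_rho m h B \<rho>"
proof -
  have e: "matvec h B (\<lambda>a. v a + t * (u a - v a)) i = matvec h B v i + t * (matvec h B u i - matvec h B v i)" for i
    by (simp add: matvec_add matvec_scale matvec_diff)
  have "(\<Sum>i<m. matvec h B v i + t * (matvec h B u i - matvec h B v i) - 1)
     = (1 - t) * (\<Sum>i<m. matvec h B v i - 1) + t * (\<Sum>i<m. matvec h B u i - 1)"
    by (simp add: sum_distrib_left sum.distrib[symmetric] algebra_simps)
  also have "\<dots> = 0" using assms by (simp add: B_rho_def G_rho_def)
  finally have 1: "(\<Sum>i<m. matvec h B v i + t * (matvec h B u i - matvec h B v i) - 1) = 0" .
  have 2: "\<bar>matvec h B v i + t * (matvec h B u i - matvec h B v i) - 1\<bar> \<le> \<rho>" if "i < m" for i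
  proof -
    have "\<bar>matvec h B v i + t * (matvec h B u i - matvec h B v i) - 1\<bar>
      = \<bar>(1 - t) * (matvec h B v i - 1) + t * (matvec h B u i - 1)\<bar>" by (simp add: algebra_simps)
    also have "\<dots> \<le> (1 - t) * \<bar>matvec h B v i - 1\<bar> + t * \<bar>matvec h B u i - 1\<bar>"
      using assms(3,4) by (intro order_trans[OF abs_triangle_ineq]) (simp add: abs_mult)
    also have "\<dots> \<le> (1 - t) * \<rho> + t * \<rho>"
      using assms that by (intro add_mono mult_left_mono) (auto simp: B_rho_def G_rho_def)
    finally show ?thesis by (simp add: algebra_simps)
  qed
  show ?thesis using assms 1 2 by (simp add: B_rho_def G_rho_def e)
qed

text \<open>Comparing the minimiser with the points of the segment towards \<open>u\<close> gives
  the variational inequality \<open>0 \<le> I\<close>; expanding the square around the minimiser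
  then yields the distance estimate, for whichever minimiser \<open>SOME\<close> selects.\<close>

lemma proj_B_rho:
  assumes orth: "\<And>a a'. a < h \<Longrightarrow> a' < h \<Longrightarrow> (\<Sum>i<m. B i a * B i a') = (if a = a' then 1 else 0)"
    and u: "u \<in> B_rho m h B \<rho>"
  shows "proj h (B_rho m h B \<rho>) w \<in> B_rho m h B \<rho>"
    "sqn h (\<lambda>a. proj h (B_rho m h B \<rho>) w a - u a) \<le> sqn h (\<lambda>a. w a - u a)"
proof -
  let ?S = "B_rho m h B \<rho>"
  define q where "q = proj h ?S w"
  have "\<exists>v\<in>?S. \<forall>u\<in>?S. (\<Sum>a<h. (v a - w a)\<^sup>2) \<le> (\<Sum>a<h. (u a - w a)\<^sup>2)"
    by (rule continuous_attains_inf[OF B_rho_compact[OF orth]])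
       (use u in \<open>auto intro!: continuous_intros continuous_on_coord\<close>)
  then have ex: "\<exists>v. v \<in> ?S \<and> (\<forall>u\<in>?S. (\<Sum>a<h. (v a - w a)\<^sup>2) \<le> (\<Sum>a<h. (u a - w a)\<^sup>2))"
    unfolding Bex_def .
  have "q \<in> ?S \<and> (\<forall>u\<in>?S. (\<Sum>a<h. (q a - w a)\<^sup>2) \<le> (\<Sum>a<h. (u a - w a)\<^sup>2))"
    unfolding q_def proj_def by (rule someI_ex[OF ex])
  then have q: "q \<in> ?S" and min: "\<And>u. u \<in> ?S \<Longrightarrow> sqn h (\<lambda>a. q a - w a) \<le> sqn h (\<lambda>a. u a - w a)"
    by (auto simp: sqn_def)
  show "proj h ?S w \<in> ?S" using q by (simp add: q_def)
  define D where "D = sqn h (\<lambda>a. u a - q a)"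
  define I where "I = (\<Sum>a<h. (q a - w a) * (u a - q a))"
  have nn: "0 \<le> 2 * I + t * D" if "0 < t" "t \<le> 1" for t
  proof -
    have "sqn h (\<lambda>a. q a - w a) \<le> sqn h (\<lambda>a. q a + t * (u a - q a) - w a)"
      by (rule min) (rule B_rho_convex[OF u q], use that in auto)
    also have "\<dots> = sqn h (\<lambda>a. q a - w a) + 2 * t * I + t\<^sup>2 * D"
      unfolding sqn_def I_def D_def sum_distrib_left sum.distrib[symmetric]
      by (intro sum.cong refl) (simp add: power2_eq_square algebra_simps)
    finally have "0 \<le> t * (2 * I + t * D)" by (simp add: power2_eq_square algebra_simps)
    then show ?thesis using that by (simp add: zero_le_mult_iff)
  qed
  have "0 \<le> I"
  proof (rule ccontr)
    assume "\<not> 0 \<le> I"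
    then have I: "I < 0" by simp
    have D: "0 \<le> D" by (simp add: D_def sqn_nonneg)
    \<comment> \<open>Small enough for t D \<le> - I, so that 2 I + t D \<le> I < 0;
      \<open>D + 1\<close> keeps the denominator positive.\<close>
    define t where "t = min 1 (- I / (D + 1))"
    have "0 < - I / (D + 1)" using I D by (intro divide_pos_pos) auto
    then have t: "0 < t" "t \<le> 1" by (auto simp: t_def)
    have "t * D \<le> (- I / (D + 1)) * D" using D by (intro mult_right_mono) (auto simp: t_def)
    also have "\<dots> \<le> - I"
    proof -
      have "D / (D + 1) \<le> 1" using D by simp
      then have "- I * (D / (D + 1)) \<le> - I * 1" using I by (intro mult_left_mono) auto
      then show ?thesis by simp
    qed
    finally show False using nn[OF t] I by linarith
  qed
  moreover have "sqn h (\<lambda>a. w a - u a) = sqn h (\<lambda>a. q a - w a) + 2 * I + D"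
    unfolding sqn_def I_def D_def sum_distrib_left sum.distrib[symmetric]
    by (intro sum.cong refl) (simp add: power2_eq_square algebra_simps)
  moreover have "D = sqn h (\<lambda>a. q a - u a)" by (simp add: D_def sqn_def power2_commute)
  ultimately show "sqn h (\<lambda>a. proj h ?S w a - u a) \<le> sqn h (\<lambda>a. w a - u a)"
    using sqn_nonneg[of h "\<lambda>a. q a - w a"] by (simp add: q_def)
qed

text \<open>An index \<open>j = (l, i)\<close> stands for the measurement in row \<open>i\<close> of \<open>A\<^sub>l\<close>, and \<open>\<phi> j\<close> for that row of
  \<open>A\<^sub>l Z\<close>.\<close>

locale blind_calibration =
  fixes m p k h :: nat and \<phi> :: "nat \<times> nat \<Rightarrow> nat \<Rightarrow> real" and B :: "nat \<Rightarrow> nat \<Rightarrow> real"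
    and z b :: "nat \<Rightarrow> real" and \<nu> :: "nat \<times> nat \<Rightarrow> real" and \<rho> \<mu> :: real
  assumes m1: "m \<ge> 1" and p1: "p \<ge> 1" and h1: "h \<ge> 1"
    and orth: "\<And>a a'. a < h \<Longrightarrow> a' < h \<Longrightarrow> (\<Sum>i<m. B i a * B i a') = (if a = a' then 1 else 0)"
    and B0: "\<And>i. i < m \<Longrightarrow> B i 0 = 1 / sqrt (real m)"
    and Bperp: "\<And>a. 0 < a \<Longrightarrow> a < h \<Longrightarrow> (\<Sum>i<m. B i a) = 0"
    and b0: "b 0 = sqrt (real m)" and g: "matvec h B b \<in> G_rho m \<rho>" and rho: "\<rho> \<le> 1 / 31"
    and z: "sqn k z > 0"
    and upper: "\<And>u. (\<Sum>j\<in>{..<p}\<times>{..<m}. (\<Sum>c<k. u c * \<phi> j c)\<^sup>2) \<le> 2 * real (m * p) * sqn k u"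
    and lower: "\<And>u v. v 0 = 0 \<Longrightarrow> 9/10 * real (m * p) * (sqn k u + sqn k z / real m * sqn h v)
      \<le> (\<Sum>j\<in>{..<p}\<times>{..<m}. ((\<Sum>c<k. u c * \<phi> j c) + matvec h B v (snd j) * (\<Sum>c<k. z c * \<phi> j c))\<^sup>2)"
    and mu: "0 < \<mu>"
    and mu_small: "\<mu> * (real m * (99 + 80 * ((\<Sum>j\<in>{..<p}\<times>{..<m}. (\<nu> j)\<^sup>2) / real (m * p)) / sqn k z)) \<le> 1 / 20"
begin

definition "JJ = {..<p} \<times> {..<m}"
definition "NN = real (m * p)"
definition "s2 = (\<Sum>j\<in>JJ. (\<nu> j)\<^sup>2) / NN"
definition Lf :: "nat \<times> nat \<Rightarrow> (nat \<Rightarrow> real) \<Rightarrow> real" where "Lf j u = (\<Sum>c<k. u c * \<phi> j c)"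
definition bb :: "(nat \<Rightarrow> real) \<Rightarrow> nat \<times> nat \<Rightarrow> real" where "bb v j = matvec h B v (snd j)"
definition yy :: "nat \<times> nat \<Rightarrow> real" where "yy j = bb b j * Lf j z + \<nu> j"
definition FF :: "(nat \<Rightarrow> real) \<Rightarrow> (nat \<Rightarrow> real) \<Rightarrow> real" where
  "FF \<zeta> \<beta> = 1 / (2 * NN) * (\<Sum>j\<in>JJ. (bb \<beta> j * Lf j \<zeta> - yy j)\<^sup>2)"
definition rr :: "(nat \<Rightarrow> real) \<Rightarrow> (nat \<Rightarrow> real) \<Rightarrow> nat \<times> nat \<Rightarrow> real" where
  "rr \<zeta> \<beta> j = bb \<beta> j * Lf j \<zeta> - yy j"
abbreviation "SS \<equiv> B_rho m h B \<rho>"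
abbreviation "DD \<zeta> \<beta> \<equiv> Delta m k h z b \<zeta> \<beta>"

lemma NN: "NN > 0" using m1 p1 by (simp add: NN_def)

lemma s2: "0 \<le> s2" using NN by (simp add: s2_def sum_nonneg)

lemma noise_sum: "(\<Sum>j\<in>JJ. (\<nu> j)\<^sup>2) = NN * s2" using NN by (simp add: s2_def)

lemma rho0: "0 \<le> \<rho>" using g m1 unfolding G_rho_def by (auto intro: order_trans[OF abs_ge_zero])

lemma DD_eq: "DD \<zeta> \<beta> = sqn k (\<lambda>a. \<zeta> a - z a) + sqn k z / real m * sqn h (\<lambda>a. \<beta> a - b a)"
  by (simp add: Delta_def sqn_def)

lemma Lf_diff: "Lf j (\<lambda>a. u a - v a) = Lf j u - Lf j v" by (simp add: Lf_def algebra_simps sum_subtractf)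
lemma bb_diff: "bb (\<lambda>a. u a - v a) j = bb u j - bb v j" by (simp add: bb_def matvec_diff)

lemma upper': "(\<Sum>j\<in>JJ. (Lf j u)\<^sup>2) \<le> 2 * NN * sqn k u"
  using upper[of u] by (simp add: JJ_def NN_def Lf_def)

lemma isometry: "sqn m (matvec h B v) = sqn h v"
  by (rule sqn_matvec_orthonormal(1)) (rule orth)

lemma bb_sq_le: "j \<in> JJ \<Longrightarrow> (bb v j)\<^sup>2 \<le> sqn h v"
proof -
  assume "j \<in> JJ"
  then have "(bb v j)\<^sup>2 \<le> sqn m (matvec h B v)"
    unfolding bb_def sqn_def by (intro member_le_sum[where f = "\<lambda>i. (matvec h B v i)\<^sup>2"]) (auto simp: JJ_def)
  then show ?thesis by (simp only: isometry)
qed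

text \<open>Summing the entries of \<open>B \<beta>\<close> kills all columns but the first, while
  feasibility fixes the sum as m. Hence feasible points differ only in the other coordinates, as the
  bound \<open>lower\<close> requires.\<close>

lemma SS_first: assumes "\<beta> \<in> SS" shows "\<beta> 0 = sqrt (real m)"
proof -
  have "(\<Sum>i<m. matvec h B \<beta> i) = (\<Sum>i<m. \<Sum>a<h. B i a * \<beta> a)" by (simp add: matvec_def)
  also have "\<dots> = (\<Sum>a<h. (\<Sum>i<m. B i a) * \<beta> a)" by (subst sum.swap) (simp add: sum_distrib_right)
  also have "\<dots> = (\<Sum>a<h. if a = 0 then sqrt (real m) * \<beta> a else 0)"
  proof (intro sum.cong refl)
    fix a assume a: "a \<in> {..<h}"
    show "(\<Sum>i<m. B i a) * \<beta> a = (if a = 0 then sqrt (real m) * \<beta> a else 0)"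
    proof (cases "a = 0")
      case True
      have "(\<Sum>i<m. B i 0) = real m / sqrt (real m)" by (simp add: B0)
      then show ?thesis using True by (simp add: real_div_sqrt)
    qed (use Bperp a in auto)
  qed
  also have "\<dots> = sqrt (real m) * \<beta> 0" using h1 by simp
  finally have "sqrt (real m) * \<beta> 0 = real m"
    using assms by (simp add: B_rho_def G_rho_def sum_subtractf)
  then have "sqrt (real m) * \<beta> 0 = sqrt (real m) * sqrt (real m)" by simp
  moreover have "sqrt (real m) \<noteq> 0" using m1 by simp
  ultimately show ?thesis by (metis mult_cancel_left)
qed

lemma bb_close: assumes "\<beta> \<in> SS" "j \<in> JJ" shows "\<bar>bb \<beta> j - 1\<bar> \<le> \<rho>"
  using assms by (auto simp: B_rho_def G_rho_def bb_def JJ_def)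

lemma bb_b_close: assumes "j \<in> JJ" shows "\<bar>bb b j - 1\<bar> \<le> \<rho>"
  using assms g by (auto simp: G_rho_def bb_def JJ_def)

section \<open>The partial gradients in weak form\<close>

lemma pdiff_quadratic:
  assumes "\<And>s. g (v(a := v a + s)) = 1 / (2 * NN) * (\<Sum>j\<in>J. (A j + s * C j)\<^sup>2)"
  shows "pdiff g v a = 1 / NN * (\<Sum>j\<in>J. A j * C j)"
proof -
  have "((\<lambda>s. 1 / (2 * NN) * (\<Sum>j\<in>J. (A j + s * C j)\<^sup>2)) has_field_derivative
      1 / (2 * NN) * (\<Sum>j\<in>J. 2 * (A j * C j))) (at 0)"
    using NN by (auto intro!: derivative_eq_intros sum.cong simp: mult_ac)
  then have "deriv (\<lambda>s. 1 / (2 * NN) * (\<Sum>j\<in>J. (A j + s * C j)\<^sup>2)) 0 = 1 / (2 * NN) * (\<Sum>j\<in>J. 2 * (A j * C j))"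
    by (rule DERIV_imp_deriv)
  also have "\<dots> = 1 / NN * (\<Sum>j\<in>J. A j * C j)" by (simp add: sum_distrib_left[symmetric])
  finally show ?thesis unfolding pdiff_def assms .
qed

definition gz :: "(nat \<Rightarrow> real) \<Rightarrow> (nat \<Rightarrow> real) \<Rightarrow> nat \<Rightarrow> real" where
  "gz \<zeta> \<beta> = grad k (\<lambda>\<zeta>'. FF \<zeta>' \<beta>) \<zeta>"
definition gb :: "(nat \<Rightarrow> real) \<Rightarrow> (nat \<Rightarrow> real) \<Rightarrow> nat \<Rightarrow> real" where
  "gb \<zeta> \<beta> = perp0 (grad h (\<lambda>\<beta>'. FF \<zeta> \<beta>') \<beta>)"

text \<open>Gradients are used only through their inner products with a direction, which express
  them by the residuals \<open>rr\<close>.\<close>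

lemma gz_inner: "NN * (\<Sum>a<k. gz \<zeta> \<beta> a * u a) = (\<Sum>j\<in>JJ. rr \<zeta> \<beta> j * (bb \<beta> j * Lf j u))"
proof -
  have "gz \<zeta> \<beta> a = 1 / NN * (\<Sum>j\<in>JJ. rr \<zeta> \<beta> j * (bb \<beta> j * \<phi> j a))" if a: "a < k" for a
  proof -
    have e: "FF (\<zeta>(a := \<zeta> a + s)) \<beta> = 1 / (2 * NN) * (\<Sum>j\<in>JJ. (rr \<zeta> \<beta> j + s * (bb \<beta> j * \<phi> j a))\<^sup>2)" for s
    proof -
      have "Lf j (\<zeta>(a := \<zeta> a + s)) = Lf j \<zeta> + s * \<phi> j a" for j
        using matvec_upd[OF a, of "\<lambda>_. \<phi> j" \<zeta> s 0] unfolding Lf_def matvec_def by (simp only: mult.commute)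
      then show ?thesis by (simp add: FF_def rr_def algebra_simps)
    qed
    show ?thesis using a unfolding gz_def grad_def
      by (simp add: pdiff_quadratic[where g = "\<lambda>\<zeta>'. FF \<zeta>' \<beta>" and v = \<zeta> and a = a, OF e])
  qed
  then have "NN * (\<Sum>a<k. gz \<zeta> \<beta> a * u a) = (\<Sum>a<k. \<Sum>j\<in>JJ. rr \<zeta> \<beta> j * (bb \<beta> j * \<phi> j a) * u a)"
    using NN by (simp add: sum_distrib_left sum_distrib_right)
  also have "\<dots> = (\<Sum>j\<in>JJ. \<Sum>a<k. rr \<zeta> \<beta> j * (bb \<beta> j * \<phi> j a) * u a)" by (rule sum.swap)
  finally show ?thesis by (simp add: Lf_def sum_distrib_left mult_ac)
qed

text \<open>\<open>perp0\<close> erases coordinate 0 of the gradient, so the pairing agrees with the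
  one of the full gradient for directions with \<open>v 0 = 0\<close>.\<close>

lemma gb_inner:
  assumes "v 0 = 0"
  shows "NN * (\<Sum>a<h. gb \<zeta> \<beta> a * v a) = (\<Sum>j\<in>JJ. rr \<zeta> \<beta> j * (bb v j * Lf j \<zeta>))"
proof -
  have g: "grad h (\<lambda>\<beta>'. FF \<zeta> \<beta>') \<beta> a = 1 / NN * (\<Sum>j\<in>JJ. rr \<zeta> \<beta> j * (B (snd j) a * Lf j \<zeta>))" if a: "a < h" for a
  proof -
    have e: "FF \<zeta> (\<beta>(a := \<beta> a + s)) = 1 / (2 * NN) * (\<Sum>j\<in>JJ. (rr \<zeta> \<beta> j + s * (B (snd j) a * Lf j \<zeta>))\<^sup>2)" for s
      unfolding FF_def rr_def bb_def matvec_upd[OF a] by (simp add: algebra_simps)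
    show ?thesis using a unfolding grad_def
      by (simp add: pdiff_quadratic[where g = "\<lambda>\<beta>'. FF \<zeta> \<beta>'" and v = \<beta> and a = a, OF e])
  qed
  have "(\<Sum>a<h. gb \<zeta> \<beta> a * v a) = (\<Sum>a<h. grad h (\<lambda>\<beta>'. FF \<zeta> \<beta>') \<beta> a * v a)"
    using assms by (intro sum.cong refl) (auto simp: gb_def perp0_def)
  then have "NN * (\<Sum>a<h. gb \<zeta> \<beta> a * v a) = (\<Sum>a<h. \<Sum>j\<in>JJ. rr \<zeta> \<beta> j * (B (snd j) a * Lf j \<zeta>) * v a)"
    using NN g by (simp add: sum_distrib_left sum_distrib_right)
  also have "\<dots> = (\<Sum>j\<in>JJ. \<Sum>a<h. rr \<zeta> \<beta> j * (B (snd j) a * Lf j \<zeta>) * v a)" by (rule sum.swap)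
  finally show ?thesis by (simp add: bb_def matvec_def sum_distrib_left sum_distrib_right mult_ac)
qed

text \<open>Closes the duality arguments below: a vector is paired with itself, Cauchy-Schwarz
  brings in its length once more, and one factor cancels.\<close>

lemma le_of_sq_le:
  fixes x C r :: real
  assumes x: "0 \<le> x" and C: "0 \<le> C" and r: "0 \<le> r" and le: "(NN * x)\<^sup>2 \<le> r * (C * NN * x)"
  shows "NN * x \<le> C * r"
proof (cases "x = 0")
  case False
  then have "0 < NN * x" using x NN by simp
  moreover have "(NN * x) * (NN * x) \<le> (C * r) * (NN * x)" using le by (simp add: power2_eq_square mult_ac)
  ultimately show ?thesis by (rule mult_right_le_imp_le[rotated])
qed (use C r in simp)

lemma gz_bound:
  assumes "\<beta> \<in> SS"
  shows "NN * sqn k (gz \<zeta> \<beta>) \<le> 3 * (\<Sum>j\<in>JJ. (rr \<zeta> \<beta> j)\<^sup>2)"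
proof (rule le_of_sq_le)
  let ?g = "gz \<zeta> \<beta>"
  have "(NN * sqn k ?g)\<^sup>2 = (\<Sum>j\<in>JJ. rr \<zeta> \<beta> j * (bb \<beta> j * Lf j ?g))\<^sup>2"
    unfolding gz_inner[symmetric] by (simp add: sqn_def power2_eq_square)
  also have "\<dots> \<le> (\<Sum>j\<in>JJ. (rr \<zeta> \<beta> j)\<^sup>2) * (\<Sum>j\<in>JJ. (bb \<beta> j * Lf j ?g)\<^sup>2)"
    by (rule Cauchy_Schwarz_ineq_sum)
  also have "\<dots> \<le> (\<Sum>j\<in>JJ. (rr \<zeta> \<beta> j)\<^sup>2) * (3 * NN * sqn k ?g)"
  proof (rule mult_left_mono)
    have "(\<Sum>j\<in>JJ. (bb \<beta> j * Lf j ?g)\<^sup>2) \<le> (\<Sum>j\<in>JJ. 3/2 * (Lf j ?g)\<^sup>2)"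
    proof (rule sum_mono)
      fix j assume "j \<in> JJ"
      then have "\<bar>bb \<beta> j\<bar> \<le> \<bar>32/31\<bar>" using bb_close[OF assms] rho by fastforce
      then have "(bb \<beta> j)\<^sup>2 \<le> (32/31)\<^sup>2" by (simp only: abs_le_square_iff)
      also have "\<dots> \<le> 3/2" by (simp add: power2_eq_square)
      finally show "(bb \<beta> j * Lf j ?g)\<^sup>2 \<le> 3/2 * (Lf j ?g)\<^sup>2"
        unfolding power_mult_distrib by (rule mult_right_mono) simp
    qed
    also have "\<dots> = 3/2 * (\<Sum>j\<in>JJ. (Lf j ?g)\<^sup>2)" by (rule sum_distrib_left[symmetric])
    also have "\<dots> \<le> 3 * NN * sqn k ?g" using upper'[of ?g] by linarith
    finally show "(\<Sum>j\<in>JJ. (bb \<beta> j * Lf j ?g)\<^sup>2) \<le> 3 * NN * sqn k ?g" .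
  qed (simp add: sum_nonneg)
  finally show "(NN * sqn k ?g)\<^sup>2 \<le> (\<Sum>j\<in>JJ. (rr \<zeta> \<beta> j)\<^sup>2) * (3 * NN * sqn k ?g)" .
qed (simp_all add: sqn_nonneg sum_nonneg)

text \<open>Each entry of \<open>B\<close> applied to the gradient is at most its length, by the
  isometry. This loses a factor of m against the average entry and is what forces a step size of
  order 1/m.\<close>

lemma gb_bound: "NN * sqn h (gb \<zeta> \<beta>) \<le> (2 * sqn k \<zeta>) * (\<Sum>j\<in>JJ. (rr \<zeta> \<beta> j)\<^sup>2)"
proof (rule le_of_sq_le)
  let ?g = "gb \<zeta> \<beta>"
  have g0: "?g 0 = 0" by (simp add: gb_def perp0_def)
  have "(NN * sqn h ?g)\<^sup>2 = (\<Sum>j\<in>JJ. rr \<zeta> \<beta> j * (bb ?g j * Lf j \<zeta>))\<^sup>2"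
    unfolding gb_inner[where v = ?g, OF g0, symmetric] by (simp add: sqn_def power2_eq_square)
  also have "\<dots> \<le> (\<Sum>j\<in>JJ. (rr \<zeta> \<beta> j)\<^sup>2) * (\<Sum>j\<in>JJ. (bb ?g j * Lf j \<zeta>)\<^sup>2)"
    by (rule Cauchy_Schwarz_ineq_sum)
  also have "\<dots> \<le> (\<Sum>j\<in>JJ. (rr \<zeta> \<beta> j)\<^sup>2) * (2 * sqn k \<zeta> * NN * sqn h ?g)"
  proof (rule mult_left_mono)
    have "(\<Sum>j\<in>JJ. (bb ?g j * Lf j \<zeta>)\<^sup>2) \<le> (\<Sum>j\<in>JJ. sqn h ?g * (Lf j \<zeta>)\<^sup>2)"
      unfolding power_mult_distrib by (intro sum_mono mult_right_mono bb_sq_le) auto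
    also have "\<dots> = sqn h ?g * (\<Sum>j\<in>JJ. (Lf j \<zeta>)\<^sup>2)" by (simp add: sum_distrib_left)
    also have "\<dots> \<le> sqn h ?g * (2 * NN * sqn k \<zeta>)" by (intro mult_left_mono upper' sqn_nonneg)
    finally show "(\<Sum>j\<in>JJ. (bb ?g j * Lf j \<zeta>)\<^sup>2) \<le> 2 * sqn k \<zeta> * NN * sqn h ?g" by (simp add: mult_ac)
  qed (simp add: sum_nonneg)
  finally show "(NN * sqn h ?g)\<^sup>2 \<le> (\<Sum>j\<in>JJ. (rr \<zeta> \<beta> j)\<^sup>2) * (2 * sqn k \<zeta> * NN * sqn h ?g)" .
qed (simp_all add: sqn_nonneg sum_nonneg)

text \<open>The residual without noise,
  \<open>bb \<beta> j * Lf j \<zeta> - bb b j * Lf j z\<close>.\<close>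

definition hh :: "(nat \<Rightarrow> real) \<Rightarrow> (nat \<Rightarrow> real) \<Rightarrow> nat \<times> nat \<Rightarrow> real" where
  "hh \<zeta> \<beta> j = rr \<zeta> \<beta> j + \<nu> j"

text \<open>The noiseless residual is H = F + e A, with F bounded below by \<open>lower\<close> and
  |e| \<le> 1/31, so it inherits a lower bound: (9/10 - 42/31^2) * 20/21 exceeds 81/100.
  Differentiating the model in the direction (u, v) gives H + R with the second order term R =
  \<open>bb v\<close> A, so the gradient pairing is the sum of (H + R) (H - \<nu>). Both
  \<open>\<beta>\<close> and \<open>b\<close> are feasible, so |\<open>bb v\<close>| \<le> 2/31, and
  R costs at most 1/20 of the error.\<close>

lemma regularity:
  fixes \<zeta> \<beta> :: "nat \<Rightarrow> real"
  assumes \<beta>: "\<beta> \<in> SS"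
  defines "u \<equiv> \<lambda>a. \<zeta> a - z a" and "v \<equiv> \<lambda>a. \<beta> a - b a"
  shows "81/100 * NN * DD \<zeta> \<beta> \<le> (\<Sum>j\<in>JJ. (hh \<zeta> \<beta> j)\<^sup>2)"
    "9/10 * (\<Sum>j\<in>JJ. (hh \<zeta> \<beta> j)\<^sup>2) - 1/20 * NN * DD \<zeta> \<beta> - 11/2 * NN * s2
       \<le> NN * ((\<Sum>a<k. gz \<zeta> \<beta> a * u a) + (\<Sum>a<h. gb \<zeta> \<beta> a * v a))"
proof -
  define \<Delta> where "\<Delta> = DD \<zeta> \<beta>"
  define A where "A j = Lf j u" for j
  define F where "F j = A j + bb v j * Lf j z" for j
  define e where "e j = bb \<beta> j - 1" for j
  define H where "H j = hh \<zeta> \<beta> j" for j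
  define R where "R j = bb v j * A j" for j
  have v0: "v 0 = 0" using SS_first[OF \<beta>] b0 by (simp add: v_def)
  have nD: "sqn k z / real m * sqn h v \<ge> 0" using z by (simp add: sqn_nonneg)
  have Du: "\<Delta> = sqn k u + sqn k z / real m * sqn h v" by (simp add: \<Delta>_def DD_eq u_def v_def)
  have Hj: "H j = F j + e j * A j" for j
    by (simp add: H_def hh_def rr_def yy_def F_def A_def e_def u_def v_def Lf_diff bb_diff algebra_simps)
  have nA: "(\<Sum>j\<in>JJ. (A j)\<^sup>2) \<le> 2 * NN * \<Delta>"
  proof -
    have "(\<Sum>j\<in>JJ. (A j)\<^sup>2) \<le> 2 * NN * sqn k u" unfolding A_def by (rule upper')
    also have "\<dots> \<le> 2 * NN * \<Delta>" using NN nD by (intro mult_left_mono) (auto simp: Du)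
    finally show ?thesis .
  qed
  have nF: "9/10 * NN * \<Delta> \<le> (\<Sum>j\<in>JJ. (F j)\<^sup>2)"
    using lower[where v = v, OF v0, of u] by (simp add: NN_def Du JJ_def F_def A_def Lf_def bb_def)
  have sm: "(\<Sum>j\<in>JJ. (c j * A j)\<^sup>2) \<le> t * (2 * NN * \<Delta>)" if "\<And>j. j \<in> JJ \<Longrightarrow> (c j)\<^sup>2 \<le> t" "0 \<le> t" for c t
  proof -
    have "(\<Sum>j\<in>JJ. (c j * A j)\<^sup>2) \<le> (\<Sum>j\<in>JJ. t * (A j)\<^sup>2)"
      unfolding power_mult_distrib using that by (intro sum_mono mult_right_mono) auto
    also have "\<dots> \<le> t * (2 * NN * \<Delta>)"
      unfolding sum_distrib_left[symmetric] using that nA by (intro mult_left_mono) auto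
    finally show ?thesis .
  qed
  have ne: "(\<Sum>j\<in>JJ. (e j * A j)\<^sup>2) \<le> (1/31)\<^sup>2 * (2 * NN * \<Delta>)"
  proof (rule sm)
    fix j assume "j \<in> JJ"
    then have "\<bar>e j\<bar> \<le> \<bar>1/31\<bar>" using bb_close[OF \<beta>, of j] rho by (simp add: e_def)
    then show "(e j)\<^sup>2 \<le> (1/31)\<^sup>2" by (simp only: abs_le_square_iff)
  qed simp
  have nR: "(\<Sum>j\<in>JJ. (R j)\<^sup>2) \<le> (2/31)\<^sup>2 * (2 * NN * \<Delta>)"
    unfolding R_def
  proof (rule sm)
    fix j assume "j \<in> JJ"
    then have "\<bar>bb v j\<bar> \<le> \<bar>2/31\<bar>" using bb_close[OF \<beta>, of j] bb_b_close[of j] rho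
      unfolding v_def bb_diff by linarith
    then show "(bb v j)\<^sup>2 \<le> (2/31)\<^sup>2" by (simp only: abs_le_square_iff)
  qed simp
  have D0: "0 \<le> NN * \<Delta>" using NN nD by (simp add: Du sqn_nonneg)
  have "(\<Sum>j\<in>JJ. (F j)\<^sup>2) \<le> (\<Sum>j\<in>JJ. 21/20 * (H j)\<^sup>2 + 21 * (e j * A j)\<^sup>2)"
  proof (rule sum_mono)
    fix j
    have "(x - y)\<^sup>2 \<le> 21/20 * x\<^sup>2 + 21 * y\<^sup>2" for x y :: real
    proof -
      have "0 \<le> (x + 20 * y)\<^sup>2 / 20" by simp
      then show ?thesis by (simp add: power2_eq_square algebra_simps)
    qed
    from this[of "H j" "e j * A j"] show "(F j)\<^sup>2 \<le> 21/20 * (H j)\<^sup>2 + 21 * (e j * A j)\<^sup>2" by (simp add: Hj)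
  qed
  also have "\<dots> = 21/20 * (\<Sum>j\<in>JJ. (H j)\<^sup>2) + 21 * (\<Sum>j\<in>JJ. (e j * A j)\<^sup>2)"
    by (simp add: sum.distrib sum_distrib_left)
  finally have "9/10 * NN * \<Delta> \<le> 21/20 * (\<Sum>j\<in>JJ. (H j)\<^sup>2) + 21 * ((1/31)\<^sup>2 * (2 * NN * \<Delta>))"
    using nF ne by linarith
  then show "81/100 * NN * DD \<zeta> \<beta> \<le> (\<Sum>j\<in>JJ. (hh \<zeta> \<beta> j)\<^sup>2)"
    using D0 unfolding \<Delta>_def[symmetric] H_def[symmetric] by (simp add: power2_eq_square)
  note sv = noise_sum
  have "NN * ((\<Sum>a<k. gz \<zeta> \<beta> a * u a) + (\<Sum>a<h. gb \<zeta> \<beta> a * v a)) = (\<Sum>j\<in>JJ. (H j + R j) * (H j - \<nu> j))"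
  proof -
    have "rr \<zeta> \<beta> j * (bb \<beta> j * Lf j u) + rr \<zeta> \<beta> j * (bb v j * Lf j \<zeta>) = (H j + R j) * (H j - \<nu> j)" for j
    proof -
      have "bb \<beta> j * Lf j u + bb v j * Lf j \<zeta> = H j + R j"
        by (simp add: H_def hh_def rr_def yy_def R_def A_def u_def v_def Lf_diff bb_diff algebra_simps)
      then have "rr \<zeta> \<beta> j * (bb \<beta> j * Lf j u + bb v j * Lf j \<zeta>) = (H j + R j) * (H j - \<nu> j)"
        by (simp add: H_def hh_def)
      then show ?thesis by (simp only: distrib_left)
    qed
    then show ?thesis
      unfolding distrib_left gz_inner gb_inner[where v = v, OF v0] by (simp add: sum.distrib[symmetric])
  qed
  moreover have "(\<Sum>j\<in>JJ. 9/10 * (H j)\<^sup>2 - 11/2 * (R j)\<^sup>2 - 11/2 * (\<nu> j)\<^sup>2) \<le> (\<Sum>j\<in>JJ. (H j + R j) * (H j - \<nu> j))"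
  proof (rule sum_mono)
    fix j
    \<comment> \<open>The two products with x take x^2/20 each and leave 5 y^2 and 5 n^2; the
      product y n adds one half to both coefficients.\<close>
    have "9/10 * x\<^sup>2 - 11/2 * y\<^sup>2 - 11/2 * n\<^sup>2 \<le> (x + y) * (x - n)" for x y n :: real
    proof -
      have "0 \<le> (x + 10 * y)\<^sup>2 / 20 + (x - 10 * n)\<^sup>2 / 20 + (y - n)\<^sup>2 / 2" by simp
      also have "\<dots> = (x + y) * (x - n) - (9/10 * x\<^sup>2 - 11/2 * y\<^sup>2 - 11/2 * n\<^sup>2)"
        by (simp add: power2_eq_square field_simps)
      finally show ?thesis by simp
    qed
    then show "9/10 * (H j)\<^sup>2 - 11/2 * (R j)\<^sup>2 - 11/2 * (\<nu> j)\<^sup>2 \<le> (H j + R j) * (H j - \<nu> j)" .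
  qed
  moreover have "(\<Sum>j\<in>JJ. 9/10 * (H j)\<^sup>2 - 11/2 * (R j)\<^sup>2 - 11/2 * (\<nu> j)\<^sup>2)
     = 9/10 * (\<Sum>j\<in>JJ. (H j)\<^sup>2) - 11/2 * (\<Sum>j\<in>JJ. (R j)\<^sup>2) - 11/2 * (NN * s2)"
    unfolding sv[symmetric] by (simp add: sum_subtractf sum_distrib_left)
  moreover have "11/2 * ((2/31)\<^sup>2 * (2 * NN * \<Delta>)) \<le> 1/20 * NN * \<Delta>"
    using D0 by (simp add: power2_eq_square mult.commute)
  ultimately show "9/10 * (\<Sum>j\<in>JJ. (hh \<zeta> \<beta> j)\<^sup>2) - 1/20 * NN * DD \<zeta> \<beta> - 11/2 * NN * s2
       \<le> NN * ((\<Sum>a<k. gz \<zeta> \<beta> a * u a) + (\<Sum>a<h. gb \<zeta> \<beta> a * v a))"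
    using nR unfolding \<Delta>_def[symmetric] H_def[symmetric] by linarith
qed

text \<open>The set \<open>B_rho\<close> forces the coordinates from \<open>h\<close> on to vanish, which is not assumed of \<open>b\<close>.\<close>

definition b' :: "nat \<Rightarrow> real" where "b' a = (if a < h then b a else 0)"

lemma b'_SS: "b' \<in> SS"
proof -
  have "matvec h B b' = matvec h B b" by (simp add: matvec_def b'_def fun_eq_iff)
  then show ?thesis using g by (simp add: B_rho_def b'_def)
qed

lemma sqn_b': "sqn h (\<lambda>a. \<beta> a - b' a) = sqn h (\<lambda>a. \<beta> a - b a)"
  by (simp add: sqn_def b'_def)

section \<open>One step of the iteration\<close>

definition zn :: "(nat \<Rightarrow> real) \<Rightarrow> (nat \<Rightarrow> real) \<Rightarrow> nat \<Rightarrow> real" where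
  "zn \<zeta> \<beta> = (\<lambda>a. \<zeta> a - \<mu> * gz \<zeta> \<beta> a)"
definition bn :: "(nat \<Rightarrow> real) \<Rightarrow> (nat \<Rightarrow> real) \<Rightarrow> nat \<Rightarrow> real" where
  "bn \<zeta> \<beta> = proj h SS (\<lambda>a. \<beta> a - \<mu> * (real m / sqn k z) * gb \<zeta> \<beta> a)"

lemma sq_step: "sqn d (\<lambda>a. x a - t * y a - w a) = sqn d (\<lambda>a. x a - w a) - 2 * t * (\<Sum>a<d. y a * (x a - w a)) + t\<^sup>2 * sqn d y"
  unfolding sqn_def sum_distrib_left sum.distrib[symmetric] sum_subtractf[symmetric]
  by (intro sum.cong refl) (simp add: power2_eq_square algebra_simps)

text \<open>The error changes by -2 \<mu> P + \<mu>^2 G. The bounds for P and G leave -1.7 h2 + 0.1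
  \<Delta> + 11.1 s2 after division by \<mu>, and h2 \<ge> 0.81 \<Delta> makes the coefficient of
  \<Delta> less than -1. The assumption on \<open>DD \<zeta> \<beta>\<close> bounds
  \<open>\<zeta>\<close>, and with it the gradient in \<open>\<beta>\<close>.\<close>

lemma step:
  assumes \<beta>: "\<beta> \<in> SS" and D: "DD \<zeta> \<beta> \<le> 23 * sqn k z + 20 * s2"
  shows "bn \<zeta> \<beta> \<in> SS" "DD (zn \<zeta> \<beta>) (bn \<zeta> \<beta>) \<le> (1 - \<mu>) * DD \<zeta> \<beta> + 12 * \<mu> * s2"
proof -
  show "bn \<zeta> \<beta> \<in> SS" unfolding bn_def by (rule proj_B_rho(1)[OF orth b'_SS])
  define Z where "Z = sqn k z"
  have Z: "Z > 0" using z by (simp add: Z_def)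
  have m0: "real m > 0" using m1 by simp
  define P where "P = (\<Sum>a<k. gz \<zeta> \<beta> a * (\<zeta> a - z a)) + (\<Sum>a<h. gb \<zeta> \<beta> a * (\<beta> a - b a))"
  define G where "G = sqn k (gz \<zeta> \<beta>) + real m / Z * sqn h (gb \<zeta> \<beta>)"
  define \<Delta> where "\<Delta> = DD \<zeta> \<beta>"
  define h2 where "h2 = (\<Sum>j\<in>JJ. (hh \<zeta> \<beta> j)\<^sup>2) / NN"
  have h2: "0 \<le> h2" using NN by (simp add: h2_def sum_nonneg)
  have D0: "0 \<le> \<Delta>" unfolding \<Delta>_def DD_eq using z by (intro add_nonneg_nonneg mult_nonneg_nonneg sqn_nonneg) auto
  have "sqn h (\<lambda>a. bn \<zeta> \<beta> a - b a) \<le> sqn h (\<lambda>a. \<beta> a - \<mu> * (real m / Z) * gb \<zeta> \<beta> a - b a)"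
    using proj_B_rho(2)[OF orth b'_SS, of "\<lambda>a. \<beta> a - \<mu> * (real m / Z) * gb \<zeta> \<beta> a"]
    unfolding sqn_b' by (simp add: bn_def Z_def)
  then have "Z / real m * sqn h (\<lambda>a. bn \<zeta> \<beta> a - b a)
      \<le> Z / real m * (sqn h (\<lambda>a. \<beta> a - b a) - 2 * (\<mu> * (real m / Z)) * (\<Sum>a<h. gb \<zeta> \<beta> a * (\<beta> a - b a)) + (\<mu> * (real m / Z))\<^sup>2 * sqn h (gb \<zeta> \<beta>))"
    unfolding sq_step using Z by (intro mult_left_mono) auto
  \<comment> \<open>The preconditioner m / Z of the step cancels the weight Z / m of
    \<open>Delta\<close>, so both blocks enter P with the same coefficient.\<close>
  also have "\<dots> = Z / real m * sqn h (\<lambda>a. \<beta> a - b a) - 2 * \<mu> * (\<Sum>a<h. gb \<zeta> \<beta> a * (\<beta> a - b a)) + \<mu>\<^sup>2 * (real m / Z * sqn h (gb \<zeta> \<beta>))"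
    using Z m0 by (simp add: power2_eq_square field_simps)
  finally have "DD (zn \<zeta> \<beta>) (bn \<zeta> \<beta>) \<le> \<Delta> - 2 * \<mu> * P + \<mu>\<^sup>2 * G"
    unfolding \<Delta>_def DD_eq zn_def sq_step P_def G_def Z_def by (simp add: algebra_simps)
  moreover have "\<mu> * G \<le> 1/10 * h2 + 1/10 * s2"
  proof -
    define r2 where "r2 = (\<Sum>j\<in>JJ. (rr \<zeta> \<beta> j)\<^sup>2) / NN"
    have r2: "0 \<le> r2" using NN by (simp add: r2_def sum_nonneg)
    have g1: "sqn k (gz \<zeta> \<beta>) \<le> 3 * r2" using gz_bound[OF \<beta>, of \<zeta>] NN by (simp add: r2_def field_simps)
    have g2: "sqn h (gb \<zeta> \<beta>) \<le> 2 * sqn k \<zeta> * r2" using gb_bound[of \<zeta> \<beta>] NN by (simp add: r2_def field_simps)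
    have zeta: "sqn k \<zeta> \<le> 48 * Z + 40 * s2"
    proof -
      have "sqn k \<zeta> \<le> (\<Sum>a<k. 2 * (\<zeta> a - z a)\<^sup>2 + 2 * (z a)\<^sup>2)"
        unfolding sqn_def
      proof (rule sum_mono)
        fix a have "0 \<le> (\<zeta> a - z a - z a)\<^sup>2" by simp
        then show "(\<zeta> a)\<^sup>2 \<le> 2 * (\<zeta> a - z a)\<^sup>2 + 2 * (z a)\<^sup>2" by (simp add: power2_eq_square algebra_simps)
      qed
      also have "\<dots> = 2 * sqn k (\<lambda>a. \<zeta> a - z a) + 2 * Z" by (simp add: sqn_def Z_def sum.distrib sum_distrib_left)
      also have "\<dots> \<le> 2 * \<Delta> + 2 * Z"
        unfolding \<Delta>_def DD_eq using z by (simp add: sqn_nonneg)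
      finally show ?thesis using D by (simp add: \<Delta>_def Z_def)
    qed
    have "G \<le> 3 * r2 + real m / Z * (2 * (48 * Z + 40 * s2) * r2)"
      unfolding G_def
    proof (intro add_mono g1 mult_left_mono)
      show "sqn h (gb \<zeta> \<beta>) \<le> 2 * (48 * Z + 40 * s2) * r2"
        using g2 mult_right_mono[OF zeta r2] unfolding mult.assoc by linarith
    qed (use Z in auto)
    \<comment> \<open>Twice 48 Z + 40 s2, divided by Z, gives 96 and 80; as m \<ge> 1 the 3 is
      absorbed into 99 m, the constant of \<open>mu_small\<close>.\<close>
    also have "\<dots> = (3 + real m * (96 + 80 * s2 / Z)) * r2" using Z by (simp add: field_simps)
    also have "\<dots> \<le> (real m * (99 + 80 * s2 / Z)) * r2"
      using r2 m1 by (intro mult_right_mono) (auto simp: algebra_simps)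
    finally have "\<mu> * G \<le> \<mu> * ((real m * (99 + 80 * s2 / Z)) * r2)" using mu by (intro mult_left_mono) auto
    also have "\<dots> = (\<mu> * (real m * (99 + 80 * s2 / Z))) * r2" by simp
    also have "\<dots> \<le> 1/20 * r2"
      using mu_small by (intro mult_right_mono r2) (simp add: s2_def JJ_def NN_def Z_def)
    also have "r2 \<le> 2 * h2 + 2 * s2"
    proof -
      have "(\<Sum>j\<in>JJ. (rr \<zeta> \<beta> j)\<^sup>2) \<le> (\<Sum>j\<in>JJ. 2 * (hh \<zeta> \<beta> j)\<^sup>2 + 2 * (\<nu> j)\<^sup>2)"
      proof (rule sum_mono)
        fix j have "0 \<le> (hh \<zeta> \<beta> j + \<nu> j)\<^sup>2" by simp
        then show "(rr \<zeta> \<beta> j)\<^sup>2 \<le> 2 * (hh \<zeta> \<beta> j)\<^sup>2 + 2 * (\<nu> j)\<^sup>2"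
          by (simp add: hh_def power2_eq_square algebra_simps)
      qed
      also have "\<dots> = 2 * (\<Sum>j\<in>JJ. (hh \<zeta> \<beta> j)\<^sup>2) + 2 * (\<Sum>j\<in>JJ. (\<nu> j)\<^sup>2)" by (simp add: sum.distrib sum_distrib_left)
      finally show ?thesis unfolding r2_def h2_def s2_def using NN
        by (simp add: divide_right_mono add_divide_distrib[symmetric])
    qed
    finally show ?thesis by simp
  qed
  then have "\<mu>\<^sup>2 * G \<le> \<mu> * (1/10 * h2 + 1/10 * s2)"
    using mu by (simp add: power2_eq_square mult.assoc)
  moreover have "81/100 * \<Delta> \<le> h2"
    using regularity(1)[OF \<beta>, of \<zeta>] NN by (simp add: \<Delta>_def h2_def field_simps)
  moreover have "9/10 * h2 - 1/20 * \<Delta> - 11/2 * s2 \<le> P"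
    using regularity(2)[OF \<beta>, of \<zeta>] NN by (simp add: \<Delta>_def h2_def P_def field_simps)
  then have "2 * \<mu> * (9/10 * h2 - 1/20 * \<Delta> - 11/2 * s2) \<le> 2 * \<mu> * P" using mu by (intro mult_left_mono) auto
  moreover have "\<mu> * (81/100 * \<Delta>) \<le> \<mu> * h2" using \<open>81/100 * \<Delta> \<le> h2\<close> mu by (intro mult_left_mono) auto
  moreover have "0 \<le> \<mu> * \<Delta>" "0 \<le> \<mu> * s2" using mu D0 s2 by auto
  ultimately show "DD (zn \<zeta> \<beta>) (bn \<zeta> \<beta>) \<le> (1 - \<mu>) * DD \<zeta> \<beta> + 12 * \<mu> * s2"
    unfolding \<Delta>_def[symmetric] by (simp add: algebra_simps)
qed

section \<open>The initial point and the induction over the iterates\<close>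

definition z0 :: "nat \<Rightarrow> real" where
  "z0 = (\<lambda>a. if a < k then 1 / NN * (\<Sum>j\<in>JJ. \<phi> j a * yy j) else 0)"
definition be0 :: "nat \<Rightarrow> real" where "be0 = (\<lambda>a. if a = 0 then sqrt (real m) else 0)"

lemma be0_bb: "i < m \<Longrightarrow> matvec h B be0 i = 1"
proof -
  assume i: "i < m"
  have "matvec h B be0 i = (\<Sum>a<h. if a = 0 then B i 0 * sqrt (real m) else 0)"
    unfolding matvec_def be0_def by (intro sum.cong) auto
  also have "\<dots> = B i 0 * sqrt (real m)" using h1 by simp
  also have "\<dots> = 1" using B0[OF i] m1 by simp
  finally show ?thesis .
qed

lemma be0_SS: "be0 \<in> SS"
proof -
  have "be0 a = 0" if "a \<ge> h" for a using that h1 by (simp add: be0_def)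
  then show ?thesis using rho0 by (simp add: B_rho_def G_rho_def be0_bb)
qed

text \<open>An error of the order of |z|^2 suffices, so boundedness of the operator is enough:
  \<open>z0\<close> is its adjoint applied to the data, whence |z0|^2 \<le> 10 |z|^2 + 4 s2 and the
  first block is at most 22 |z|^2 + 8 s2. The second block adds |z|^2, because \<open>B\<close> maps
  \<open>be0\<close> to the vector of ones, from which the true gains differ by at most 1 per
  entry.\<close>

lemma init: "DD z0 be0 \<le> 23 * sqn k z + 8 * s2"
proof -
  have n0: "NN * sqn k z0 \<le> 2 * (\<Sum>j\<in>JJ. (yy j)\<^sup>2)"
  proof (rule le_of_sq_le)
    have "NN * sqn k z0 = (\<Sum>a<k. \<Sum>j\<in>JJ. yy j * (z0 a * \<phi> j a))"
    proof -
      have "NN * (z0 a * z0 a) = (\<Sum>j\<in>JJ. yy j * (z0 a * \<phi> j a))" if "a < k" for a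
      proof -
        have "(\<Sum>j\<in>JJ. yy j * (z0 a * \<phi> j a)) = z0 a * (\<Sum>j\<in>JJ. \<phi> j a * yy j)"
          by (simp add: sum_distrib_left mult_ac)
        also have "(\<Sum>j\<in>JJ. \<phi> j a * yy j) = NN * z0 a" using that NN by (simp add: z0_def)
        finally show ?thesis by simp
      qed
      then show ?thesis by (simp add: sqn_def power2_eq_square sum_distrib_left)
    qed
    also have "\<dots> = (\<Sum>j\<in>JJ. yy j * Lf j z0)"
      by (subst sum.swap) (simp add: Lf_def sum_distrib_left)
    finally have "(NN * sqn k z0)\<^sup>2 \<le> (\<Sum>j\<in>JJ. (yy j)\<^sup>2) * (\<Sum>j\<in>JJ. (Lf j z0)\<^sup>2)"
      by (simp only:) (rule Cauchy_Schwarz_ineq_sum)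
    also have "\<dots> \<le> (\<Sum>j\<in>JJ. (yy j)\<^sup>2) * (2 * NN * sqn k z0)"
      by (intro mult_left_mono upper' sum_nonneg) auto
    finally show "(NN * sqn k z0)\<^sup>2 \<le> (\<Sum>j\<in>JJ. (yy j)\<^sup>2) * (2 * NN * sqn k z0)" .
  qed (simp_all add: sqn_nonneg sum_nonneg)
  have ny: "(\<Sum>j\<in>JJ. (yy j)\<^sup>2) \<le> NN * (5 * sqn k z + 2 * s2)"
  proof -
    have "(\<Sum>j\<in>JJ. (yy j)\<^sup>2) \<le> (\<Sum>j\<in>JJ. 5/2 * (Lf j z)\<^sup>2 + 2 * (\<nu> j)\<^sup>2)"
    proof (rule sum_mono)
      fix j assume "j \<in> JJ"
      then have "\<bar>bb b j\<bar> \<le> \<bar>32/31\<bar>" using bb_b_close[of j] rho by simp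
      then have "(bb b j)\<^sup>2 \<le> (32/31)\<^sup>2" by (simp only: abs_le_square_iff)
      also have "\<dots> \<le> 5/4" by (simp add: power2_eq_square)
      finally have "(bb b j)\<^sup>2 * (Lf j z)\<^sup>2 \<le> 5/4 * (Lf j z)\<^sup>2" by (rule mult_right_mono) simp
      moreover have "0 \<le> (bb b j * Lf j z - \<nu> j)\<^sup>2" by simp
      then have "(yy j)\<^sup>2 \<le> 2 * ((bb b j)\<^sup>2 * (Lf j z)\<^sup>2) + 2 * (\<nu> j)\<^sup>2"
        by (simp add: yy_def power2_eq_square algebra_simps)
      ultimately show "(yy j)\<^sup>2 \<le> 5/2 * (Lf j z)\<^sup>2 + 2 * (\<nu> j)\<^sup>2" by linarith
    qed
    also have "\<dots> = 5/2 * (\<Sum>j\<in>JJ. (Lf j z)\<^sup>2) + 2 * (NN * s2)"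
      unfolding noise_sum[symmetric] by (simp add: sum.distrib sum_distrib_left)
    also have "\<dots> \<le> NN * (5 * sqn k z + 2 * s2)" using upper'[of z] by (simp add: algebra_simps)
    finally show ?thesis .
  qed
  have "NN * sqn k z0 \<le> NN * (10 * sqn k z + 4 * s2)" using n0 ny by (simp add: algebra_simps)
  then have sz: "sqn k z0 \<le> 10 * sqn k z + 4 * s2" using NN by simp
  have "sqn k (\<lambda>a. z0 a - z a) \<le> (\<Sum>a<k. 2 * (z0 a)\<^sup>2 + 2 * (z a)\<^sup>2)"
    unfolding sqn_def
  proof (rule sum_mono)
    fix a have "0 \<le> (z0 a + z a)\<^sup>2" by simp
    then show "(z0 a - z a)\<^sup>2 \<le> 2 * (z0 a)\<^sup>2 + 2 * (z a)\<^sup>2" by (simp add: power2_eq_square algebra_simps)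
  qed
  also have "\<dots> = 2 * sqn k z0 + 2 * sqn k z" by (simp add: sqn_def sum.distrib sum_distrib_left)
  finally have a: "sqn k (\<lambda>a. z0 a - z a) \<le> 22 * sqn k z + 8 * s2" using sz by linarith
  have "sqn h (\<lambda>a. be0 a - b a) = sqn m (matvec h B (\<lambda>a. be0 a - b a))" by (simp add: isometry)
  also have "\<dots> \<le> (\<Sum>i<m. 1)"
    unfolding sqn_def
  proof (rule sum_mono)
    fix i assume i: "i \<in> {..<m}"
    then have "\<bar>matvec h B b i - 1\<bar> \<le> 1" using g rho by (auto simp: G_rho_def intro: order_trans)
    then have "\<bar>matvec h B (\<lambda>a. be0 a - b a) i\<bar> \<le> 1" using i by (simp add: matvec_diff be0_bb abs_minus_commute)
    then show "(matvec h B (\<lambda>a. be0 a - b a) i)\<^sup>2 \<le> 1" by (simp add: abs_square_le_1)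
  qed
  finally have "sqn k z / real m * sqn h (\<lambda>a. be0 a - b a) \<le> sqn k z / real m * real m"
    using z by (intro mult_left_mono) auto
  then show ?thesis using a m1 by (simp add: DD_eq)
qed

lemma mu_le: "\<mu> \<le> 1"
proof -
  have "0 \<le> s2 / sqn k z" using s2 z by simp
  then have "1 * 1 \<le> real m * (99 + 80 * s2 / sqn k z)"
    using m1 by (intro mult_mono) auto
  then have "\<mu> * 1 \<le> \<mu> * (real m * (99 + 80 * s2 / sqn k z))" using mu by (intro mult_left_mono) auto
  also have "\<dots> \<le> 1 / 20" using mu_small by (simp add: s2_def JJ_def NN_def)
  finally show ?thesis by simp
qed

text \<open>The noise floor 12 s2 is the fixed point of the step. Since the transient part never
  exceeds its initial value, the error stays below 23 |z|^2 + 20 s2, exactly the precondition of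
  \<open>step\<close>; feasibility is carried along in the induction.\<close>

theorem convergence:
  defines "it \<equiv> gd_iter FF k h \<mu> (real m / sqn k z) SS z0 be0"
  shows "DD (fst (it j)) (snd (it j)) \<le> (1 - \<mu>) ^ j * (23 * sqn k z + 8 * s2) + 12 * s2"
proof -
  have "snd (it j) \<in> SS \<and> DD (fst (it j)) (snd (it j)) \<le> (1 - \<mu>) ^ j * (23 * sqn k z + 8 * s2) + 12 * s2"
  proof (induction j)
    case 0
    show ?case using be0_SS init s2 by (simp add: it_def)
  next
    case (Suc j)
    define \<zeta> where "\<zeta> = fst (it j)"
    define \<beta> where "\<beta> = snd (it j)"
    have i: "it (Suc j) = (zn \<zeta> \<beta>, bn \<zeta> \<beta>)"
      by (simp add: it_def \<zeta>_def \<beta>_def zn_def bn_def gz_def gb_def case_prod_unfold Let_def)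
    have IH: "\<beta> \<in> SS" "DD \<zeta> \<beta> \<le> (1 - \<mu>) ^ j * (23 * sqn k z + 8 * s2) + 12 * s2"
      using Suc by (auto simp: \<zeta>_def \<beta>_def)
    have "(1 - \<mu>) ^ j * (23 * sqn k z + 8 * s2) \<le> 1 * (23 * sqn k z + 8 * s2)"
      using mu mu_le z s2 by (intro mult_right_mono power_le_one) auto
    with IH have "DD \<zeta> \<beta> \<le> 23 * sqn k z + 20 * s2" by simp
    note st = step[OF IH(1) this]
    have "(1 - \<mu>) * DD \<zeta> \<beta> \<le> (1 - \<mu>) * ((1 - \<mu>) ^ j * (23 * sqn k z + 8 * s2) + 12 * s2)"
      using IH mu_le by (intro mult_left_mono) auto
    with st show ?case by (simp add: i algebra_simps)
  qed
  then show ?thesis by blast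
qed

end

section \<open>The good event\<close>

lemma sum_lessThan_append: "(\<Sum>c<k + h. f c) = (\<Sum>c<k. f c) + (\<Sum>a<h. f (k + a))" for f :: "nat \<Rightarrow> real"
proof (induction h)
  case (Suc h) then show ?case by (simp add: add.assoc)
qed simp

lemma mu_max_row:
  assumes "i < m" "h \<ge> 1"
  shows "real m * (\<Sum>a<h. (B i a)\<^sup>2) \<le> (mu_max m h B)\<^sup>2 * real h"
proof -
  define X where "X = Max ((\<lambda>i. sqrt (\<Sum>a<h. (B i a)\<^sup>2)) ` {..<m})"
  have le: "sqrt (\<Sum>a<h. (B i a)\<^sup>2) \<le> X" unfolding X_def by (rule Max_ge) (use assms in auto)
  have "(\<Sum>a<h. (B i a)\<^sup>2) = (sqrt (\<Sum>a<h. (B i a)\<^sup>2))\<^sup>2" by (simp add: sum_nonneg)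
  also have "\<dots> \<le> X\<^sup>2" using le by (intro power_mono) (auto simp: sum_nonneg)
  finally have "real m * (\<Sum>a<h. (B i a)\<^sup>2) \<le> real m * X\<^sup>2" by (intro mult_left_mono) auto
  also have "\<dots> = (mu_max m h B)\<^sup>2 * real h"
    using assms by (simp add: mu_max_def X_def power_mult_distrib)
  finally show ?thesis .
qed

context unit_subgaussian
begin

text \<open>Regroups independent entries into independent rows, where the tail bounds live. The
  measure of uncurried samples agrees with the product measure on rectangles, so the preimage of an
  event under currying keeps its probability.\<close>

lemma block_product:
  fixes p m n :: nat
  defines "I \<equiv> {..<p} \<times> {..<m} \<times> {..<n}" and "JJ \<equiv> {..<p} \<times> {..<m}"
  defines "cur \<equiv> \<lambda>\<omega>. \<lambda>j\<in>JJ. \<lambda>r\<in>{..<n}. \<omega> (fst j, snd j, r)"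
  assumes E': "E' \<in> sets (PiM JJ (\<lambda>_. VV n))"
  shows "\<exists>E\<in>sets (PiM I (\<lambda>_. M)). measure (PiM I (\<lambda>_. M)) E = measure (PiM JJ (\<lambda>_. VV n)) E' \<and> (\<forall>\<omega>\<in>E. cur \<omega> \<in> E')"
proof -
  let ?P = "PiM I (\<lambda>_. M)" and ?Q = "PiM JJ (\<lambda>_. VV n)"
  interpret PM: product_sigma_finite "\<lambda>_::nat \<times> nat \<times> nat. M" by standard
  interpret PN: product_sigma_finite "\<lambda>_::nat. M" by standard
  interpret V: prob_space "VV n" by (rule VV_prob)
  interpret PV: product_sigma_finite "\<lambda>_::nat \<times> nat. VV n" by standard
  define unc where "unc \<omega> = (\<lambda>x\<in>I. \<omega> (fst x, fst (snd x)) (snd (snd x)))" for \<omega> :: "nat \<times> nat \<Rightarrow> nat \<Rightarrow> real"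
  have comp: "(\<lambda>\<omega>. \<omega> j r) \<in> measurable ?Q M" if "j \<in> JJ" "r < n" for j r
  proof -
    have "(\<lambda>\<omega>. \<omega> j) \<in> measurable ?Q (VV n)" using that by simp
    moreover have "(\<lambda>a. a r) \<in> measurable (VV n) M" unfolding VV_def using that by simp
    ultimately show ?thesis by (rule measurable_compose)
  qed
  have um: "unc \<in> measurable ?Q ?P"
    unfolding unc_def
  proof (rule measurable_restrict)
    fix x assume "x \<in> I"
    then show "(\<lambda>\<omega>. \<omega> (fst x, fst (snd x)) (snd (snd x))) \<in> measurable ?Q M"
      by (intro comp) (auto simp: I_def JJ_def)
  qed
  have cm: "cur \<in> measurable ?P ?Q"
    unfolding cur_def VV_def
    by (intro measurable_restrict measurable_component_singleton) (auto simp: I_def JJ_def)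
  have d: "distr ?Q ?P unc = ?P"
  proof (rule PM.PiM_eqI)
    show "finite I" by (simp add: I_def)
    show "sets (distr ?Q ?P unc) = sets ?P" by simp
    fix A assume A: "\<And>i. i \<in> I \<Longrightarrow> A i \<in> sets M"
    have AP: "Pi\<^sub>E I A \<in> sets ?P" by (rule sets_PiM_I_finite) (use A in \<open>auto simp: I_def\<close>)
    define R where "R j = PiE {..<n} (\<lambda>r. A (fst j, snd j, r))" for j
    have Rs: "R j \<in> sets (VV n)" if "j \<in> JJ" for j
      unfolding R_def VV_def by (rule sets_PiM_I_finite) (use A that in \<open>auto simp: I_def JJ_def\<close>)
    have sM: "x \<in> A i \<Longrightarrow> i \<in> I \<Longrightarrow> x \<in> space M" for x i using A sets.sets_into_space by blast
    have "unc -` (Pi\<^sub>E I A) \<inter> space ?Q = Pi\<^sub>E JJ R"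
    proof (intro set_eqI iffI)
      fix \<omega> assume w: "\<omega> \<in> unc -` (Pi\<^sub>E I A) \<inter> space ?Q"
      then have e: "\<omega> \<in> PiE JJ (\<lambda>_. space (VV n))" by (simp add: space_PiM)
      show "\<omega> \<in> Pi\<^sub>E JJ R"
      proof (rule PiE_I)
        fix j assume j: "j \<in> JJ"
        have ej: "\<omega> j \<in> PiE {..<n} (\<lambda>_. space M)" using e j by (auto simp: VV_def space_PiM)
        show "\<omega> j \<in> R j" unfolding R_def
        proof (rule PiE_I)
          fix r assume r: "r \<in> {..<n}"
          have x: "(fst j, snd j, r) \<in> I" using j r by (auto simp: I_def JJ_def)
          have "unc \<omega> (fst j, snd j, r) \<in> A (fst j, snd j, r)" using w x by (auto intro: PiE_mem)
          then show "\<omega> j r \<in> A (fst j, snd j, r)" using x by (simp add: unc_def)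
        next
          fix r assume "r \<notin> {..<n}" then show "\<omega> j r = undefined" by (rule PiE_arb[OF ej])
        qed
      next
        fix j assume "j \<notin> JJ" then show "\<omega> j = undefined" by (rule PiE_arb[OF e])
      qed
    next
      fix \<omega> assume w: "\<omega> \<in> Pi\<^sub>E JJ R"
      have "\<omega> \<in> space ?Q"
        unfolding space_PiM
      proof (rule PiE_I)
        fix j assume j: "j \<in> JJ"
        show "\<omega> j \<in> space (VV n)" using sets.sets_into_space[OF Rs[OF j]] PiE_mem[OF w j] by blast
      qed (rule PiE_arb[OF w])
      moreover have "unc \<omega> \<in> Pi\<^sub>E I A"
      proof (rule PiE_I)
        fix x assume x: "x \<in> I"
        then obtain l i r where xe: "x = (l, i, r)" "l < p" "i < m" "r < n" by (auto simp: I_def)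
        have "\<omega> (l, i) \<in> R (l, i)" using w xe by (auto simp: JJ_def intro: PiE_mem)
        then have "\<omega> (l, i) r \<in> A (l, i, r)" using xe by (auto simp: R_def dest: PiE_mem)
        then show "unc \<omega> x \<in> A x" using x xe by (simp add: unc_def)
      qed (simp add: unc_def)
      ultimately show "\<omega> \<in> unc -` (Pi\<^sub>E I A) \<inter> space ?Q" by simp
    qed
    then have "emeasure (distr ?Q ?P unc) (Pi\<^sub>E I A) = emeasure ?Q (Pi\<^sub>E JJ R)"
      using um AP by (simp add: emeasure_distr)
    also have "\<dots> = (\<Prod>j\<in>JJ. emeasure (VV n) (R j))"
      by (rule PV.emeasure_PiM) (use Rs in \<open>auto simp: JJ_def\<close>)
    also have "\<dots> = (\<Prod>j\<in>JJ. \<Prod>r<n. emeasure M (A (fst j, snd j, r)))"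
      unfolding R_def VV_def
      by (intro prod.cong refl PN.emeasure_PiM) (use A in \<open>auto simp: I_def JJ_def\<close>)
    also have "\<dots> = (\<Prod>i\<in>I. emeasure M (A i))"
    proof -
      have "(\<Prod>j\<in>JJ. \<Prod>r<n. emeasure M (A (fst j, snd j, r)))
          = (\<Prod>x\<in>JJ \<times> {..<n}. emeasure M (A (fst (fst x), snd (fst x), snd x)))"
        by (simp add: prod.cartesian_product case_prod_unfold)
      also have "\<dots> = (\<Prod>i\<in>I. emeasure M (A i))"
        by (rule prod.reindex_bij_witness[of _ "\<lambda>x. ((fst x, fst (snd x)), snd (snd x))"
              "\<lambda>x. (fst (fst x), snd (fst x), snd x)"]) (auto simp: I_def JJ_def)
      finally show ?thesis .
    qed
    finally show "emeasure (distr ?Q ?P unc) (Pi\<^sub>E I A) = (\<Prod>i\<in>I. emeasure M (A i))" .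
  qed
  define E where "E = cur -` E' \<inter> space ?P"
  have Es: "E \<in> sets ?P" unfolding E_def using cm E' by (rule measurable_sets)
  \<comment> \<open>Equality of functions also needs the indices outside the products, where points
    of the space are \<open>undefined\<close>, just as the restricted abstractions are.\<close>
  have cu: "cur (unc \<omega>) = \<omega>" if w: "\<omega> \<in> space ?Q" for \<omega>
  proof (intro ext)
    fix j r
    from w have e: "\<omega> \<in> PiE JJ (\<lambda>_. PiE {..<n} (\<lambda>_. space M))" by (simp add: space_PiM VV_def)
    show "cur (unc \<omega>) j r = \<omega> j r"
    proof (cases "j \<in> JJ")
      case True
      then have ej: "\<omega> j \<in> PiE {..<n} (\<lambda>_. space M)" using e by (auto dest: PiE_mem)
      show ?thesis using True PiE_arb[OF ej, of r] by (auto simp: cur_def unc_def I_def JJ_def)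
    next
      case False then show ?thesis using PiE_arb[OF e, of j] by (simp add: cur_def)
    qed
  qed
  have "measure ?P E = measure (distr ?Q ?P unc) E" by (simp add: d)
  also have "\<dots> = measure ?Q (unc -` E \<inter> space ?Q)" by (rule measure_distr[OF um Es])
  also have "unc -` E \<inter> space ?Q = E'"
    using cu measurable_space[OF um] sets.sets_into_space[OF E'] by (auto simp: E_def)
  finally have "measure ?P E = measure ?Q E'" .
  with Es show ?thesis by (auto simp: E_def)
qed

abbreviation sample_const :: real where "sample_const \<equiv> sample_size_const \<beta>"

text \<open>The factor \<open>ln (1 / \<delta>) / \<delta>\<^sup>2\<close> is only used through its lower bound 16 for \<open>\<delta> < 1/4\<close>; the latter is
  implied by \<open>\<eta> > 0\<close>.\<close>

lemma sample_size_consequences: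
  fixes N S t \<delta> k \<l> :: real
  assumes \<delta>: "0 < \<delta>" "\<delta> < 1/4" and t: "t \<ge> 1" and S: "S \<ge> 1" and k: "0 \<le> k" "k \<le> S" and lg: "\<l> \<ge> ln 2" "\<l> \<ge> ln N" and N0: "N > 0"
    and NK: "N \<ge> sample_const * t / \<delta>\<^sup>2 * S * \<l>\<^sup>2 * ln (1 / \<delta>)"
  shows "S \<le> N" "ln N \<ge> 1" "tauL * S * (2 * (t * ln N)) \<le> exp (-2) / 12800 * N" "18 * k + t * ln N \<le> cU * N"
proof -
  define K where "K = sample_const"
  have K1: "K \<ge> 1" "K \<ge> tauL * 12800 * exp 2" "K \<ge> 2 / cU"
    using tauL_pos cU_pos by (auto simp: K_def sample_size_const_def)
  have d2: "16 \<le> 1 / \<delta>\<^sup>2"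
  proof -
    have "\<delta>\<^sup>2 \<le> (1/4)\<^sup>2" using \<delta> by (intro power_mono) auto
    then show ?thesis using \<delta> by (simp add: power2_eq_square field_simps)
  qed
  have ld: "1 \<le> ln (1 / \<delta>)"
  proof -
    have "exp (1::real) \<le> 4" using exp_le by simp
    also have "4 \<le> 1 / \<delta>" using \<delta> by (simp add: field_simps)
    finally show ?thesis using \<delta> by (simp add: ln_ge_iff)
  qed
  have l2: "1/2 \<le> \<l>" using lg(1) ln2_ge_two_thirds by linarith
  have K0: "0 \<le> K * t * S * \<l>\<^sup>2" using K1 t S by (intro mult_nonneg_nonneg) auto
  have "16 * (K * t * S * \<l>\<^sup>2) \<le> 1 / \<delta>\<^sup>2 * (K * t * S * \<l>\<^sup>2)" using d2 K0 by (rule mult_right_mono)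
  also have "\<dots> * 1 \<le> 1 / \<delta>\<^sup>2 * (K * t * S * \<l>\<^sup>2) * ln (1 / \<delta>)"
    using K0 by (intro mult_left_mono[OF ld]) simp
  also have "\<dots> = sample_const * t / \<delta>\<^sup>2 * S * \<l>\<^sup>2 * ln (1 / \<delta>)" by (simp add: K_def mult_ac)
  finally have N16: "16 * (K * t * S * \<l>\<^sup>2) \<le> N" using NK by simp
  have lsq: "1/4 \<le> \<l>\<^sup>2" using power_mono[OF l2, of 2] by (simp add: power2_eq_square)
  have KtS: "S \<le> K * t * S"
    using mult_mono[of 1 K 1 t] K1 t S mult_right_mono[of 1 "K * t" S] by simp
  have "16 * (K * t * S * (1/4)) \<le> 16 * (K * t * S * \<l>\<^sup>2)"
    using lsq K1 t S by (intro mult_left_mono mult_nonneg_nonneg) auto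
  with N16 have N4: "4 * (K * t * S) \<le> N" by linarith
  then have N4': "4 \<le> N" and SN: "S \<le> N" using KtS S by linarith+
  show "S \<le> N" by (rule SN)
  have "exp (1::real) \<le> N" using exp_le N4' by linarith
  then show ln1: "ln N \<ge> 1" using N0 by (simp add: ln_ge_iff)
  have "ln N * 1 \<le> \<l> * \<l>" using lg ln1 by (intro mult_mono) auto
  then have lsq': "ln N \<le> \<l>\<^sup>2" by (simp add: power2_eq_square)
  define Q where "Q = t * S * ln N"
  have "16 * (K * Q) \<le> 16 * (K * t * S * \<l>\<^sup>2)"
    using lsq' K1 t S by (simp add: Q_def mult.assoc mult_left_mono)
  then have NQ: "16 * (K * Q) \<le> N" using N16 by linarith
  have Q1: "1 \<le> Q" "S \<le> Q" "t * ln N \<le> Q" "0 \<le> Q"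
  proof -
    have tl: "1 \<le> t * ln N" using mult_mono[of 1 t 1 "ln N"] t ln1 by simp
    show "S \<le> Q" using mult_right_mono[OF tl, of S] S by (simp add: Q_def mult_ac)
    then show "1 \<le> Q" "0 \<le> Q" using S by auto
    show "t * ln N \<le> Q" using mult_right_mono[OF S, of "t * ln N"] tl by (simp add: Q_def mult_ac)
  qed
  have "tauL * S * (2 * (t * ln N)) * (12800 * exp 2) = (tauL * 12800 * exp 2) * (2 * Q)" by (simp add: Q_def mult_ac)
  also have "\<dots> \<le> K * (2 * Q)" using K1 Q1 by (intro mult_right_mono) auto
  also have "\<dots> \<le> N" using NQ mult_nonneg_nonneg[of K Q] K1 Q1 by linarith
  finally have "tauL * S * (2 * (t * ln N)) \<le> N / (12800 * exp 2)" by (simp add: pos_le_divide_eq)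
  then show "tauL * S * (2 * (t * ln N)) \<le> exp (-2) / 12800 * N" by (simp add: exp_minus field_simps)
  \<comment> \<open>Each of k and t ln N is at most Q; 18 is the exponent per dimension of the net.
    As 32 = 16 * 2, the summand 2 / \<open>cU\<close> of the constant finishes the bound.\<close>
  have "18 * k + t * ln N \<le> 19 * Q" using k Q1 by linarith
  also have "\<dots> \<le> 32 * Q" using Q1 by simp
  also have "\<dots> = cU * (16 * (2 / cU * Q))" using cU_pos by simp
  also have "\<dots> \<le> cU * (16 * (K * Q))"
    using K1 Q1 cU_pos by (intro mult_left_mono mult_right_mono) auto
  also have "\<dots> \<le> cU * N" using NQ cU_pos by (intro mult_left_mono) auto
  finally show "18 * k + t * ln N \<le> cU * N" .
qed

end

context unit_subgaussian
begin

text \<open>Both matrix bounds hold outside events of probability N^(-t). For the lower one, u and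
  the rescaled v form one vector of dimension k + h; the rows seen by it have expected squared
  length at most k + \<open>mu_max\<close>^2 h, and 19/20 - 1/20 gives 9/10.\<close>

lemma good_event:
  fixes m p k h n :: nat
  defines "I \<equiv> {..<p} \<times> {..<m} \<times> {..<n}" and "JJ \<equiv> {..<p} \<times> {..<m}" and "N \<equiv> real m * real p"
  assumes m1: "m \<ge> 1" and p1: "p \<ge> 1" and h1: "h \<ge> 1" and n1: "n \<ge> 1"
    and Zo: "\<And>a a'. a < k \<Longrightarrow> a' < k \<Longrightarrow> (\<Sum>r<n. Z r a * Z r a') = (if a = a' then 1 else 0)"
    and Bo: "\<And>a a'. a < h \<Longrightarrow> a' < h \<Longrightarrow> (\<Sum>i<m. B i a * B i a') = (if a = a' then 1 else 0)"
    and Bperp: "\<And>a. 0 < a \<Longrightarrow> a < h \<Longrightarrow> (\<Sum>i<m. B i a) = 0"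
    and z: "sqn k z > 0"
    and \<delta>: "0 < \<delta>" "\<delta> < 1/4" and t: "t \<ge> 1"
    and NK: "N \<ge> sample_const * t / \<delta>\<^sup>2 * (real k + (mu_max m h B)\<^sup>2 * real h)
            * (ln (real m * (real p + real n)))\<^sup>2 * ln (1 / \<delta>)"
  shows "\<exists>E\<in>sets (PiM I (\<lambda>_. M)). measure (PiM I (\<lambda>_. M)) E > 1 - 3 * N powr (- t) \<and>
    (\<forall>\<omega>\<in>E. (\<forall>u. (\<Sum>j\<in>JJ. (lin n (matvec k Z u) (\<lambda>r. \<omega> (fst j, snd j, r)))\<^sup>2) \<le> 2 * N * sqn k u) \<and>
      (\<forall>u v. v 0 = 0 \<longrightarrow> 9/10 * N * (sqn k u + sqn k z / real m * sqn h v)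
      \<le> (\<Sum>j\<in>JJ. (lin n (matvec k Z u) (\<lambda>r. \<omega> (fst j, snd j, r))
           + matvec h B v (snd j) * lin n (matvec k Z z) (\<lambda>r. \<omega> (fst j, snd j, r)))\<^sup>2)))"
proof -
  define S where "S = real k + (mu_max m h B)\<^sup>2 * real h"
  have m0: "real m > 0" "real p > 0" using m1 p1 by auto
  have N0: "N > 0" using m0 by (simp add: N_def)
  have cJ: "real (card JJ) = N" by (simp add: JJ_def N_def)
  have k1: "k \<ge> 1"
  proof (rule ccontr)
    assume "\<not> k \<ge> 1" then have "k = 0" by simp
    then show False using z by (simp add: sqn_def)
  qed
  have row: "real m * (\<Sum>a<h. (B i a)\<^sup>2) \<le> (mu_max m h B)\<^sup>2 * real h" if "i < m" for i
    by (rule mu_max_row[OF that h1])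
  \<comment> \<open>The squared rows of \<open>B\<close> sum to h, so the largest is at least their
    mean h/m. This bounds the dimension k + h by \<open>S\<close>, hence by the sample size.\<close>
  have hS: "real h \<le> (mu_max m h B)\<^sup>2 * real h"
  proof -
    have "real m * real h = (\<Sum>a<h. \<Sum>i<m. real m * (B i a)\<^sup>2)"
      using Bo by (simp add: power2_eq_square sum_distrib_left[symmetric])
    also have "\<dots> = (\<Sum>i<m. real m * (\<Sum>a<h. (B i a)\<^sup>2))"
      by (subst sum.swap) (simp add: sum_distrib_left)
    also have "\<dots> \<le> (\<Sum>i<m. (mu_max m h B)\<^sup>2 * real h)" by (intro sum_mono row) auto
    also have "\<dots> = real m * ((mu_max m h B)\<^sup>2 * real h)" by simp
    finally show ?thesis using m0 by (simp only: mult_le_cancel_left_pos)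
  qed
  have S: "S \<ge> 1" "real k \<le> S" "real (k + h) \<le> S" using hS k1 by (auto simp: S_def)
  define lg where "lg = ln (real m * (real p + real n))"
  have "2 \<le> real m * (real p + real n)" using mult_mono[of 1 "real m" 2 "real p + real n"] m1 p1 n1 by simp
  then have lg1: "lg \<ge> ln 2" unfolding lg_def by (subst ln_le_cancel_iff) auto
  have "N \<le> real m * (real p + real n)" by (simp add: N_def algebra_simps)
  then have lg2: "lg \<ge> ln N" unfolding lg_def using N0 by (subst ln_le_cancel_iff) auto
  note cons = sample_size_consequences[OF \<delta> t S(1) of_nat_0_le_iff S(2) lg1 lg2 N0 NK[folded S_def lg_def]]
  define R where "R = nat \<lceil>t * ln N\<rceil>"
  have tl: "1 \<le> t * ln N" using mult_mono[of 1 t 1 "ln N"] t cons(2) by simp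
  have R1: "t * ln N \<le> real R" unfolding R_def by (rule of_nat_ceiling)
  have R2: "real R \<le> 2 * (t * ln N)"
  proof -
    have "real R = of_int \<lceil>t * ln N\<rceil>" using tl by (simp add: R_def)
    also have "\<dots> \<le> t * ln N + 1" by linarith
    finally show ?thesis using tl by linarith
  qed
  have pw: "N powr (- t) = exp (- (t * ln N))" using N0 by (simp add: powr_def)
  let ?Q = "PiM JJ (\<lambda>_. VV n)"
  interpret Q: prob_space ?Q by (rule prob_space_PiM) (rule VV_prob)
  have finJ: "finite JJ" "JJ \<noteq> {}" using m1 p1 by (auto simp: JJ_def lessThan_empty_iff)

  obtain E1 where "E1 \<in> sets ?Q" and E1': "measure ?Q E1 \<ge> 1 - (3 * 2 ^ 16) ^ k * exp (- cU * real (card JJ)) \<and>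
    (\<forall>\<omega>\<in>E1. \<forall>u. (\<Sum>j\<in>JJ. (lin n (matvec k Z u) (\<omega> j))\<^sup>2) \<le> real (2 * card JJ) * sqn k u)"
    by (rule bexE[OF sample_covariance_upper_tail[where Z = Z and k = k and n = n and J = JJ, OF Zo finJ(1)]])
  note E1 = this(1) E1'[THEN conjunct1] E1'[THEN conjunct2, rule_format]
  have pE1: "measure ?Q E1 \<ge> 1 - N powr (- t)"
  proof -
    \<comment> \<open>As e \<ge> 2, the net has at most exp (18 k) points, which the Chernoff
      exponent beats with t ln N to spare.\<close>
    have "(3 * 2 ^ 16 :: real) \<le> 2 ^ 18" by simp
    also have "\<dots> \<le> exp 1 ^ 18" using exp_ge_add_one_self[of 1] by (intro power_mono) auto
    also have "\<dots> = exp 18" by (simp add: exp_of_nat_mult[symmetric])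
    finally have "(3 * 2 ^ 16 :: real) ^ k \<le> exp 18 ^ k" by (rule power_mono) simp
    also have "\<dots> = exp (18 * real k)" by (simp add: exp_of_nat_mult[symmetric] mult.commute)
    finally have "(3 * 2 ^ 16) ^ k * exp (- cU * real (card JJ)) \<le> exp (18 * real k) * exp (- cU * N)"
      unfolding cJ by (rule mult_right_mono) simp
    also have "\<dots> = exp (18 * real k - cU * N)" by (simp add: exp_add[symmetric])
    also have "\<dots> \<le> N powr (- t)" unfolding pw using cons(4) by simp
    finally show ?thesis using E1(2) by linarith
  qed

  define x where "x = matvec k Z z"
  define zn where "zn = sqrt (sqn k z)"
  have zn: "zn > 0" "zn\<^sup>2 = sqn k z" using z by (auto simp: zn_def)
  define xh where "xh r = x r / zn" for r
  have sx: "sqn n xh = 1"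
  proof -
    have "sqn n xh = sqn n x / zn\<^sup>2" by (simp add: sqn_def xh_def power_divide sum_divide_distrib)
    also have "sqn n x = sqn k z" unfolding x_def by (rule sqn_matvec_orthonormal(1)[OF Zo])
    finally show ?thesis using zn z by simp
  qed
  define B' where "B' i a = (if a = 0 then 0 else B i a)" for i a
  \<comment> \<open>The first \<open>k\<close> coordinates of the combined unknown are \<open>u\<close>, the remaining \<open>h\<close> are a multiple of \<open>v\<close>;
    dropping the constant column of \<open>B\<close> makes the two blocks orthogonal on average.\<close>
  define y where "y j c r = (if c < k then Z r c else sqrt (real m) * B' (snd j) (c - k) * xh r)" for j :: "nat \<times> nat" and c r
  define bt where "bt w i = (\<Sum>a<h. w (k + a) * B' i a)" for w i
  have comb: "(\<Sum>c<k + h. w c * y j c r) = matvec k Z w r + sqrt (real m) * bt w (snd j) * xh r" for w j r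
  proof -
    have "(\<Sum>c<k + h. w c * y j c r) = (\<Sum>c<k. w c * Z r c) + (\<Sum>a<h. w (k + a) * (sqrt (real m) * B' (snd j) a * xh r))"
      unfolding sum_lessThan_append by (simp add: y_def)
    then show ?thesis by (simp add: matvec_def bt_def sum_distrib_left sum_distrib_right mult_ac)
  qed
  have trace: "(\<Sum>c<k + h. sqn n (y j c)) \<le> S" if j: "j \<in> JJ" for j
  proof -
    have 1: "sqn n (y j c) = 1" if "c < k" for c
      using Zo[OF that that] that by (simp add: sqn_def y_def power2_eq_square)
    have 2: "sqn n (y j (k + a)) = real m * (B' (snd j) a)\<^sup>2" for a
    proof -
      have "sqn n (y j (k + a)) = (sqrt (real m) * B' (snd j) a)\<^sup>2 * sqn n xh"
        by (simp add: sqn_def y_def sum_distrib_left power_mult_distrib)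
      then show ?thesis by (simp add: sx power_mult_distrib)
    qed
    have "(\<Sum>c<k + h. sqn n (y j c)) = real k + (\<Sum>a<h. real m * (B' (snd j) a)\<^sup>2)"
      unfolding sum_lessThan_append by (simp add: 1 2)
    also have "\<dots> \<le> real k + (\<Sum>a<h. real m * (B (snd j) a)\<^sup>2)"
      by (intro add_left_mono sum_mono mult_left_mono) (auto simp: B'_def)
    also have "\<dots> \<le> S"
      using row[of "snd j"] j by (simp add: S_def JJ_def sum_distrib_left mem_Times_iff)
    finally show ?thesis .
  qed
  have total: "(\<Sum>j\<in>JJ. sqn n (\<lambda>r. \<Sum>c<k + h. w c * y j c r)) = N * (sqn k w + (\<Sum>a<h. if a = 0 then 0 else (w (k + a))\<^sup>2))" for w
  proof -
    define v where "v a = (if a = 0 then 0 else w (k + a))" for a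
    have btv: "bt w i = matvec h B v i" for i
      unfolding bt_def matvec_def by (intro sum.cong refl) (auto simp: B'_def v_def)
    have s1: "(\<Sum>i<m. (bt w i)\<^sup>2) = sqn h v"
      using sqn_matvec_orthonormal(1)[of h B m v, OF Bo] by (simp add: btv sqn_def)
    have s2: "(\<Sum>i<m. bt w i) = 0"
    proof -
      have "(\<Sum>i<m. bt w i) = (\<Sum>a<h. v a * (\<Sum>i<m. B i a))"
        unfolding btv matvec_def by (subst sum.swap) (simp add: sum_distrib_left mult.commute)
      also have "\<dots> = 0" using Bperp by (intro sum.neutral) (auto simp: v_def)
      finally show ?thesis .
    qed
    define ip where "ip = (\<Sum>r<n. matvec k Z w r * xh r)"
    have sq: "sqn n (\<lambda>r. \<Sum>c<k + h. w c * y j c r) = sqn k w + real m * (bt w (snd j))\<^sup>2 + 2 * sqrt (real m) * ip * bt w (snd j)" for j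
    proof -
      have "sqn n (\<lambda>r. \<Sum>c<k + h. w c * y j c r)
        = sqn n (matvec k Z w) + (sqrt (real m) * bt w (snd j))\<^sup>2 * sqn n xh + 2 * (sqrt (real m) * bt w (snd j)) * ip"
        unfolding comb sqn_def ip_def sum_distrib_left sum.distrib[symmetric]
        by (intro sum.cong refl) (simp add: power2_eq_square algebra_simps)
      also have "sqn n (matvec k Z w) = sqn k w" by (rule sqn_matvec_orthonormal(1)[OF Zo])
      finally show ?thesis by (simp add: sx power_mult_distrib mult_ac)
    qed
    have "(\<Sum>j\<in>JJ. sqn n (\<lambda>r. \<Sum>c<k + h. w c * y j c r))
       = (\<Sum>l<p. \<Sum>i<m. sqn k w + real m * (bt w i)\<^sup>2 + 2 * sqrt (real m) * ip * bt w i)"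
      unfolding sq JJ_def sum.cartesian_product by (simp only: case_prod_unfold)
    also have "\<dots> = real p * (real m * sqn k w + real m * (\<Sum>i<m. (bt w i)\<^sup>2) + 2 * sqrt (real m) * ip * (\<Sum>i<m. bt w i))"
      by (simp add: sum.distrib sum_distrib_left)
    also have "\<dots> = N * (sqn k w + sqn h v)" unfolding s1 s2 by (simp add: N_def algebra_simps)
    also have "sqn h v = (\<Sum>a<h. if a = 0 then 0 else (w (k + a))\<^sup>2)"
      unfolding sqn_def by (intro sum.cong refl) (simp add: v_def)
    finally show ?thesis .
  qed
  have sqn_split: "sqn (k + h) w = sqn k w + (\<Sum>a<h. (w (k + a))\<^sup>2)" for w
    unfolding sqn_def by (rule sum_lessThan_append)
  have upper: "(\<Sum>j\<in>JJ. sqn n (\<lambda>r. \<Sum>c<k + h. w c * y j c r)) \<le> real (card JJ) * sqn (k + h) w" for w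
    unfolding total cJ sqn_split using N0 by (intro mult_left_mono add_left_mono sum_mono) auto
  have RR: "tauL * S * real R \<le> exp (-2) / 12800 * real (card JJ)"
  proof -
    have "tauL * S * real R \<le> tauL * S * (2 * (t * ln N))"
      using R2 tauL_pos S by (intro mult_left_mono) auto
    then show ?thesis using cons(3) unfolding cJ by linarith
  qed
  have S0: "S > 0" using S by simp
  obtain E2 where "E2 \<in> sets ?Q" and E2': "measure ?Q E2 \<ge> 1 - real (k + h) * exp (-2) ^ R \<and>
    (\<forall>\<omega>\<in>E2. \<forall>w. 19/20 * (\<Sum>j\<in>JJ. sqn n (\<lambda>r. \<Sum>c<k + h. w c * y j c r)) - 1/20 * real (card JJ) * sqn (k + h) w
       \<le> (\<Sum>j\<in>JJ. (lin n (\<lambda>r. \<Sum>c<k + h. w c * y j c r) (\<omega> j))\<^sup>2))"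
    by (rule bexE[OF anisotropic_lower_tail[where y = y and d = "k + h" and n = n and J = JJ and R = R, OF finJ S0 trace upper RR]])
  note E2 = this(1) E2'[THEN conjunct1] E2'[THEN conjunct2, rule_format]
  have pE2: "measure ?Q E2 \<ge> 1 - N powr (- t)"
  proof -
    \<comment> \<open>With \<open>R\<close> at least t ln N the gain is N^(-2t); one factor N^(-t)
      pays for the dimension, as k + h \<le> N and t \<ge> 1.\<close>
    have "exp (-2) ^ R = exp (- 2 * real R)" by (simp add: exp_of_nat_mult[symmetric] mult.commute)
    also have "\<dots> \<le> exp (- 2 * (t * ln N))" using R1 by simp
    finally have "real (k + h) * exp (-2) ^ R \<le> N * exp (- 2 * (t * ln N))"
      using S cons(1) by (intro mult_mono) auto
    also have "\<dots> = exp (ln N + - 2 * (t * ln N))" using N0 by (simp only: exp_add exp_ln)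
    also have "\<dots> \<le> N powr (- t)"
    proof -
      have "ln N \<le> t * ln N" using mult_right_mono[OF t, of "ln N"] cons(2) by simp
      then show ?thesis unfolding pw by simp
    qed
    finally show ?thesis using E2(2) by linarith
  qed
  define E' where "E' = E1 \<inter> E2"
  have E's: "E' \<in> sets ?Q" using E1 E2 by (auto simp: E'_def)
  have "measure ?Q E1 \<le> measure ?Q (E' \<union> (space ?Q - E2))"
    using sets.sets_into_space[OF E1(1)] E's E2(1) by (intro Q.finite_measure_mono) (auto simp: E'_def)
  also have "\<dots> \<le> measure ?Q E' + measure ?Q (space ?Q - E2)"
    using E's E2(1) by (intro measure_Un_le) auto
  also have "measure ?Q (space ?Q - E2) = 1 - measure ?Q E2" by (rule Q.prob_compl[OF E2(1)])
  \<comment> \<open>Two failure events; the factor 3 makes the inequality strict.\<close>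
  finally have pE': "measure ?Q E' > 1 - 3 * N powr (- t)"
    using pE1 pE2 N0 powr_gt_zero[of N "- t"] by linarith
  obtain E where E: "E \<in> sets (PiM I (\<lambda>_. M))" "measure (PiM I (\<lambda>_. M)) E = measure ?Q E'"
    "\<And>\<omega>. \<omega> \<in> E \<Longrightarrow> (\<lambda>j\<in>JJ. \<lambda>r\<in>{..<n}. \<omega> (fst j, snd j, r)) \<in> E'"
    using block_product[of E' p m n] E's unfolding I_def JJ_def by blast
  have "(\<forall>u. (\<Sum>j\<in>JJ. (lin n (matvec k Z u) (\<lambda>r. \<omega> (fst j, snd j, r)))\<^sup>2) \<le> 2 * N * sqn k u) \<and>
      (\<forall>u v. v 0 = 0 \<longrightarrow> 9/10 * N * (sqn k u + sqn k z / real m * sqn h v)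
      \<le> (\<Sum>j\<in>JJ. (lin n (matvec k Z u) (\<lambda>r. \<omega> (fst j, snd j, r))
           + matvec h B v (snd j) * lin n (matvec k Z z) (\<lambda>r. \<omega> (fst j, snd j, r)))\<^sup>2))"
    if w: "\<omega> \<in> E" for \<omega>
  proof (intro conjI allI impI)
    define \<omega>' where "\<omega>' = (\<lambda>j\<in>JJ. \<lambda>r\<in>{..<n}. \<omega> (fst j, snd j, r))"
    have w': "\<omega>' \<in> E1" "\<omega>' \<in> E2" using E(3)[OF w] by (auto simp: \<omega>'_def E'_def)
    have lw: "lin n v (\<omega>' j) = lin n v (\<lambda>r. \<omega> (fst j, snd j, r))" if "j \<in> JJ" for v j
      using that by (simp add: lin_def \<omega>'_def)
    show "(\<Sum>j\<in>JJ. (lin n (matvec k Z u) (\<lambda>r. \<omega> (fst j, snd j, r)))\<^sup>2) \<le> 2 * N * sqn k u" for u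
      using E1(3)[OF w'(1), of u] by (simp add: lw cJ)
    fix u v :: "nat \<Rightarrow> real" assume v0: "v 0 = 0"
    \<comment> \<open>Undoes the normalisation in \<open>y\<close>, where the signal has unit length
      and \<open>B\<close> is scaled by sqrt m; it also produces the weight |z|^2 / m of
      \<open>Delta\<close>.\<close>
    define s where "s = zn / sqrt (real m)"
    define w where "w c = (if c < k then u c else s * v (c - k))" for c
    have a: "sqn k w = sqn k u" by (simp add: sqn_def w_def)
    have b: "(\<Sum>a<h. (w (k + a))\<^sup>2) = sqn k z / real m * sqn h v"
      using zn m0 by (simp add: w_def s_def sqn_def power_mult_distrib power_divide sum_distrib_left)
    have c: "(\<Sum>a<h. if a = 0 then 0 else (w (k + a))\<^sup>2) = (\<Sum>a<h. (w (k + a))\<^sup>2)"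
      using v0 by (intro sum.cong refl) (auto simp: w_def)
    have d: "lin n (\<lambda>r. \<Sum>c<k + h. w c * y j c r) (\<omega>' j)
      = lin n (matvec k Z u) (\<omega>' j) + matvec h B v (snd j) * lin n (matvec k Z z) (\<omega>' j)" for j
    proof -
      have "matvec k Z w = matvec k Z u" by (simp add: matvec_def w_def fun_eq_iff)
      moreover have "bt w (snd j) = s * matvec h B v (snd j)"
        unfolding bt_def matvec_def sum_distrib_left
        by (intro sum.cong refl) (auto simp: w_def B'_def v0)
      moreover have "sqrt (real m) * (s * matvec h B v (snd j)) * xh r = matvec h B v (snd j) * matvec k Z z r" for r
        using zn m0 by (simp add: s_def xh_def x_def)
      ultimately have "(\<lambda>r. \<Sum>c<k + h. w c * y j c r) = (\<lambda>r. matvec k Z u r + matvec h B v (snd j) * matvec k Z z r)"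
        unfolding comb by (simp only:)
      then show ?thesis by (simp add: lin_def algebra_simps sum.distrib sum_distrib_left)
    qed
    have "9/10 * N * (sqn k u + sqn k z / real m * sqn h v)
      = 19/20 * (\<Sum>j\<in>JJ. sqn n (\<lambda>r. \<Sum>c<k + h. w c * y j c r)) - 1/20 * real (card JJ) * sqn (k + h) w"
      unfolding total cJ sqn_split c a b by (simp add: algebra_simps)
    also have "\<dots> \<le> (\<Sum>j\<in>JJ. (lin n (\<lambda>r. \<Sum>c<k + h. w c * y j c r) (\<omega>' j))\<^sup>2)" by (rule E2(3)[OF w'(2)])
    finally show "9/10 * N * (sqn k u + sqn k z / real m * sqn h v)
      \<le> (\<Sum>j\<in>JJ. (lin n (matvec k Z u) (\<lambda>r. \<omega> (fst j, snd j, r))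
           + matvec h B v (snd j) * lin n (matvec k Z z) (\<lambda>r. \<omega> (fst j, snd j, r)))\<^sup>2)"
      unfolding d by (simp add: lw cong: sum.cong)
  qed
  note event = this
  show ?thesis
  proof (rule bexI[OF conjI E(1)])
    show "1 - 3 * N powr - t < measure (PiM I (\<lambda>_. M)) E" using E(2) pE' by simp
  qed (rule ballI, rule event)
qed

end

text \<open>Identifies the iteration with the one of \<open>blind_calibration\<close> and weakens
  its conclusion: \<eta> \<le> 1 replaces 1 - \<mu> by 1 - \<eta> \<mu>, and \<sigma>^2 \<le> c1
  \<sigma> |z| / \<eta> turns the noise terms 8 + 12 into the 20 c1 of the constant.\<close>

lemma trajectory_bound:
  fixes \<omega> :: "nat \<times> nat \<times> nat \<Rightarrow> real" and m n p k h :: nat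
    and Z B \<nu> :: "nat \<Rightarrow> nat \<Rightarrow> real" and z b :: "nat \<Rightarrow> real" and \<delta> \<rho> \<mu> c1 :: real
  defines "N \<equiv> real m * real p" and "zn \<equiv> sqrt (\<Sum>a<k. (z a)\<^sup>2)"
    and "\<sigma> \<equiv> sqrt ((\<Sum>l<p. \<Sum>i<m. (\<nu> l i)\<^sup>2) / (real m * real p))"
    and "\<eta> \<equiv> 1 - 4 * \<delta> - 31 * \<rho>"
    and "A \<equiv> \<lambda>l i r. \<omega> (l, i, r)"
  defines "y \<equiv> \<lambda>l i. matvec h B b i * matvec n (A l) (matvec k Z z) i + \<nu> l i"
  defines "f \<equiv> fs m p n k h A Z B y"
    and "\<zeta>0 \<equiv> \<lambda>a. if a < k then (1 / (real m * real p)) *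
                        (\<Sum>l<p. \<Sum>i<m. (\<Sum>r<n. A l i r * Z r a) * y l i) else 0"
    and "\<beta>0 \<equiv> \<lambda>a::nat. if a = 0 then sqrt (real m) else 0"
  defines "it \<equiv> gd_iter f k h \<mu> (real m / zn\<^sup>2) (B_rho m h B \<rho>) \<zeta>0 \<beta>0"
  defines "D \<equiv> \<lambda>j. Delta m k h z b (fst (it j)) (snd (it j))"
  assumes m1: "m \<ge> 1" and p1: "p \<ge> 1" and h1: "h \<ge> 1"
    and Bo: "\<And>a a'. a < h \<Longrightarrow> a' < h \<Longrightarrow> (\<Sum>i<m. B i a * B i a') = (if a = a' then 1 else 0)"
    and B0: "\<And>i. i < m \<Longrightarrow> B i 0 = 1 / sqrt (real m)"
    and Bperp: "\<And>a. 0 < a \<Longrightarrow> a < h \<Longrightarrow> (\<Sum>i<m. B i a) = 0"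
    and b0: "b 0 = sqrt (real m)" and g: "matvec h B b \<in> G_rho m \<rho>"
    and z: "sqn k z > 0" and \<delta>: "0 < \<delta>" and \<rho>: "\<rho> < (1 - 4 * \<delta>) / 31" and c1: "c1 > 0" and \<sigma>c: "\<sigma> \<le> c1 * zn"
    and \<mu>: "0 < \<mu>" "\<mu> < 1 / 3600 * \<eta> / real m * (if \<sigma> = 0 then 1 else min 1 (zn\<^sup>2 / \<sigma>\<^sup>2))"
    and upper: "\<And>u. (\<Sum>j\<in>{..<p}\<times>{..<m}. (lin n (matvec k Z u) (\<lambda>r. \<omega> (fst j, snd j, r)))\<^sup>2) \<le> 2 * N * sqn k u"
    and lower: "\<And>u v. v 0 = 0 \<Longrightarrow> 9/10 * N * (sqn k u + sqn k z / real m * sqn h v)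
      \<le> (\<Sum>j\<in>{..<p}\<times>{..<m}. (lin n (matvec k Z u) (\<lambda>r. \<omega> (fst j, snd j, r))
           + matvec h B v (snd j) * lin n (matvec k Z z) (\<lambda>r. \<omega> (fst j, snd j, r)))\<^sup>2)"
  shows "(\<forall>j. D j \<le> (23 + 20 * c1) * ((1 - \<eta> * \<mu>) ^ j * zn\<^sup>2 + (1 / \<eta>) * \<sigma> * zn)) \<and>
     limsup (\<lambda>j. ereal (D j)) \<le> ereal ((23 + 20 * c1) * (1 / \<eta>) * \<sigma> * zn)"
proof -
  define \<phi> where "\<phi> j c = lin n (\<lambda>r. Z r c) (\<lambda>r. \<omega> (fst j, snd j, r))" for j :: "nat \<times> nat" and c
  define \<nu>' where "\<nu>' j = \<nu> (fst j) (snd j)" for j :: "nat \<times> nat"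
  define s2 where "s2 = (\<Sum>j\<in>{..<p}\<times>{..<m}. (\<nu>' j)\<^sup>2) / real (m * p)"
  \<comment> \<open>Division by zero yields 0 in HOL, so the noiseless case receives the intended
    value 1 of the minimum separately.\<close>
  define q where "q = (if \<sigma> = 0 then 1 else min 1 (zn\<^sup>2 / \<sigma>\<^sup>2))"
  have m0: "real m > 0" "real p > 0" using m1 p1 by auto
  have zn: "zn > 0" "zn\<^sup>2 = sqn k z" using z by (auto simp: zn_def sqn_def)
  have rho0: "0 \<le> \<rho>" using g m1 unfolding G_rho_def by (auto intro: order_trans[OF abs_ge_zero])
  have eta: "0 < \<eta>" "\<eta> \<le> 1" using \<rho> \<delta> rho0 by (auto simp: \<eta>_def)
  have rho31: "\<rho> \<le> 1 / 31" using \<rho> \<delta> by simp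
  have s2_nn: "0 \<le> s2" by (simp add: s2_def sum_nonneg)
  have sig: "\<sigma>\<^sup>2 = s2" "0 \<le> \<sigma>"
  proof -
    have "s2 = (\<Sum>l<p. \<Sum>i<m. (\<nu> l i)\<^sup>2) / (real m * real p)"
      by (simp add: s2_def \<nu>'_def sum.cartesian_product case_prod_unfold)
    then show "\<sigma>\<^sup>2 = s2" "0 \<le> \<sigma>" using s2_nn by (simp_all add: \<sigma>_def)
  qed
  have q: "0 \<le> q" "q \<le> 1" "q * (s2 / sqn k z) \<le> 1"
  proof -
    show "0 \<le> q" "q \<le> 1" by (auto simp: q_def)
    show "q * (s2 / sqn k z) \<le> 1"
    proof (cases "\<sigma> = 0")
      case True then show ?thesis using sig by simp
    next
      case False
      have "q * (s2 / sqn k z) \<le> (zn\<^sup>2 / \<sigma>\<^sup>2) * (s2 / sqn k z)"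
        using s2_nn z False by (intro mult_right_mono) (auto simp: q_def)
      also have "\<dots> = 1" using False z by (simp add: zn sig(1)[symmetric])
      finally show ?thesis .
    qed
  qed
  have mu_m: "\<mu> * real m \<le> 1 / 3600 * q"
  proof -
    have "\<mu> * real m \<le> (1 / 3600 * \<eta> / real m * q) * real m"
      using \<mu>(2) m0 by (intro mult_right_mono) (auto simp: q_def)
    also have "\<dots> = 1 / 3600 * (\<eta> * q)" using m0 by simp
    also have "\<dots> \<le> 1 / 3600 * (1 * q)" using eta q by (intro mult_left_mono mult_right_mono) auto
    finally show ?thesis by simp
  qed
  have mu_small: "\<mu> * (real m * (99 + 80 * s2 / sqn k z)) \<le> 1 / 20"
  proof -
    have "\<mu> * (real m * (99 + 80 * s2 / sqn k z)) = (\<mu> * real m) * (99 + 80 * (s2 / sqn k z))" by simp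
    also have "\<dots> \<le> (1 / 3600 * q) * (99 + 80 * (s2 / sqn k z))"
      using mu_m s2_nn z by (intro mult_right_mono) auto
    also have "\<dots> = 1 / 3600 * (99 * q + 80 * (q * (s2 / sqn k z)))" by (simp add: algebra_simps)
    \<comment> \<open>Origin of 3600: 99 + 80 = 179 must not exceed 3600 / 20 = 180.\<close>
    also have "\<dots> \<le> 1 / 3600 * (99 * 1 + 80 * 1)" using q by (intro mult_left_mono add_mono) auto
    also have "\<dots> \<le> 1 / 20" by simp
    finally show ?thesis .
  qed
  have Lphi: "(\<Sum>c<k. u c * \<phi> j c) = lin n (matvec k Z u) (\<lambda>r. \<omega> (fst j, snd j, r))" for u j
    by (simp add: lin_matvec \<phi>_def)
  interpret bc: blind_calibration m p k h \<phi> B z b \<nu>' \<rho> \<mu>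
  proof
    show "(\<Sum>j\<in>{..<p}\<times>{..<m}. (\<Sum>c<k. u c * \<phi> j c)\<^sup>2) \<le> 2 * real (m * p) * sqn k u" for u
      using upper[of u] by (simp add: Lphi N_def)
    show "9/10 * real (m * p) * (sqn k u + sqn k z / real m * sqn h v)
      \<le> (\<Sum>j\<in>{..<p}\<times>{..<m}. ((\<Sum>c<k. u c * \<phi> j c) + matvec h B v (snd j) * (\<Sum>c<k. z c * \<phi> j c))\<^sup>2)"
      if "v 0 = 0" for u v
      using lower[of v u] that by (simp add: Lphi N_def)
    show "\<mu> * (real m * (99 + 80 * ((\<Sum>j\<in>{..<p}\<times>{..<m}. (\<nu>' j)\<^sup>2) / real (m * p)) / sqn k z)) \<le> 1 / 20"
      using mu_small by (simp only: s2_def)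
  qed (fact m1 p1 h1 Bo B0 Bperp b0 g rho31 z \<mu>(1))+
  have matA: "matvec n (A l) v i = lin n v (\<lambda>r. \<omega> (l, i, r))" for l v i
    by (simp add: matvec_def lin_def A_def)
  have yy: "bc.yy (l, i) = y l i" for l i
    by (simp add: bc.yy_def bc.bb_def bc.Lf_def Lphi y_def matA \<nu>'_def)
  have f: "f = bc.FF"
    unfolding f_def fs_def bc.FF_def bc.JJ_def bc.NN_def
    by (intro ext) (simp add: sum.cartesian_product case_prod_unfold bc.bb_def bc.Lf_def Lphi matA yy[symmetric])
  have z0: "\<zeta>0 = bc.z0"
    unfolding \<zeta>0_def bc.z0_def bc.JJ_def bc.NN_def
    by (intro ext) (simp add: sum.cartesian_product case_prod_unfold yy[symmetric] \<phi>_def lin_def A_def)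
  have b0': "\<beta>0 = bc.be0" by (simp add: \<beta>0_def bc.be0_def)
  have s2': "bc.s2 = s2" by (simp add: s2_def bc.s2_def bc.JJ_def bc.NN_def)
  have conv: "D j \<le> (1 - \<mu>) ^ j * (23 * zn\<^sup>2 + 8 * s2) + 12 * s2" for j
    using bc.convergence[of j] unfolding D_def it_def f z0 b0' zn(2) s2' .
  have em: "0 < \<eta> * \<mu>" "\<eta> * \<mu> \<le> \<mu>" using eta \<mu>(1) by (auto intro: mult_left_le_one_le)
  have mu1: "\<mu> \<le> 1" by (rule bc.mu_le)
  have s2c: "s2 \<le> c1 * (1 / \<eta> * \<sigma> * zn)"
  proof -
    have "s2 = \<sigma> * \<sigma>" using sig by (simp add: power2_eq_square)
    also have "\<dots> \<le> \<sigma> * (c1 * zn)" using \<sigma>c sig by (intro mult_left_mono) auto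
    also have "\<dots> \<le> (1 / \<eta>) * (\<sigma> * (c1 * zn))"
    proof -
      have "1 \<le> 1 / \<eta>" using eta by simp
      then show ?thesis using mult_right_mono[of 1 "1 / \<eta>" "\<sigma> * (c1 * zn)"] sig c1 zn by simp
    qed
    finally show ?thesis by (simp add: mult_ac)
  qed
  have w0: "0 \<le> 1 / \<eta> * \<sigma> * zn" using eta sig zn by simp
  have bound: "D j \<le> (23 + 20 * c1) * ((1 - \<eta> * \<mu>) ^ j * zn\<^sup>2 + (1 / \<eta>) * \<sigma> * zn)" for j
  proof -
    have pj: "(1 - \<mu>) ^ j \<le> (1 - \<eta> * \<mu>) ^ j" "(1 - \<mu>) ^ j \<le> 1" "0 \<le> (1 - \<mu>) ^ j"
      using em mu1 \<mu>(1) by (auto intro!: power_mono power_le_one)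
    have "D j \<le> 23 * ((1 - \<mu>) ^ j * zn\<^sup>2) + 8 * ((1 - \<mu>) ^ j * s2) + 12 * s2"
      using conv[of j] by (simp add: algebra_simps)
    also have "\<dots> \<le> 23 * ((1 - \<eta> * \<mu>) ^ j * zn\<^sup>2) + 8 * (1 * s2) + 12 * s2"
      using pj s2_nn by (intro add_mono mult_left_mono mult_right_mono) auto
    also have "\<dots> \<le> 23 * ((1 - \<eta> * \<mu>) ^ j * zn\<^sup>2) + 20 * (c1 * (1 / \<eta> * \<sigma> * zn))" using s2c by simp
    also have "\<dots> \<le> (23 + 20 * c1) * ((1 - \<eta> * \<mu>) ^ j * zn\<^sup>2) + (23 + 20 * c1) * (1 / \<eta> * \<sigma> * zn)"
    proof -
      have "0 \<le> (1 - \<eta> * \<mu>) ^ j * zn\<^sup>2" using em mu1 by simp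
      then have "0 \<le> c1 * ((1 - \<eta> * \<mu>) ^ j * zn\<^sup>2)" using c1 by simp
      then show ?thesis using w0 by (simp only: distrib_right)
    qed
    finally show ?thesis by (simp only: distrib_left)
  qed
  moreover have "limsup (\<lambda>j. ereal (D j)) \<le> ereal ((23 + 20 * c1) * (1 / \<eta>) * \<sigma> * zn)"
  proof -
    define a where "a j = (23 + 20 * c1) * ((1 - \<eta> * \<mu>) ^ j * zn\<^sup>2 + (1 / \<eta>) * \<sigma> * zn)" for j
    have L: "(\<lambda>j. (1 - \<eta> * \<mu>) ^ j) \<longlonglongrightarrow> 0"
      by (rule LIMSEQ_realpow_zero) (use em mu1 in auto)
    have "a \<longlonglongrightarrow> (23 + 20 * c1) * (0 * zn\<^sup>2 + (1 / \<eta>) * \<sigma> * zn)"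
      unfolding a_def by (intro tendsto_add tendsto_mult tendsto_const L)
    then have "(\<lambda>j. ereal (a j)) \<longlonglongrightarrow> ereal ((23 + 20 * c1) * (1 / \<eta>) * \<sigma> * zn)"
      by (simp add: mult.assoc)
    then have "limsup (\<lambda>j. ereal (a j)) = ereal ((23 + 20 * c1) * (1 / \<eta>) * \<sigma> * zn)"
      by (intro lim_imp_Limsup) auto
    moreover have "limsup (\<lambda>j. ereal (D j)) \<le> limsup (\<lambda>j. ereal (a j))"
      using bound by (intro Limsup_mono always_eventually) (auto simp: a_def)
    ultimately show ?thesis by simp
  qed
  ultimately show ?thesis by blast
qed

theorem mainTheorem12:
  shows "\<exists>c::real. c > 0 \<and>
    (\<exists>Cp :: real \<Rightarrow> real. (\<forall>c1>0. Cp c1 > 0) \<and>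
    (\<exists>K :: real \<Rightarrow> real \<Rightarrow> real. (\<forall>\<alpha> c0. K \<alpha> c0 > 0) \<and>
    (\<exists>Cpr :: real \<Rightarrow> real \<Rightarrow> real \<Rightarrow> real. (\<forall>\<alpha> c0 c1. Cpr \<alpha> c0 c1 > 0) \<and>
    (\<forall>(M :: real measure) (\<alpha>::real) (c0::real) (c1::real)
       (n::nat) (m::nat) (p::nat) (k::nat) (h::nat)
       (Z :: nat \<Rightarrow> nat \<Rightarrow> real) (B :: nat \<Rightarrow> nat \<Rightarrow> real)
       (z :: nat \<Rightarrow> real) (b :: nat \<Rightarrow> real) (\<nu> :: nat \<Rightarrow> nat \<Rightarrow> real)
       (\<delta>::real) (t::real) (\<rho>::real) (\<mu>::real).
     let x = matvec k Z z;
         g = matvec h B b;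
         zn = sqrt (\<Sum>a<k. (z a)\<^sup>2);
         \<sigma> = sqrt ((\<Sum>l<p. \<Sum>i<m. (\<nu> l i)\<^sup>2) / (real m * real p));
         \<eta> = 1 - 4 * \<delta> - 31 * \<rho>;
         \<mu>0 = c * \<eta> / real m * (if \<sigma> = 0 then 1 else min 1 (zn\<^sup>2 / \<sigma>\<^sup>2));
         P = PiM ({..<p} \<times> {..<m} \<times> {..<n}) (\<lambda>_. M)
     in
     ( \<comment> \<open>random model: X ~ M centred, unit variance, sub-Gaussian norm alpha\<close>
       prob_space M \<and> sets M = sets borel \<and>
       integrable M (\<lambda>x. x) \<and> (\<integral>x. x \<partial>M) = 0 \<and>
       integrable M (\<lambda>x. x\<^sup>2) \<and> (\<integral>x. x\<^sup>2 \<partial>M) = 1 \<and>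
       subg_set M \<noteq> {} \<and> subgaussian_norm M = \<alpha> \<and>
       c0 > 0 \<and> c1 > 0 \<and>
       \<comment> \<open>Bernoulli restriction\<close>
       ((\<integral>x. x ^ 4 \<partial>M) = 1 \<longrightarrow>
          n > 1 \<and> (\<Sum>r<n. (x r / sqrt (\<Sum>r'<n. (x r')\<^sup>2)) ^ 4) \<le> 1 - c0 / real n) \<and>
       \<comment> \<open>subspace setting\<close>
       m \<ge> 1 \<and> p \<ge> 1 \<and> h \<ge> 1 \<and>
       (\<forall>a<k. \<forall>a'<k. (\<Sum>r<n. Z r a * Z r a') = (if a = a' then 1 else 0)) \<and>
       (\<forall>a<h. \<forall>a'<h. (\<Sum>i<m. B i a * B i a') = (if a = a' then 1 else 0)) \<and>
       (\<forall>i<m. B i 0 = 1 / sqrt (real m)) \<and>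
       (\<forall>a. 0 < a \<and> a < h \<longrightarrow> (\<Sum>i<m. B i a) = 0) \<and>
       (\<exists>r<n. x r \<noteq> 0) \<and>
       b 0 = sqrt (real m) \<and> g \<in> G_rho m \<rho> \<and>
       \<comment> \<open>parameters and sample complexity\<close>
       0 < \<delta> \<and> \<delta> < 1 \<and> t \<ge> 1 \<and>
       real n \<ge> K \<alpha> c0 * t * ln (real m * real p) \<and>
       real m * real p \<ge> K \<alpha> c0 * t / \<delta>\<^sup>2 * (real k + (mu_max m h B)\<^sup>2 * real h)
            * (ln (real m * (real p + real n)))\<^sup>2 * ln (1 / \<delta>) \<and>
       \<rho> < (1 - 4 * \<delta>) / 31 \<and>
       \<sigma> \<le> c1 * zn \<and>
       0 < \<mu> \<and> \<mu> < \<mu>0)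
     \<longrightarrow>
     (\<exists>E \<in> sets P.
        measure P E > 1 - Cpr \<alpha> c0 c1 * (real m * real p) powr (- t) \<and>
        (\<forall>\<omega>\<in>E.
          let A = (\<lambda>l i r. \<omega> (l, i, r));
              y = (\<lambda>l i. g i * matvec n (A l) x i + \<nu> l i);
              f = fs m p n k h A Z B y;
              \<zeta>0 = (\<lambda>a. if a < k then (1 / (real m * real p)) *
                        (\<Sum>l<p. \<Sum>i<m. (\<Sum>r<n. A l i r * Z r a) * y l i) else 0);
              \<beta>0 = (\<lambda>a. if a = 0 then sqrt (real m) else 0);
              it = gd_iter f k h \<mu> (real m / zn\<^sup>2) (B_rho m h B \<rho>) \<zeta>0 \<beta>0;
              D = (\<lambda>j. Delta m k h z b (fst (it j)) (snd (it j)))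
          in (\<forall>j. D j \<le> Cp c1 * ((1 - \<eta> * \<mu>) ^ j * zn\<^sup>2 + (1 / \<eta>) * \<sigma> * zn)) \<and>
             limsup (\<lambda>j. ereal (D j)) \<le> ereal (Cp c1 * (1 / \<eta>) * \<sigma> * zn)))))))"
\<comment> \<open>Step size, error and probability constants come from
  \<open>trajectory_bound\<close> and \<open>good_event\<close>; \<open>2 * \<alpha>\<close> is the
  admissible level provided by \<open>subgaussian_norm_attained\<close>.\<close>
proof (rule exI[of _ "1 / 3600"], rule conjI, simp,
    rule exI[of _ "\<lambda>c1. 23 + 20 * c1"], rule conjI, simp,
    rule exI[of _ "\<lambda>\<alpha> c0. sample_size_const (2 * \<alpha>)"], rule conjI, simp add: sample_size_const_pos,
    rule exI[of _ "\<lambda>\<alpha> c0 c1. 3"], rule conjI, simp,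
    unfold Let_def, intro allI impI, elim conjE, goal_cases)
  case prems: (1 M \<alpha> c0 c1 n m p k h Z B z b \<nu> \<delta> t \<rho> \<mu>)
  note norm = subgaussian_norm_attained[OF prems(1,2,5,6,7), unfolded prems(8)]
  interpret unit_subgaussian M "2 * \<alpha>"
    by (intro unit_subgaussian.intro unit_subgaussian_axioms.intro prems)
       (use norm in \<open>auto simp: subg_set_def\<close>)
  have Zo: "(\<Sum>r<n. Z r a * Z r a') = (if a = a' then 1 else 0)" if "a < k" "a' < k" for a a'
    using prems(15) that by blast
  have Bo: "(\<Sum>i<m. B i a * B i a') = (if a = a' then 1 else 0)" if "a < h" "a' < h" for a a'
    using prems(16) that by blast
  have Bperp: "(\<Sum>i<m. B i a) = 0" if "0 < a" "a < h" for a using prems(18) that by blast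
  have B0: "B i 0 = 1 / sqrt (real m)" if "i < m" for i using prems(17) that by blast
  obtain r where r: "r < n" "matvec k Z z r \<noteq> 0" using prems(19) by blast
  then have n1: "n \<ge> 1" by simp
  have z: "sqn k z > 0"
  proof -
    have "sqn n (matvec k Z z) \<noteq> 0" using r by (auto simp: sqn_eq_0_iff)
    then show ?thesis using sqn_nonneg[of k z] sqn_matvec_orthonormal(1)[where Z = Z, OF Zo] by fastforce
  qed
  \<comment> \<open>The set \<open>G_rho\<close> is inhabited by the true gains and m \<ge> 1, so
    \<rho> cannot be negative; the upper bound on \<rho> then limits \<delta>.\<close>
  have "0 \<le> \<rho>" using prems(12,21) unfolding G_rho_def by (auto intro: order_trans[OF abs_ge_zero])
  then have \<delta>: "\<delta> < 1 / 4" using prems(27) by simp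
  obtain E where E: "E \<in> sets (PiM ({..<p} \<times> {..<m} \<times> {..<n}) (\<lambda>_. M))"
    and ev: "measure (PiM ({..<p} \<times> {..<m} \<times> {..<n}) (\<lambda>_. M)) E > 1 - 3 * (real m * real p) powr (- t) \<and>
    (\<forall>\<omega>\<in>E. (\<forall>u. (\<Sum>j\<in>{..<p} \<times> {..<m}. (lin n (matvec k Z u) (\<lambda>r. \<omega> (fst j, snd j, r)))\<^sup>2)
        \<le> 2 * (real m * real p) * sqn k u) \<and>
      (\<forall>u v. v 0 = 0 \<longrightarrow> 9/10 * (real m * real p) * (sqn k u + sqn k z / real m * sqn h v)
      \<le> (\<Sum>j\<in>{..<p} \<times> {..<m}. (lin n (matvec k Z u) (\<lambda>r. \<omega> (fst j, snd j, r))
           + matvec h B v (snd j) * lin n (matvec k Z z) (\<lambda>r. \<omega> (fst j, snd j, r)))\<^sup>2)))"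
    by (rule bexE[OF good_event[where Z = Z and B = B and z = z and k = k and \<delta> = \<delta> and t = t,
          OF prems(12,13,14) n1 Zo Bo Bperp z prems(22) \<delta> prems(24,26)]])
  show ?case
    by (rule bexI[OF conjI E], rule ev[THEN conjunct1], rule ballI,
        rule trajectory_bound[where b = b, OF prems(12,13,14) Bo B0 Bperp prems(20,21) z prems(22,27,10,28,29,30)
          ev[THEN conjunct2, rule_format, THEN conjunct1, rule_format]
          ev[THEN conjunct2, rule_format, THEN conjunct2, rule_format]])
qed

end
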